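(* There is an analytic and computable function $f:\mathbb{R}^{3}\to\mathbb{R}^{3}$ which defines a discrete-time dynamical system (by iteration of $f$) with the following properties: 1. it has a computable hyperbolic sink $s$; 2. the basin of attraction of $s$ is not computable.
   Context: Dynamical systems. For the discrete-time dynamical system defined by $f:\mathbb{R}^n\to\mathbb{R}^n$, the trajectory starting at $x_0$ is the sequence of iterates $x_0, f(x_0), f(f(x_0)),\ldots$. The basin of attraction of a fixed point $s$ (i.e. $f(s)=s$) is the set of all $x\in\mathbb{R}^n$ whose trajectory converges to $s$. A fixed point $s$ is a sink if some neighborhood of $s$ is contained in its basin of attraction; a sink $s$ is hyperbolic if all eigenvalues of the Jacobian $Df(s)$ have absolute value $<1$. The basin of attraction of a hyperbolic sink is an open set. Analytic means real analytic. Computability. An oracle for a real number $x$ is a function $\phi:\mathbb{N}\to\mathbb{Q}$ with $|x-\phi(k)|\le 2^{-k}$ for all $k\in\mathbb{N}$; an oracle for a point of $\mathbb{R}^n$ is a tuple of oracles for its coordinates. A point of $\mathbb{R}^n$ is computable if some Turing machine computes an oracle for it. A function $F:\mathbb{R}^n\to\mathbb{R}^p$ is computable if there is an oracle Turing machine which, given any oracle for any $x\in\mathbb{R}^n$ and on input $k\in\mathbb{N}$, outputs a rational vector whose coordinates approximate those of $F(x)$ with error less than $2^{-k}$. An open set $O\subseteq\mathbb{R}^n$ is computable if the distance function $d_{\mathbb{R}^n\setminus O}:\mathbb{R}^n\to\mathbb{R}$, $d_{\mathbb{R}^n\setminus O}(x)=\inf_{y\in\mathbb{R}^n\setminus O}d(x,y)$,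 is computable, where $d$ is the usual distance on $\mathbb{R}^n$. *)

theory Defs
  imports "HOL-Analysis.Analysis"
begin

section \<open>Oracle Turing machines\<close>

text \<open>
  Deterministic multi-tape oracle Turing machines. States and tape symbols are natural numbers, and
  the symbol 0 is the blank. The program is a finite table, so that only finitely many states and
  symbols occur in it. Tapes are infinite in both directions. Tape 0 is the input tape, tape 1 the
  output tape and tape 2 the oracle tape; further tapes are work tapes. The start state is 0, and a
  machine halts when no instruction is applicable.
\<close>

datatype move = MoveL | MoveR | Stay

datatype instr =
    Act nat "(nat \<times> move) list"  \<comment> \<open>next state; for each tape the symbol written and the head move\<close>
  | Query nat nat  \<comment> \<open>number of the oracle that is asked; next state\<close>

record otm =
  ntapes :: nat
  prog :: "((nat \<times> nat list) \<times> instr) list"  \<comment> \<open>keys: state, symbols under the heads\<close>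

definition wf_otm :: "otm \<Rightarrow> bool" where
  "wf_otm M \<longleftrightarrow> 3 \<le> ntapes M \<and>
     (\<forall>((q, as), ins) \<in> set (prog M). length as = ntapes M \<and>
        (case ins of Act q' ws \<Rightarrow> length ws = ntapes M | Query i q' \<Rightarrow> True))"

type_synonym tape = "(int \<Rightarrow> nat) \<times> int"  \<comment> \<open>cell contents, head position\<close>
type_synonym config = "nat \<times> tape list"

fun read_tape :: "tape \<Rightarrow> nat" where
  "read_tape (t, h) = t h"

fun act_tape :: "nat \<times> move \<Rightarrow> tape \<Rightarrow> tape" where
  "act_tape (a, m) (t, h) =
     (t(h := a), case m of MoveL \<Rightarrow> h - 1 | MoveR \<Rightarrow> h + 1 | Stay \<Rightarrow> h)"

definition word_tape :: "nat list \<Rightarrow> tape" where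
  "word_tape w = ((\<lambda>c. if 0 \<le> c \<and> c < int (length w) then w ! nat c else 0), 0)"

text \<open>
  Natural numbers are coded in unary. A rational number is coded by its representation in lowest
  terms with positive denominator: 1 is the tally symbol, 2 the minus sign, 3 the fraction bar.
  The symbol 4 terminates each entry of a rational vector.
\<close>

definition enc_nat :: "nat \<Rightarrow> nat list" where
  "enc_nat k = replicate k 1"

definition enc_rat :: "rat \<Rightarrow> nat list" where
  "enc_rat r = (case quotient_of r of (a, b) \<Rightarrow>
     (if a < 0 then [2] else []) @ enc_nat (nat \<bar>a\<bar>) @ [3] @ enc_nat (nat b))"

definition enc_rats :: "rat list \<Rightarrow> nat list" where
  "enc_rats rs = concat (map (\<lambda>r. enc_rat r @ [4]) rs)"

text \<open>
  If the oracle tape contains exactly the code of \<open>k\<close>, then a query to the oracle \<open>\<phi>s ! i\<close>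
  replaces this in one step by the code of the answer. The machine halts on malformed queries and on
  queries to oracles that are not present. Hence with the empty list of oracles it is an ordinary
  Turing machine.
\<close>

inductive step :: "otm \<Rightarrow> (nat \<Rightarrow> rat) list \<Rightarrow> config \<Rightarrow> config \<Rightarrow> bool"
  for M :: otm and \<phi>s :: "(nat \<Rightarrow> rat) list" where
  act: "map_of (prog M) (q, map read_tape ts) = Some (Act q' ws) \<Longrightarrow>
    step M \<phi>s (q, ts) (q', map2 act_tape ws ts)"
| query: "map_of (prog M) (q, map read_tape ts) = Some (Query i q') \<Longrightarrow> i < length \<phi>s \<Longrightarrow>
    fst (ts ! 2) = fst (word_tape (enc_nat k)) \<Longrightarrow>
    step M \<phi>s (q, ts) (q', ts[2 := word_tape (enc_rat ((\<phi>s ! i) k))])"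

definition init_config :: "otm \<Rightarrow> nat \<Rightarrow> config" where
  "init_config M k = (0, word_tape (enc_nat k) # replicate (ntapes M - 1) (word_tape []))"

definition outputs :: "otm \<Rightarrow> (nat \<Rightarrow> rat) list \<Rightarrow> nat \<Rightarrow> rat list \<Rightarrow> bool" where
  "outputs M \<phi>s k rs \<longleftrightarrow>
     (\<exists>q ts. (step M \<phi>s)\<^sup>*\<^sup>* (init_config M k) (q, ts) \<and>
        (\<nexists>c. step M \<phi>s (q, ts) c) \<and>
        fst (ts ! 1) = fst (word_tape (enc_rats rs)))"


section \<open>Computable points, functions and open sets\<close>

definition is_oracle :: "(nat \<Rightarrow> rat) \<Rightarrow> real \<Rightarrow> bool" where
  "is_oracle \<phi> x \<longleftrightarrow> (\<forall>k. \<bar>x - of_rat (\<phi> k)\<bar> \<le> 1 / 2 ^ k)"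

definition is_oracle_vec :: "('n \<Rightarrow> nat \<Rightarrow> rat) \<Rightarrow> real ^ 'n \<Rightarrow> bool" where
  "is_oracle_vec \<phi> x \<longleftrightarrow> (\<forall>i. is_oracle (\<phi> i) (x $ i))"

definition tuple :: "('n::{finite,linorder} \<Rightarrow> 'a) \<Rightarrow> 'a list" where
  "tuple g = map g (sorted_list_of_set UNIV)"

definition computable_point :: "real ^ 'n::{finite,linorder} \<Rightarrow> bool" where
  "computable_point x \<longleftrightarrow>
     (\<exists>M \<phi>. wf_otm M \<and> is_oracle_vec \<phi> x \<and> (\<forall>k. outputs M [] k (tuple (\<lambda>i. \<phi> i k))))"

definition computable_fun ::
    "(real ^ 'n::{finite,linorder} \<Rightarrow> real ^ 'p::{finite,linorder}) \<Rightarrow> bool" where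
  "computable_fun F \<longleftrightarrow>
     (\<exists>M. wf_otm M \<and>
        (\<forall>x \<phi>. is_oracle_vec \<phi> x \<longrightarrow>
           (\<forall>k. \<exists>r. outputs M (tuple \<phi>) k (tuple r) \<and>
                (\<forall>j. \<bar>F x $ j - of_rat (r j)\<bar> < 1 / 2 ^ k))))"

text \<open>
  The notion is meant for open \<open>U\<close>; openness is not made part of it, so that its negation says that
  the distance function is not computable. For \<open>U = UNIV\<close>, where the infimum is over the
  empty set, \<^const>\<open>infdist\<close> is constantly 0, and \<open>UNIV\<close> counts as computable.
\<close>

definition computable_open_set :: "(real ^ 'n::{finite,linorder}) set \<Rightarrow> bool" where
  "computable_open_set U \<longleftrightarrow> computable_fun (\<lambda>x. vec (infdist x (- U)) :: real ^ 1)"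


section \<open>Real analytic functions\<close>

definition real_analytic_at :: "(real ^ 'n \<Rightarrow> real ^ 'm) \<Rightarrow> real ^ 'n \<Rightarrow> bool" where
  "real_analytic_at f x \<longleftrightarrow>
     (\<exists>r>0. \<exists>c :: ('n \<Rightarrow> nat) \<Rightarrow> real ^ 'm. \<forall>y \<in> ball x r.
        ((\<lambda>\<alpha>. (\<Prod>i\<in>UNIV. (y $ i - x $ i) ^ \<alpha> i) *\<^sub>R c \<alpha>) has_sum f y) UNIV)"

definition real_analytic :: "(real ^ 'n \<Rightarrow> real ^ 'm) \<Rightarrow> bool" where
  "real_analytic f \<longleftrightarrow> (\<forall>x. real_analytic_at f x)"


section \<open>Discrete-time dynamical systems\<close>

definition basin :: "('a::topological_space \<Rightarrow> 'a) \<Rightarrow> 'a \<Rightarrow> 'a set" where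
  "basin f s = {x. (\<lambda>k. (f ^^ k) x) \<longlonglongrightarrow> s}"

definition sink :: "('a::topological_space \<Rightarrow> 'a) \<Rightarrow> 'a \<Rightarrow> bool" where
  "sink f s \<longleftrightarrow> f s = s \<and> (\<exists>U. open U \<and> s \<in> U \<and> U \<subseteq> basin f s)"

definition complex_eigenvalue :: "real ^ 'n ^ 'n \<Rightarrow> complex \<Rightarrow> bool" where
  "complex_eigenvalue A \<mu> \<longleftrightarrow> (\<exists>v. v \<noteq> 0 \<and> map_matrix of_real A *v v = \<mu> *s v)"

definition hyperbolic_sink :: "(real ^ 'n \<Rightarrow> real ^ 'n) \<Rightarrow> real ^ 'n \<Rightarrow> bool" where
  "hyperbolic_sink f s \<longleftrightarrow> sink f s \<and> f differentiable (at s) \<and>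
     (\<forall>\<mu>. complex_eigenvalue (jacobian f (at s)) \<mu> \<longrightarrow> cmod \<mu> < 1)"

end

theory Submission
  imports Defs "HOL-Complex_Analysis.Cauchy_Integral_Formula"
begin

text \<open>
  The system is one-dimensional in essence: \<open>f (x, y, z) = (g x, 0, 0)\<close> with
  \<open>g x = (\<Sum>q. V q * x\<^sup>2 / (x\<^sup>2 + (2 * (x - (q + 1))) ^ (2 * n q)))\<close>. The summand for \<open>q\<close> is close to \<open>V q\<close>
  at distance at most \<open>1/4\<close> from \<open>q + 1\<close> and negligible at distance at least \<open>3/4\<close>, so that \<open>g\<close> maps
  the ball of radius \<open>1/4\<close> around \<open>q + 1\<close> into the one around \<open>V q\<close>, while \<open>g 0 = g' 0 = 0\<close>. A
  primitive recursive \<open>V\<close> makes the orbit of \<open>\<langle>e, 0\<rangle> + 1\<close> run through the points \<open>\<langle>e, t\<rangle> + 1\<close> until a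
  decidable property of \<open>(e, t)\<close> holds, and then jump to the sink 0. The property chosen is that \<open>t\<close>
  witnesses that the \<open>e\<close>-th machine, asked for the distance of \<open>\<langle>e, 0\<rangle> + 1\<close> to the complement of the
  basin, returns a small number. As this distance is 0 or at least \<open>1/4\<close>, no machine
  computes it. The function \<open>g\<close> is computable because primitive recursive functions are, and
  real analytic because the series converges locally uniformly in a complex neighbourhood of the
  real line.
\<close>

section \<open>Register programs\<close>

text \<open>An analytic map that is constant on an interval is constant, so a discrete computation
  can only be followed with errors, and these must not accumulate although the values
  \<open>V q\<close> are unbounded. Hence the exponent \<open>n q\<close> grows with
  \<open>V q\<close>: the decay of a summand has to beat its own height. The factor 2 separates the
  two radii, since \<open>2 * abs (x - (q + 1))\<close> is at most 1/2 inside and at least 3/2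
  outside. Even exponents keep both terms of the denominator nonnegative and exclude poles on the
  real line; the shift by 1 leaves 0 free for the sink, and the numerator \<open>x^2\<close> makes 0
  attracting whatever \<open>V\<close> is.

  No recursion theorem is needed: the accepting property speaks of machine codes only and is defined
  without reference to the map, while the point at which a machine is tested depends on its code.
  That point has natural number coordinates, so the machine may be given exact constant oracles and
  can be simulated without any oracle. Spreading an unbounded search over the orbit leaves one
  bounded check for each point, which keeps \<open>V\<close> total and primitive recursive even for
  machines that never halt.\<close>

text \<open>
  Register \<open>r \<noteq> 1\<close> is kept in unary on tape \<open>r\<close>, with the head behind the last tally, so that the
  oracle tape is register 2. Tape 1 only serves for the output. \<open>Ask i j k\<close> queries the first oracle
  and adds the sign, the absolute value of the numerator and the denominator of the answer to the
  registers \<open>i\<close>, \<open>j\<close>, \<open>k\<close>.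
\<close>

datatype com =
    Inc nat | Dec nat | Emit nat | Ask nat nat nat
  | Seq com com  (infixr \<open>;;;\<close> 60) | While nat com | Cond nat com com

type_synonym store = "(nat \<Rightarrow> nat) \<times> nat list"

inductive big :: "(nat \<Rightarrow> rat) list \<Rightarrow> com \<Rightarrow> store \<Rightarrow> store \<Rightarrow> bool" for \<phi>s where
  Inc: "big \<phi>s (Inc r) (s, w) (s(r := Suc (s r)), w)"
| Dec: "big \<phi>s (Dec r) (s, w) (s(r := s r - 1), w)"
| Emit: "big \<phi>s (Emit a) (s, w) (s, w @ [a])"
| Ask: "\<phi>s \<noteq> [] \<Longrightarrow> quotient_of ((\<phi>s ! 0) (s 2)) = (a, b) \<Longrightarrow> distinct [i, j, k, 2] \<Longrightarrow>
    big \<phi>s (Ask i j k) (s, w)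
      (s(2 := 0, i := s i + (if a < 0 then 1 else 0), j := s j + nat \<bar>a\<bar>, k := s k + nat b), w)"
| Seq: "big \<phi>s c \<sigma> \<sigma>' \<Longrightarrow> big \<phi>s d \<sigma>' \<sigma>'' \<Longrightarrow> big \<phi>s (c ;;; d) \<sigma> \<sigma>''"
| WhileF: "s r = 0 \<Longrightarrow> big \<phi>s (While r c) (s, w) (s, w)"
| WhileT: "s r \<noteq> 0 \<Longrightarrow> big \<phi>s c (s, w) \<sigma>' \<Longrightarrow> big \<phi>s (While r c) \<sigma>' \<sigma>'' \<Longrightarrow>
    big \<phi>s (While r c) (s, w) \<sigma>''"
| CondT: "s r \<noteq> 0 \<Longrightarrow> big \<phi>s c (s, w) \<sigma>' \<Longrightarrow> big \<phi>s (Cond r c d) (s, w) \<sigma>'"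
| CondF: "s r = 0 \<Longrightarrow> big \<phi>s d (s, w) \<sigma>' \<Longrightarrow> big \<phi>s (Cond r c d) (s, w) \<sigma>'"


section \<open>Compilation to oracle Turing machines\<close>

datatype tinstr = Op "nat list \<Rightarrow> nat \<times> (nat \<times> move) list" | Qy nat

fun instr_of :: "tinstr \<Rightarrow> nat list \<Rightarrow> instr" where
  "instr_of (Op f) as = Act (fst (f as)) (snd (f as))"
| "instr_of (Qy q) as = Query 0 q"

text \<open>The position of an instruction in the list is its state, and each action function is
  tabulated over all words of symbols below 5, as the codings in use have the symbols 0 to 4. The
  state \<open>length code\<close> has no entry, so a run that reaches it halts.\<close>

definition otm_of :: "nat \<Rightarrow> tinstr list \<Rightarrow> otm" where
  "otm_of nt code = \<lparr>ntapes = nt, prog = map (\<lambda>k. (k, instr_of (code ! fst k) (snd k)))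
      (List.product [0..<length code] (List.n_lists nt [0..<5]))\<rparr>"

definition stay :: "nat list \<Rightarrow> (nat \<times> move) list" where
  "stay as = map (\<lambda>a. (a, Stay)) as"

text \<open>The symbol on tape \<open>r\<close> alone decides. The flag asks in addition for a tally
  on tape \<open>t\<close>, so that a loop can copy a piece of an oracle answer into a register with
  one step per symbol.\<close>

definition op :: "nat \<Rightarrow> nat \<Rightarrow> (nat \<Rightarrow> nat \<times> (nat \<times> move) \<times> bool) \<Rightarrow> tinstr" where
  "op r t g = Op (\<lambda>as. case g (as ! r) of (q, u, b) \<Rightarrow>
     (q, if b then (stay as)[r := u, t := (1, MoveR)] else (stay as)[r := u]))"

abbreviation "op1 r g \<equiv> op r r (\<lambda>a. case g a of (q, u) \<Rightarrow> (q, u, False))"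

fun clen :: "com \<Rightarrow> nat" where
  "clen (Inc r) = 1"
| "clen (Dec r) = 2"
| "clen (Emit a) = 1"
| "clen (Ask i j k) = 5"
| "clen (c ;;; d) = clen c + clen d"
| "clen (While r c) = clen c + 3"
| "clen (Cond r c d) = clen c + clen d + 3"

text \<open>The first argument is the absolute address of the code. A register head rests on the
  blank behind the tallies, so decrement and test begin with a step to the left; a blank found there
  means that the register is 0. Rewriting the symbol on tape 0 without moving is a jump. An oracle
  answer is scanned from left to right and then erased from right to left, which leaves register 2
  equal to 0.\<close>

fun comp :: "nat \<Rightarrow> com \<Rightarrow> tinstr list" where
  "comp p (Inc r) = [op1 r (\<lambda>a. (p + 1, (1, MoveR)))]"
| "comp p (Dec r) = [op1 r (\<lambda>a. (p + 1, (0, MoveL))),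
     op1 r (\<lambda>a. (p + 2, (0, if a = 1 then Stay else MoveR)))]"
| "comp p (Emit a) = [op1 1 (\<lambda>_. (p + 1, (a, MoveR)))]"
| "comp p (Ask i j k) =
    [Qy (p + 1),
     op 2 i (\<lambda>a. if a = 2 then (p + 2, (2, MoveR), True) else (p + 2, (a, Stay), False)),
     op 2 j (\<lambda>a. if a = 1 then (p + 2, (1, MoveR), True) else (p + 3, (a, MoveR), False)),
     op 2 k (\<lambda>a. if a = 1 then (p + 3, (1, MoveR), True) else (p + 4, (a, MoveL), False)),
     op1 2 (\<lambda>a. if a \<noteq> 0 then (p + 4, (0, MoveL)) else (p + 5, (0, MoveR)))]"
| "comp p (c ;;; d) = comp p c @ comp (p + clen c) d"
| "comp p (While r c) =
    [op1 r (\<lambda>a. (p + 1, (0, MoveL))),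
     op1 r (\<lambda>a. (if a = 1 then p + 2 else p + 3 + clen c, (a, MoveR)))] @
    comp (p + 2) c @ [op1 0 (\<lambda>a. (p, (a, Stay)))]"
| "comp p (Cond r c d) =
    [op1 r (\<lambda>a. (p + 1, (0, MoveL))),
     op1 r (\<lambda>a. (if a = 1 then p + 2 else p + 3 + clen c, (a, MoveR)))] @
    comp (p + 2) c @ [op1 0 (\<lambda>a. (p + 3 + clen c + clen d, (a, Stay)))] @
    comp (p + 3 + clen c) d"

lemma length_comp [simp]: "length (comp p c) = clen c"
  by (induction c arbitrary: p) auto

fun regs_below :: "nat \<Rightarrow> com \<Rightarrow> bool" where
  "regs_below n (Inc r) = (r < n \<and> r \<noteq> 1)"
| "regs_below n (Dec r) = (r < n \<and> r \<noteq> 1)"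
| "regs_below n (Emit a) = True"
| "regs_below n (Ask i j k) = (i < n \<and> i \<noteq> 1 \<and> j < n \<and> j \<noteq> 1 \<and> k < n \<and> k \<noteq> 1)"
| "regs_below n (c ;;; d) = (regs_below n c \<and> regs_below n d)"
| "regs_below n (While r c) = (r < n \<and> r \<noteq> 1 \<and> regs_below n c)"
| "regs_below n (Cond r c d) = (r < n \<and> r \<noteq> 1 \<and> regs_below n c \<and> regs_below n d)"

lemma regs_below_mono: "regs_below n c \<Longrightarrow> n \<le> m \<Longrightarrow> regs_below m c"
  by (induction c) auto

section \<open>Tapes that represent registers and output\<close>

definition reg_tape :: "nat \<Rightarrow> tape" where
  "reg_tape n = (\<lambda>z. if 0 \<le> z \<and> z < int n then 1 else 0, int n)"

definition back_tape :: "nat \<Rightarrow> tape" where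
  "back_tape n = (fst (reg_tape n), int n - 1)"

definition out_tape :: "nat list \<Rightarrow> tape" where
  "out_tape w = (fst (word_tape w), int (length w))"

fun tapes :: "nat \<Rightarrow> store \<Rightarrow> tape list" where
  "tapes nt (s, w) = map (\<lambda>r. if r = 1 then out_tape w else reg_tape (s r)) [0..<nt]"

declare tapes.simps [simp del]

lemma read_reg_tape [simp]: "read_tape (reg_tape n) = 0"
  by (simp add: reg_tape_def)

lemma read_back_tape [simp]: "read_tape (back_tape n) = (if n = 0 then 0 else 1)"
  by (simp add: back_tape_def reg_tape_def)

lemma read_out_tape [simp]: "read_tape (out_tape w) = 0"
  by (simp add: out_tape_def word_tape_def)

lemma act_reg_tape [simp]:
  "act_tape (1, MoveR) (reg_tape n) = reg_tape (Suc n)"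
  "act_tape (Suc 0, MoveR) (reg_tape n) = reg_tape (Suc n)"
  "act_tape (0, MoveL) (reg_tape n) = back_tape n"
  by (auto simp: reg_tape_def back_tape_def fun_eq_iff)

lemma act_back_tape [simp]:
  "act_tape (0, Stay) (back_tape (Suc n)) = reg_tape n"
  "act_tape (1, MoveR) (back_tape (Suc n)) = reg_tape (Suc n)"
  "act_tape (Suc 0, MoveR) (back_tape (Suc n)) = reg_tape (Suc n)"
  "act_tape (0, MoveR) (back_tape 0) = reg_tape 0"
  by (auto simp: reg_tape_def back_tape_def fun_eq_iff)

lemma act_out_tape [simp]: "act_tape (a, MoveR) (out_tape w) = out_tape (w @ [a])"
  by (auto simp: out_tape_def word_tape_def fun_eq_iff nth_append)

lemma act_read_stay [simp]: "act_tape (read_tape t, Stay) t = t"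
  by (cases t) auto

lemma length_tapes [simp]: "length (tapes nt \<sigma>) = nt"
  by (cases \<sigma>) (simp add: tapes.simps)

lemma nth_tapes [simp]:
  "r < nt \<Longrightarrow> r \<noteq> 1 \<Longrightarrow> tapes nt (s, w) ! r = reg_tape (s r)"
  "r < nt \<Longrightarrow> r \<noteq> Suc 0 \<Longrightarrow> tapes nt (s, w) ! r = reg_tape (s r)"
  "1 < nt \<Longrightarrow> tapes nt (s, w) ! 1 = out_tape w"
  "1 < nt \<Longrightarrow> tapes nt (s, w) ! Suc 0 = out_tape w"
  by (simp_all add: tapes.simps)

lemma tapes_update_reg [simp]:
  "r \<noteq> 1 \<Longrightarrow> (tapes nt (s, w))[r := reg_tape n] = tapes nt (s(r := n), w)"
  "r \<noteq> Suc 0 \<Longrightarrow> (tapes nt (s, w))[r := reg_tape n] = tapes nt (s(r := n), w)"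
  by (auto simp: tapes.simps list_eq_iff_nth_eq nth_list_update)

lemma tapes_update_out [simp]:
  "(tapes nt (s, w))[1 := out_tape v] = tapes nt (s, v)"
  "(tapes nt (s, w))[Suc 0 := out_tape v] = tapes nt (s, v)"
  by (auto simp: tapes.simps list_eq_iff_nth_eq nth_list_update)

lemma read_tapes [simp]: "t \<in> set (tapes nt \<sigma>) \<Longrightarrow> read_tape t = 0"
  by (cases \<sigma>) (auto simp: tapes.simps)

lemma map_of_prog:
  "map_of (prog (otm_of nt code)) (p, as) =
    (if p < length code \<and> length as = nt \<and> set as \<subseteq> {..<5} then Some (instr_of (code ! p) as) else None)"
  by (auto simp: otm_of_def map_of_map_restrict restrict_map_def set_n_lists atLeast0LessThan)

lemma map2_stay:
  "length ts = n \<Longrightarrow> map2 act_tape (stay (map read_tape ts)) ts = ts"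
  by (auto simp: stay_def list_eq_iff_nth_eq)

lemma map2_list_update:
  "length us = length ts \<Longrightarrow> r < length ts \<Longrightarrow>
    map2 f (us[r := u]) ts = (map2 f us ts)[r := f u (ts ! r)]"
  by (auto simp: list_eq_iff_nth_eq nth_list_update)

lemma length_stay [simp]: "length (stay as) = length as"
  by (simp add: stay_def)

text \<open>The program table only has entries for symbols below 5, so each step has to know that no
  other symbol is under a head.\<close>

definition small :: "tape list \<Rightarrow> bool" where
  "small ts \<longleftrightarrow> (\<forall>t\<in>set ts. read_tape t < 5)"

definition steps :: "otm \<Rightarrow> (nat \<Rightarrow> rat) list \<Rightarrow> config \<Rightarrow> config \<Rightarrow> bool" where
  "steps M \<phi>s = (step M \<phi>s)\<^sup>*\<^sup>*"

lemma steps_refl [simp]: "steps M \<phi>s c c"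
  by (simp add: steps_def)

lemma steps_trans [trans]: "steps M \<phi>s c c' \<Longrightarrow> steps M \<phi>s c' c'' \<Longrightarrow> steps M \<phi>s c c''"
  unfolding steps_def by (rule rtranclp_trans)

lemma stepsI: "step M \<phi>s c c' \<Longrightarrow> steps M \<phi>s c c'"
  unfolding steps_def by (rule r_into_rtranclp)

lemma step_op:
  assumes "p < length code" "code ! p = op r t g" "length ts = nt" "small ts"
    and "r < nt" "t < nt" "g (read_tape (ts ! r)) = (q, u, b)"
    and "ts' = (if b then ts[r := act_tape u (ts ! r), t := act_tape (1, MoveR) (ts ! t)]
      else ts[r := act_tape u (ts ! r)])"
  shows "steps (otm_of nt code) \<phi>s (p, ts) (q, ts')"
proof -
  let ?as = "map read_tape ts"
  have as: "set ?as \<subseteq> {..<5}" "length ?as = nt"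
    using assms(3,4) by (auto simp: small_def)
  define us where "us = (if b then (stay ?as)[r := u, t := (1, MoveR)] else (stay ?as)[r := u])"
  have "map_of (prog (otm_of nt code)) (p, ?as) = Some (Act q us)"
    using assms as by (simp add: map_of_prog op_def us_def)
  from step.act[of "otm_of nt code" p ts q us \<phi>s, OF this]
  have "step (otm_of nt code) \<phi>s (p, ts) (q, map2 act_tape us ts)" .
  moreover have "map2 act_tape us ts = ts'"
    using assms by (simp add: us_def map2_list_update map2_stay)
  ultimately show ?thesis by (simp add: stepsI)
qed

lemma step_op1:
  assumes "p < length code" "code ! p = op1 r g" "length ts = nt" "small ts"
    and "r < nt" "g (read_tape (ts ! r)) = (q, u)" "ts' = ts[r := act_tape u (ts ! r)]"
  shows "steps (otm_of nt code) \<phi>s (p, ts) (q, ts')"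
  using step_op[where b = False, OF assms(1,2,3,4,5,5)] assms(6,7) by simp

lemma small_update [simp, intro]: "read_tape t < 5 \<Longrightarrow> small ts \<Longrightarrow> small (ts[r := t])"
  unfolding small_def using set_update_subset_insert by fastforce

lemma small_tapes [simp]: "small (tapes nt \<sigma>)"
  unfolding small_def by (metis read_tapes zero_less_numeral)

subsection \<open>Oracle queries\<close>

definition scan_tape :: "nat list \<Rightarrow> nat \<Rightarrow> tape" where
  "scan_tape w i = (fst (word_tape w), int i)"

definition wipe_tape :: "nat list \<Rightarrow> tape" where
  "wipe_tape w = (fst (word_tape w), int (length w) - 1)"

lemma read_scan_tape [simp]: "read_tape (scan_tape w i) = (if i < length w then w ! i else 0)"
  by (simp add: scan_tape_def word_tape_def)

lemma read_wipe_tape [simp]: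
  "read_tape (wipe_tape (w @ [a])) = a" "read_tape (wipe_tape []) = 0"
  by (auto simp: wipe_tape_def word_tape_def nat_diff_distrib)

lemma act_scan_tape [simp]:
  "i < length w \<Longrightarrow> w ! i = a \<Longrightarrow> act_tape (a, MoveR) (scan_tape w i) = scan_tape w (Suc i)"
  "i < length w \<Longrightarrow> w ! i = a \<Longrightarrow> act_tape (a, Stay) (scan_tape w i) = scan_tape w i"
  "act_tape (0, MoveL) (scan_tape w (length w)) = wipe_tape w"
  by (auto simp: scan_tape_def wipe_tape_def word_tape_def fun_eq_iff)

lemma act_wipe_tape [simp]:
  "act_tape (0, MoveL) (wipe_tape (w @ [a])) = wipe_tape w"
  "act_tape (0, MoveR) (wipe_tape []) = reg_tape 0"
  by (auto simp: wipe_tape_def word_tape_def reg_tape_def fun_eq_iff nth_append)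

text \<open>Induction on the tallies still to be read; the part \<open>u\<close> left of the head
  grows by one tally in each step.\<close>

lemma scan_ones:
  assumes M: "M = otm_of nt code" and p: "p < length code"
    and op: "code ! p = op 2 j (\<lambda>a. if a = 1 then (p, (1, MoveR), True) else (q, (a, d), False))"
    and nt: "2 < nt" "j < nt" "j \<noteq> 1" "j \<noteq> 2"
    and w: "w = u @ replicate n 1 @ v" "\<forall>a\<in>set w. a < 5"
  shows "steps M \<phi>s (p, (tapes nt (s, x))[2 := scan_tape w (length u)])
    (p, (tapes nt (s(j := s j + n), x))[2 := scan_tape w (length u + n)])"
  using w
proof (induction n arbitrary: u s)
  case 0
  then show ?case by simp
next
  case (Suc n)
  have e1: "(s(j := Suc (s j)))(j := (s(j := Suc (s j))) j + n) = s(j := s j + Suc n)"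
    by auto
  have e2: "length (u @ [1]) + n = length u + Suc n" by simp
  have w: "w ! length u = 1" "length u < length w"
    using Suc.prems by (auto simp: nth_append)
  have "steps M \<phi>s (p, (tapes nt (s, x))[2 := scan_tape w (length u)])
     (p, (tapes nt (s(j := Suc (s j)), x))[2 := scan_tape w (length (u @ [1]))])"
    unfolding M
    apply (rule step_op[OF p op, where u = "(1, MoveR)" and b = True])
    using nt w
    apply (auto simp del: One_nat_def act_tape.simps)
    apply (auto simp: list_update_swap[of 2 j] simp del: act_tape.simps)
    done
  also have "steps M \<phi>s \<dots> (p, (tapes nt ((s(j := Suc (s j)))(j := (s(j := Suc (s j))) j + n), x))
     [2 := scan_tape w (length (u @ [1]) + n)])"
    by (rule Suc.IH) (use Suc.prems in auto)
  finally show ?case unfolding e1 e2 .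
qed

lemma wipe_word:
  assumes M: "M = otm_of nt code" and p: "p < length code"
    and op: "code ! p = op1 2 (\<lambda>a. if a \<noteq> 0 then (p, (0, MoveL)) else (q, (0, MoveR)))"
    and nt: "2 < nt" and w: "\<forall>a\<in>set w. 0 < a \<and> a < 5"
  shows "steps M \<phi>s (p, (tapes nt (s, x))[2 := wipe_tape w]) (q, tapes nt (s(2 := 0), x))"
  using w
proof (induction w rule: rev_induct)
  case Nil
  have "steps M \<phi>s (p, (tapes nt (s, x))[2 := wipe_tape []]) (q, tapes nt (s(2 := 0), x))"
    unfolding M
    by (rule step_op1[OF p op, where u = "(0, MoveR)"])
      (use nt in \<open>auto simp del: act_tape.simps\<close>)
  then show ?case .
next
  case (snoc a w)
  have "steps M \<phi>s (p, (tapes nt (s, x))[2 := wipe_tape (w @ [a])])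
      (p, (tapes nt (s, x))[2 := wipe_tape w])"
    unfolding M
    by (rule step_op1[OF p op, where u = "(0, MoveL)"])
      (use nt snoc in \<open>auto simp del: act_tape.simps\<close>)
  also have "steps M \<phi>s \<dots> (q, tapes nt (s(2 := 0), x))"
    by (rule snoc.IH) (use snoc.prems in auto)
  finally show ?case .
qed

lemma quotient_of_enc:
  "quotient_of r = (a, b) \<Longrightarrow> enc_rat r =
    (if a < 0 then [2] else []) @ replicate (nat \<bar>a\<bar>) 1 @ [3] @ replicate (nat b) 1"
  by (simp add: enc_rat_def enc_nat_def)

lemma step_comp_ask:
  assumes M: "M = otm_of nt code" and code: "code = pre @ comp (length pre) (Ask i j k) @ post"
    and \<phi>s: "\<phi>s \<noteq> []" and q: "quotient_of ((\<phi>s ! 0) (s 2)) = (a, b)"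
    and dist: "distinct [i, j, k, 2]"
    and nt: "2 < nt" "i < nt" "i \<noteq> 1" "j < nt" "j \<noteq> 1" "k < nt" "k \<noteq> 1"
  shows "steps M \<phi>s (length pre, tapes nt (s, w))
    (length pre + 5, tapes nt (s(2 := 0, i := s i + (if a < 0 then 1 else 0),
      j := s j + nat \<bar>a\<bar>, k := s k + nat b), w))"
proof -
  define p where "p = length pre"
  define sg :: "nat list" where "sg = (if a < 0 then [2] else [])"
  define v where "v = enc_rat ((\<phi>s ! 0) (s 2))"
  define n where "n = nat \<bar>a\<bar>"
  define d where "d = nat b"
  have v: "v = sg @ replicate n 1 @ [3] @ replicate d 1"
    unfolding v_def sg_def n_def d_def by (rule quotient_of_enc[OF q])
  have v': "v = (sg @ replicate n 1 @ [3]) @ replicate d 1 @ []"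
    by (simp add: v)
  have vn: "length sg + n < length v" "v ! (length sg + n) = 3"
    by (simp_all add: v nth_append)
  have v_small: "\<forall>x\<in>set v. 0 < x \<and> x < 5"
    by (auto simp: v sg_def)
  have v5: "\<forall>x\<in>set v. x < 5" using v_small by blast
  have nths: "p + 4 < length code" "code ! p = Qy (p + 1)"
    "code ! (p + 1) = op 2 i (\<lambda>a. if a = 2 then (p + 2, (2, MoveR), True) else (p + 2, (a, Stay), False))"
    "code ! (p + 2) = op 2 j (\<lambda>a. if a = 1 then (p + 2, (1, MoveR), True) else (p + 3, (a, MoveR), False))"
    "code ! (p + 3) = op 2 k (\<lambda>a. if a = 1 then (p + 3, (1, MoveR), True) else (p + 4, (a, MoveL), False))"
    "code ! (p + 4) = op1 2 (\<lambda>a. if a \<noteq> 0 then (p + 4, (0, MoveL)) else (p + 5, (0, MoveR)))"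
    unfolding code p_def by (auto simp: nth_append add_ac)
  let ?s1 = "s(i := s i + length sg)"
  let ?s2 = "?s1(j := s j + n)"
  let ?s3 = "?s2(k := s k + d)"
  have e1: "?s1(j := ?s1 j + n) = ?s2" using dist by auto
  have e2: "?s2(k := ?s2 k + d) = ?s3" using dist by auto
  have e3: "length (sg @ replicate n 1 @ [3]) + d = length v" by (simp add: v)
  have e4: "?s3(2 := 0) = s(2 := 0, i := s i + (if a < 0 then 1 else 0),
      j := s j + nat \<bar>a\<bar>, k := s k + nat b)"
    using dist by (auto simp: sg_def n_def d_def)
  have t2: "fst (tapes nt (s, w) ! 2) = fst (word_tape (enc_nat (s 2)))"
    using nt by (auto simp: reg_tape_def word_tape_def enc_nat_def fun_eq_iff nat_less_iff)
  have "map_of (prog M) (p, map read_tape (tapes nt (s, w))) = Some (Query 0 (p + 1))"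
    using nths unfolding M by (auto simp: map_of_prog)
  from stepsI[OF step.query[OF this _ t2]] \<phi>s
  have "steps M \<phi>s (p, tapes nt (s, w)) (p + 1, (tapes nt (s, w))[2 := scan_tape v 0])"
    by (simp add: v_def scan_tape_def word_tape_def)
  also have "steps M \<phi>s \<dots> (p + 2, (tapes nt (?s1, w))[2 := scan_tape v (length sg)])"
  proof (cases "a < 0")
    case True
    have v0: "v ! 0 = 2" "0 < length v" and sg: "length sg = 1" using True by (auto simp: v sg_def)
    show ?thesis unfolding M
      apply (rule step_op[where p = "p + 1" and u = "(2, MoveR)" and b = True, OF _ nths(3)])
      subgoal using nths(1) by simp
      subgoal by simp
      subgoal using v0 by (intro small_update) auto
      subgoal using nt by simp
      subgoal using nt by simp
      subgoal using nt v0 by (simp add: numeral_2_eq_2)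
      subgoal using nt v0 dist
        apply (simp add: sg del: act_tape.simps)
        apply (subst list_update_swap, simp)
        apply (simp add: sg del: act_tape.simps)
        done
      done
  next
    case False
    \<comment> \<open>Without a minus sign the answer starts with a tally or, for numerator 0, with
      the bar 3; the sign instruction then only passes control on.\<close>
    have v0: "v ! 0 \<noteq> 2" "0 < length v" using False by (cases n, auto simp: v sg_def nth_append)+
    have v1: "v ! 0 < 5" using v5 v0 nth_mem by blast
    have sg: "length sg = 0" using False by (simp add: sg_def)
    show ?thesis unfolding M
      apply (rule step_op[where p = "p + 1" and u = "(v ! 0, Stay)" and b = False, OF _ nths(3)])
      using nt nths(1) v0 v1 dist
      by (simp_all add: sg del: act_tape.simps)
  qed
  also have "steps M \<phi>s \<dots> (p + 2, (tapes nt (?s2, w))[2 := scan_tape v (length sg + n)])"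
  proof -
    have "steps M \<phi>s (p + 2, (tapes nt (?s1, w))[2 := scan_tape v (length sg)])
      (p + 2, (tapes nt (?s1(j := ?s1 j + n), w))[2 := scan_tape v (length sg + n)])"
      apply (rule scan_ones[OF M _ nths(4) _ _ _ _ v v5])
      subgoal using nths(1) by linarith
      subgoal using nt by blast
      subgoal using nt by blast
      subgoal using nt by blast
      subgoal using dist by (simp del: One_nat_def)
      done
    then show ?thesis unfolding e1 .
  qed
  also have "steps M \<phi>s (p + 2, (tapes nt (?s2, w))[2 := scan_tape v (length sg + n)])
     (p + 3, (tapes nt (?s2, w))[2 := scan_tape v (length (sg @ replicate n 1 @ [3]))])"
    unfolding M
    apply (rule step_op[where u = "(3, MoveR)" and b = False, OF _ nths(4)])
    using nt nths(1) vn
    by (simp_all del: act_tape.simps)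
  also have "steps M \<phi>s \<dots> (p + 3, (tapes nt (?s3, w))[2 := scan_tape v (length v)])"
  proof -
    have "steps M \<phi>s (p + 3, (tapes nt (?s2, w))[2 := scan_tape v (length (sg @ replicate n 1 @ [3]))])
      (p + 3, (tapes nt (?s2(k := ?s2 k + d), w))[2 := scan_tape v (length (sg @ replicate n 1 @ [3]) + d)])"
      apply (rule scan_ones[OF M _ nths(5) _ _ _ _ v' v5])
      subgoal using nths(1) by linarith
      subgoal using nt by blast
      subgoal using nt by blast
      subgoal using nt by blast
      subgoal using dist by (simp del: One_nat_def)
      done
    then show ?thesis unfolding e2 e3 .
  qed
  also have "steps M \<phi>s (p + 3, (tapes nt (?s3, w))[2 := scan_tape v (length v)])
     (p + 4, (tapes nt (?s3, w))[2 := wipe_tape v])"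
    unfolding M
    apply (rule step_op[where u = "(0, MoveL)" and b = False, OF _ nths(5)])
    using nt nths(1)
    by (simp_all del: act_tape.simps)
  also have "steps M \<phi>s \<dots> (p + 5, tapes nt (?s3(2 := 0), w))"
    by (rule wipe_word[OF M _ nths(6)]) (use nths(1) nt v_small in auto)
  finally show ?thesis unfolding e4 p_def .
qed

subsection \<open>Correctness of the compiler\<close>

lemma step_test:
  assumes M: "M = otm_of nt code" and p: "p + 1 < length code"
    and op: "code ! p = op1 r (\<lambda>a. (p + 1, (0, MoveL)))"
      "code ! (p + 1) = op1 r (\<lambda>a. (if a = 1 then q else q', (a, MoveR)))"
    and nt: "r < nt" "r \<noteq> 1"
  shows "steps M \<phi>s (p, tapes nt (s, w)) (if s r = 0 then q' else q, tapes nt (s, w))"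
proof -
  have "steps M \<phi>s (p, tapes nt (s, w)) (p + 1, (tapes nt (s, w))[r := back_tape (s r)])"
    unfolding M by (rule step_op1[OF _ op(1), where u = "(0, MoveL)"]) (use nt p in auto)
  also have "steps M \<phi>s \<dots> (if s r = 0 then q' else q, tapes nt (s, w))"
    unfolding M
    apply (rule step_op1[OF p op(2), where u = "(if s r = 0 then 0 else 1, MoveR)"])
    using nt apply (auto simp del: act_tape.simps)
    apply (metis One_nat_def act_back_tape(3) act_back_tape(4) fun_upd_triv gr0_implies_Suc neq0_conv
        tapes_update_reg(1))+
    done
  finally show ?thesis by simp
qed

lemma step_jump:
  assumes M: "M = otm_of nt code" and p: "p < length code"
    and op: "code ! p = op1 0 (\<lambda>a. (q, (a, Stay)))" and nt: "0 < nt"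
  shows "steps M \<phi>s (p, tapes nt \<sigma>) (q, tapes nt \<sigma>)"
proof -
  have "read_tape (tapes nt \<sigma> ! 0) = 0" using nt by (metis length_tapes nth_mem read_tapes)
  then have "tapes nt \<sigma> = (tapes nt \<sigma>)[0 := act_tape (0, Stay) (tapes nt \<sigma> ! 0)]"
    by (metis act_read_stay list_update_id)
  then show ?thesis
    unfolding M using \<open>read_tape (tapes nt \<sigma> ! 0) = 0\<close> p nt
    by (intro step_op1[OF p op, where u = "(0, Stay)"]) auto
qed

text \<open>The code sits in an arbitrary context \<open>pre\<close>, \<open>post\<close>, since
  jumps use absolute addresses: the length of \<open>pre\<close> is the address of the fragment.
  Under rule induction on \<open>big\<close>, the remaining rounds of a loop are an instance for the
  same context.\<close>

lemma step_comp:
  assumes "big \<phi>s c \<sigma> \<sigma>'" and "regs_below nt c" and "2 < nt"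
    and "M = otm_of nt code" and "code = pre @ comp (length pre) c @ post"
  shows "steps M \<phi>s (length pre, tapes nt \<sigma>) (length pre + clen c, tapes nt \<sigma>')"
  using assms
proof (induction arbitrary: pre post rule: big.induct)
  case (Inc r s w)
  have "steps M \<phi>s (length pre, tapes nt (s, w)) (length pre + 1, tapes nt (s(r := Suc (s r)), w))"
    unfolding Inc(3)
    by (rule step_op1[where u = "(1, MoveR)" and r = r and g = "\<lambda>a. (length pre + 1, (1, MoveR))"])
      (use Inc in \<open>auto simp: nth_append simp del: act_tape.simps\<close>)
  then show ?case by simp
next
  case (Dec r s w)
  have c: "code ! length pre = op1 r (\<lambda>a. (length pre + 1, (0, MoveL)))"
    "code ! (length pre + 1) = op1 r (\<lambda>a. (length pre + 2, (0, if a = 1 then Stay else MoveR)))"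
    using Dec(4) by (auto simp: nth_append)
  have l: "length pre + 1 < length code" using Dec(4) by auto
  have "steps M \<phi>s (length pre, tapes nt (s, w)) (length pre + 1, (tapes nt (s, w))[r := back_tape (s r)])"
    unfolding Dec(3)
    by (rule step_op1[OF _ c(1), where u = "(0, MoveL)"])
      (use Dec(1-3) l in \<open>auto simp del: act_tape.simps\<close>)
  also have "steps M \<phi>s \<dots> (length pre + 2, tapes nt (s(r := s r - 1), w))"
    unfolding Dec(3)
    apply (rule step_op1[OF l c(2), where u = "(0, if s r = 0 then MoveR else Stay)"])
    using Dec(1) apply (auto simp del: act_tape.simps)
    apply (metis act_back_tape(1) diff_Suc_1 gr0_implies_Suc tapes_update_reg(1) One_nat_def)
    done
  finally show ?case by simp
next
  case (Emit a s w)
  have "steps M \<phi>s (length pre, tapes nt (s, w)) (length pre + 1, tapes nt (s, w @ [a]))"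
    unfolding Emit(3)
    by (rule step_op1[where u = "(a, MoveR)" and r = 1 and g = "\<lambda>_. (length pre + 1, (a, MoveR))"])
      (use Emit in \<open>auto simp: nth_append simp del: act_tape.simps\<close>)
  then show ?case by simp
next
  case (Ask s a b i j k w)
  then show ?case using step_comp_ask[OF Ask(6,7)] by simp
next
  case (Seq c \<sigma> \<sigma>' d \<sigma>'')
  have "steps M \<phi>s (length pre, tapes nt \<sigma>) (length pre + clen c, tapes nt \<sigma>')"
    by (rule Seq.IH(1)) (use Seq.prems in auto)
  also have "steps M \<phi>s (length (pre @ comp (length pre) c), tapes nt \<sigma>')
     (length (pre @ comp (length pre) c) + clen d, tapes nt \<sigma>'')"
    by (rule Seq.IH(2)) (use Seq.prems in auto)
  then have "steps M \<phi>s (length pre + clen c, tapes nt \<sigma>')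
     (length pre + clen (c ;;; d), tapes nt \<sigma>'')" by (simp add: add.assoc)
  finally show ?case .
next
  case (WhileF s r c w)
  have *: "steps M \<phi>s (length pre, tapes nt (s, w))
      (if s r = 0 then length pre + 3 + clen c else length pre + 2, tapes nt (s, w))"
    by (rule step_test[OF WhileF(4)]) (use WhileF in \<open>auto simp: nth_append\<close>)
  then show ?case using WhileF(1) by (simp add: add_ac)
next
  case (WhileT s r c w \<sigma>' \<sigma>'')
  \<comment> \<open>The two test instructions are counted into the prefix of the loop body, whose
    code starts at the address \<open>length pre + 2\<close>.\<close>
  let ?pre = "pre @ take 2 (comp (length pre) (While r c))"
  have l: "length ?pre = length pre + 2" by simp
  have *: "steps M \<phi>s (length pre, tapes nt (s, w))
      (if s r = 0 then length pre + 3 + clen c else length pre + 2, tapes nt (s, w))"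
    by (rule step_test[OF WhileT.prems(3)]) (use WhileT in \<open>auto simp: nth_append\<close>)
  from * have *: "steps M \<phi>s (length pre, tapes nt (s, w)) (length ?pre, tapes nt (s, w))"
    using WhileT by simp
  note *
  also have "steps M \<phi>s (length ?pre, tapes nt (s, w)) (length ?pre + clen c, tapes nt \<sigma>')"
    by (rule WhileT.IH(1)) (use WhileT.prems in auto)
  also have "steps M \<phi>s (length ?pre + clen c, tapes nt \<sigma>') (length pre, tapes nt \<sigma>')"
    by (rule step_jump[OF WhileT.prems(3)]) (use WhileT.prems in \<open>auto simp: nth_append\<close>)
  also have "steps M \<phi>s \<dots> (length pre + clen (While r c), tapes nt \<sigma>'')"
    by (rule WhileT.IH(2)) (use WhileT.prems in auto)
  finally show ?case .
next
  case (CondT s r c w \<sigma>' d)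
  let ?pre = "pre @ take 2 (comp (length pre) (Cond r c d))"
  have l: "length ?pre = length pre + 2" by simp
  have *: "steps M \<phi>s (length pre, tapes nt (s, w))
      (if s r = 0 then length pre + 3 + clen c else length pre + 2, tapes nt (s, w))"
    by (rule step_test[OF CondT.prems(3)]) (use CondT in \<open>auto simp: nth_append\<close>)
  from * have *: "steps M \<phi>s (length pre, tapes nt (s, w)) (length ?pre, tapes nt (s, w))"
    using CondT by simp
  note *
  also have "steps M \<phi>s (length ?pre, tapes nt (s, w)) (length ?pre + clen c, tapes nt \<sigma>')"
    by (rule CondT.IH) (use CondT.prems in auto)
  also have "steps M \<phi>s (length ?pre + clen c, tapes nt \<sigma>') (length pre + clen (Cond r c d), tapes nt \<sigma>')"
    by (rule step_jump[OF CondT.prems(3)]) (use CondT.prems in \<open>auto simp: nth_append add_ac\<close>)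
  finally show ?case .
next
  case (CondF s r d w \<sigma>' c)
  let ?pre = "pre @ [op1 r (\<lambda>a. (length pre + 1, (0, MoveL))),
     op1 r (\<lambda>a. (if a = 1 then length pre + 2 else length pre + 3 + clen c, (a, MoveR)))] @
    comp (length pre + 2) c @ [op1 0 (\<lambda>a. (length pre + 3 + clen c + clen d, (a, Stay)))]"
  have l: "length ?pre = length pre + 3 + clen c" by simp
  have "code = ?pre @ comp (length pre + 3 + clen c) d @ post"
    using CondF.prems(4) by simp
  then have "steps M \<phi>s (length ?pre, tapes nt (s, w)) (length ?pre + clen d, tapes nt \<sigma>')"
    by (intro CondF.IH[where post = post]) (use CondF.prems in \<open>simp_all add: numeral_3_eq_3\<close>)
  note d = this[unfolded l]
  have "steps M \<phi>s (length pre, tapes nt (s, w))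
      (if s r = 0 then length pre + 3 + clen c else length pre + 2, tapes nt (s, w))"
    by (rule step_test[OF CondF.prems(3)]) (use CondF in \<open>auto simp: nth_append\<close>)
  also have "(if s r = 0 then length pre + 3 + clen c else length pre + 2) = length pre + 3 + clen c"
    using CondF(1) by simp
  also note d
  finally show ?case by (simp add: add_ac)
qed

text \<open>The first instruction moves the head of the input tape behind the input.\<close>

definition machine :: "nat \<Rightarrow> com \<Rightarrow> otm" where
  "machine nt c = otm_of nt (op1 0 (\<lambda>a. if a = 1 then (0, (1, MoveR)) else (1, (0, Stay))) # comp 1 c)"

lemma op_wf: "Op f = op r t g \<Longrightarrow> length (snd (f as)) = length as"
  by (auto simp: op_def split: prod.splits)

lemma comp_wf: "Op f \<in> set (comp p c) \<Longrightarrow> length (snd (f as)) = length as"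
proof (induction c arbitrary: p)
qed (auto dest: op_wf)

lemma wf_machine: "2 < nt \<Longrightarrow> wf_otm (machine nt c)"
proof -
  assume nt: "2 < nt"
  define code where "code = op1 0 (\<lambda>a. if a = 1 then (0, (1, MoveR)) else (1, (0, Stay))) # comp 1 c"
  have "length (snd (f as)) = length as" if "Op f \<in> set code" for f as
    using that comp_wf unfolding code_def by (auto dest: op_wf)
  then have "case instr_of (code ! p) as of Act q' ws \<Rightarrow> length ws = length as | Query i q' \<Rightarrow> True"
    if "p < length code" for p as
    using that nth_mem[OF that] by (cases "code ! p") auto
  then have "case x of ((q, as), ins) \<Rightarrow>
      length as = nt \<and> (case ins of Act q' ws \<Rightarrow> length ws = nt | Query i q' \<Rightarrow> True)"
    if "x \<in> set (prog (otm_of nt code))" for x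
    using that by (auto simp: otm_of_def set_n_lists)
  moreover have n: "ntapes (otm_of nt code) = nt" by (simp add: otm_of_def)
  ultimately show ?thesis
    using nt unfolding wf_otm_def machine_def code_def[symmetric] n by auto
qed

lemma outputs_machine:
  assumes big: "big \<phi>s c ((\<lambda>r. 0)(0 := k), []) (s, enc_rats rs)" and c: "regs_below nt c" and nt: "2 < nt"
  shows "outputs (machine nt c) \<phi>s k rs"
proof -
  define code where "code = op1 0 (\<lambda>a. if a = 1 then (0, (1, MoveR)) else (1, (0, Stay))) # comp 1 c"
  let ?M = "otm_of nt code"
  let ?z = "tapes nt (\<lambda>r. 0, [])"
  have init: "init_config ?M k = (0, ?z[0 := scan_tape (enc_nat k) 0])"
  proof -
    have "word_tape [] = reg_tape 0" "out_tape [] = reg_tape 0"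
      by (auto simp: word_tape_def out_tape_def reg_tape_def fun_eq_iff)
    then have "?z = replicate nt (word_tape [])"
      by (auto simp: list_eq_iff_nth_eq tapes.simps)
    moreover have "replicate nt (word_tape []) = word_tape [] # replicate (nt - 1) (word_tape [])"
      using nt by (cases nt) auto
    moreover have "ntapes ?M = nt" by (simp add: otm_of_def)
    moreover have "scan_tape (enc_nat k) 0 = word_tape (enc_nat k)"
      by (simp add: scan_tape_def word_tape_def)
    ultimately show ?thesis
      by (simp add: init_config_def del: replicate_Suc)
  qed
  have s0: "scan_tape (enc_nat k) k = reg_tape k"
    by (auto simp: scan_tape_def reg_tape_def word_tape_def enc_nat_def fun_eq_iff nat_less_iff)
  have scan: "steps ?M \<phi>s (0, ?z[0 := scan_tape (enc_nat k) 0]) (0, ?z[0 := scan_tape (enc_nat k) i])"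
    if "i \<le> k" for i
    using that
  proof (induction i)
    case (Suc i)
    have "steps ?M \<phi>s (0, ?z[0 := scan_tape (enc_nat k) i]) (0, ?z[0 := scan_tape (enc_nat k) (Suc i)])"
      by (rule step_op1[where r = 0 and u = "(1, MoveR)"
            and g = "\<lambda>a. if a = 1 then (0, (1, MoveR)) else (1, (0, Stay))"])
        (use nt Suc.prems in \<open>auto simp: code_def enc_nat_def simp del: act_tape.simps\<close>)
    with Suc show ?case by (meson Suc_leD steps_trans)
  qed simp
  note scan[OF order_refl]
  also have "steps ?M \<phi>s (0, ?z[0 := scan_tape (enc_nat k) k]) (1, tapes nt ((\<lambda>r. 0)(0 := k), []))"
  proof -
    let ?y = "tapes nt ((\<lambda>r. 0)(0 := k), [])"
    have y: "?z[0 := scan_tape (enc_nat k) k] = ?y" by (simp add: s0)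
    have r: "read_tape (?y ! 0) = 0" using nt by simp
    then have "?y = ?y[0 := act_tape (0, Stay) (?y ! 0)]"
      by (metis act_read_stay list_update_id)
    then show ?thesis
      unfolding y using r nt
      by (intro step_op1[where r = 0 and u = "(0, Stay)"
            and g = "\<lambda>a. if a = 1 then (0, (1, MoveR)) else (1, (0, Stay))"]) (auto simp: code_def)
  qed
  also have "steps ?M \<phi>s (1, tapes nt ((\<lambda>r. 0)(0 := k), [])) (length code, tapes nt (s, enc_rats rs))"
    using step_comp[OF big c nt, where code = code and post = "[]" and
      pre = "[op1 0 (\<lambda>a. if a = 1 then (0, (1, MoveR)) else (1, (0, Stay)))]"]
    by (simp add: code_def)
  finally have run: "steps ?M \<phi>s (init_config ?M k) (length code, tapes nt (s, enc_rats rs))"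
    unfolding init .
  have "\<not> step ?M \<phi>s (length code, ts) c'" for ts c'
    by (auto elim!: step.cases simp: map_of_prog)
  then show ?thesis
    unfolding outputs_def machine_def steps_def[symmetric] code_def[symmetric] using run nt
    by (intro exI[of _ "length code"] exI[of _ "tapes nt (s, enc_rats rs)"]) (auto simp: out_tape_def)
qed

section \<open>Primitive recursive functions relative to an oracle\<close>

abbreviation (input) pc :: "nat \<Rightarrow> nat \<Rightarrow> nat" where "pc a b \<equiv> prod_encode (a, b)"
abbreviation (input) p1 :: "nat \<Rightarrow> nat" where "p1 x \<equiv> fst (prod_decode x)"
abbreviation (input) p2 :: "nat \<Rightarrow> nat" where "p2 x \<equiv> snd (prod_decode x)"

definition rat_code :: "rat \<Rightarrow> nat" where
  "rat_code r = (case quotient_of r of (a, b) \<Rightarrow> pc (if a < 0 then 1 else 0) (pc (nat \<bar>a\<bar>) (nat b)))"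

text \<open>Pairing codes several arguments into one, so unary functions suffice. Iteration is the
  only recursion scheme; general primitive recursion is recovered from it in
  \<open>prec_rec\<close>.\<close>

inductive prec :: "((nat \<Rightarrow> rat) \<Rightarrow> nat \<Rightarrow> nat) \<Rightarrow> bool" where
  zero: "prec (\<lambda>\<phi> x. 0)"
| suc: "prec (\<lambda>\<phi> x. Suc x)"
| fst: "prec (\<lambda>\<phi> x. p1 x)"
| snd: "prec (\<lambda>\<phi> x. p2 x)"
| query: "prec (\<lambda>\<phi> x. rat_code (\<phi> x))"
| pair: "prec F \<Longrightarrow> prec G \<Longrightarrow> prec (\<lambda>\<phi> x. pc (F \<phi> x) (G \<phi> x))"
| comp: "prec F \<Longrightarrow> prec G \<Longrightarrow> prec (\<lambda>\<phi> x. F \<phi> (G \<phi> x))"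
| iter: "prec F \<Longrightarrow> prec (\<lambda>\<phi> x. (F \<phi> ^^ p1 x) (p2 x))"

subsection \<open>Implementation by register programs\<close>

definition move :: "nat \<Rightarrow> nat \<Rightarrow> com" where
  "move a b = While a (Dec a ;;; Inc b)"

definition copy :: "nat \<Rightarrow> nat \<Rightarrow> nat \<Rightarrow> com" where
  "copy a b t = While a (Dec a ;;; Inc b ;;; Inc t) ;;; move t a"

definition clear :: "nat \<Rightarrow> com" where
  "clear a = While a (Dec a)"

text \<open>Register \<open>m\<close> is counted down while the pairs are run through in the order
  of Cantor's enumeration: \<open>(a, b + 1)\<close> is followed by \<open>(a + 1, b)\<close>, and
  \<open>(a, 0)\<close> by \<open>(0, a + 1)\<close>.\<close>

definition unpair :: "nat \<Rightarrow> com" where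
  "unpair m = While m (Dec m ;;;
     Cond (m + 2) (Dec (m + 2) ;;; Inc (m + 1)) (move (m + 1) (m + 2) ;;; Inc (m + 2)))"

text \<open>\<open>prod_encode (a, b)\<close> is the triangular number of \<open>a + b\<close> plus
  \<open>a\<close>; the loop adds \<open>a + b\<close>, \<open>a + b - 1\<close>, and so on down to
  1.\<close>

definition mkpair :: "nat \<Rightarrow> com" where
  "mkpair m = copy (m + 1) m (m + 3) ;;; move (m + 2) (m + 1) ;;;
     While (m + 1) (copy (m + 1) m (m + 3) ;;; Dec (m + 1))"

text \<open>Lets unification build the final store of a run from the rules, and compares it with the
  intended one only at the end.\<close>

lemma big_cong: "big \<phi>s c \<sigma> \<tau> \<Longrightarrow> \<tau> = \<tau>' \<Longrightarrow> big \<phi>s c \<sigma> \<tau>'"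
  by simp

lemma big_WhileF: "s r = 0 \<Longrightarrow> s' = s \<Longrightarrow> big \<phi>s (While r c) (s, w) (s', w)"
  by (auto intro: big.WhileF)

lemma big_move: "a \<noteq> b \<Longrightarrow> big \<phi>s (move a b) (s, w) (s(a := 0, b := s b + s a), w)"
  unfolding move_def
proof (induction "s a" arbitrary: s)
  case 0
  then show ?case by (intro big_WhileF) (auto simp: fun_eq_iff)
next
  case (Suc n)
  let ?s = "s(a := s a - 1, b := Suc (s b))"
  have "big \<phi>s (Dec a ;;; Inc b) (s, w) (?s, w)"
    by (rule big_cong, (rule big.intros)+) (use Suc in auto)
  moreover have "big \<phi>s (While a (Dec a ;;; Inc b)) (?s, w) (?s(a := 0, b := ?s b + ?s a), w)"
    by (rule Suc.hyps(1)) (use Suc in auto)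
  moreover have "?s(a := 0, b := ?s b + ?s a) = s(a := 0, b := s b + s a)"
    using Suc by auto
  ultimately show ?case using Suc(2) by (metis big.WhileT nat.distinct(1))
qed

lemma big_copy_aux:
  "distinct [a, b, t] \<Longrightarrow> big \<phi>s (While a (Dec a ;;; Inc b ;;; Inc t)) (s, w)
    (s(a := 0, b := s b + s a, t := s t + s a), w)"
proof (induction "s a" arbitrary: s)
  case 0
  then show ?case by (intro big_WhileF) (auto simp: fun_eq_iff)
next
  case (Suc n)
  let ?s = "s(a := s a - 1, b := Suc (s b), t := Suc (s t))"
  have "big \<phi>s (Dec a ;;; Inc b ;;; Inc t) (s, w) (?s, w)"
    by (rule big_cong, (rule big.intros)+) (use Suc in auto)
  moreover have "big \<phi>s (While a (Dec a ;;; Inc b ;;; Inc t)) (?s, w)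
      (?s(a := 0, b := ?s b + ?s a, t := ?s t + ?s a), w)"
    by (rule Suc.hyps(1)) (use Suc in auto)
  moreover have "?s(a := 0, b := ?s b + ?s a, t := ?s t + ?s a) = s(a := 0, b := s b + s a, t := s t + s a)"
    using Suc by auto
  ultimately show ?case using Suc(2) by (metis big.WhileT nat.distinct(1))
qed

lemma big_copy:
  "distinct [a, b, t] \<Longrightarrow> s t = 0 \<Longrightarrow> big \<phi>s (copy a b t) (s, w) (s(b := s b + s a), w)"
  unfolding copy_def
  by (rule big_cong, rule big.Seq, rule big_copy_aux, simp, rule big_move) (auto simp: fun_eq_iff)

lemma big_clear: "big \<phi>s (clear a) (s, w) (s(a := 0), w)"
  unfolding clear_def
proof (induction "s a" arbitrary: s)
  case 0
  then show ?case by (intro big_WhileF) (auto simp: fun_eq_iff)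
next
  case (Suc n)
  have "big \<phi>s (While a (Dec a)) (s(a := s a - 1), w) (s(a := s a - 1, a := 0), w)"
    by (rule Suc.hyps(1)) (use Suc in auto)
  then show ?case using Suc(2) big.WhileT[OF _ big.Dec] by fastforce
qed

lemma prod_decode_Suc:
  "prod_decode (Suc n) =
    (if p2 n = 0 then (0, Suc (p1 n)) else (Suc (p1 n), p2 n - 1))"
proof -
  obtain a b where n: "prod_decode n = (a, b)" by fastforce
  then have n': "n = pc a b" by (metis prod_decode_inverse)
  have "Suc n = prod_encode (if b = 0 then (0, Suc a) else (Suc a, b - 1))"
    by (cases b) (auto simp: n' prod_encode_def)
  then show ?thesis by (simp add: n)
qed

lemma big_unpair:
  "s (m + 1) = p1 j \<Longrightarrow> s (m + 2) = p2 j \<Longrightarrow> big \<phi>s (unpair m) (s, w)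
    (s(m := 0, m + 1 := p1 (j + s m), m + 2 := p2 (j + s m)), w)"
  unfolding unpair_def
proof (induction "s m" arbitrary: s j)
  case 0
  then show ?case by (intro big_WhileF) (auto simp: fun_eq_iff)
next
  case (Suc n)
  let ?c = "Dec m ;;; Cond (m + 2) (Dec (m + 2) ;;; Inc (m + 1)) (move (m + 1) (m + 2) ;;; Inc (m + 2))"
  let ?s = "s(m := s m - 1, m + 1 := p1 (Suc j), m + 2 := p2 (Suc j))"
  have "big \<phi>s ?c (s, w) (?s, w)"
  proof (cases "s (m + 2) = 0")
    case True
    show ?thesis
      by (rule big_cong, rule big.Seq, rule big.Dec, rule big.CondF, use True in simp,
          rule big.Seq, rule big_move, simp, rule big.Inc)
        (use True Suc in \<open>auto simp: prod_decode_Suc fun_eq_iff\<close>)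
  next
    case False
    show ?thesis
      by (rule big_cong, rule big.Seq, rule big.Dec, rule big.CondT, use False in simp,
          rule big.Seq, rule big.Dec, rule big.Inc)
        (use False Suc in \<open>auto simp: prod_decode_Suc fun_eq_iff\<close>)
  qed
  moreover have "big \<phi>s (While m ?c) (?s, w)
      (?s(m := 0, m + 1 := p1 (Suc j + ?s m), m + 2 := p2 (Suc j + ?s m)), w)"
    by (rule Suc.hyps(1)) (use Suc in auto)
  moreover have "?s(m := 0, m + 1 := p1 (Suc j + ?s m), m + 2 := p2 (Suc j + ?s m)) =
     s(m := 0, m + 1 := p1 (j + s m), m + 2 := p2 (j + s m))"
    using Suc(2) by (auto simp: fun_eq_iff)
  ultimately show ?case using Suc(2) by (metis big.WhileT nat.distinct(1))
qed

lemma big_unpair_0: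
  assumes "s (m + 1) = 0" "s (m + 2) = 0"
  shows "big \<phi>s (unpair m) (s, w) (s(m := 0, m + 1 := p1 (s m), m + 2 := p2 (s m)), w)"
proof -
  have "prod_decode 0 = (0, 0)" by (simp add: prod_decode_def prod_decode_aux.simps)
  then show ?thesis using big_unpair[of s m 0] assms by simp
qed

lemma big_triangle:
  "s (m + 3) = 0 \<Longrightarrow> big \<phi>s (While (m + 1) (copy (m + 1) m (m + 3) ;;; Dec (m + 1))) (s, w)
    (s(m := s m + triangle (s (m + 1)), m + 1 := 0), w)"
proof (induction "s (m + 1)" arbitrary: s)
  case 0
  then show ?case by (intro big_WhileF) (auto simp: fun_eq_iff)
next
  case (Suc n)
  let ?c = "copy (m + 1) m (m + 3) ;;; Dec (m + 1)"
  let ?s = "s(m := s m + s (m + 1), m + 1 := s (m + 1) - 1)"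
  have "big \<phi>s ?c (s, w) (?s, w)"
    by (rule big_cong, rule big.Seq, rule big_copy, simp, rule Suc, rule big.Dec) simp
  moreover have "big \<phi>s (While (m + 1) ?c) (?s, w) (?s(m := ?s m + triangle (?s (m + 1)), m + 1 := 0), w)"
    by (rule Suc.hyps(1)) (use Suc in auto)
  moreover have "?s(m := ?s m + triangle (?s (m + 1)), m + 1 := 0) =
      s(m := s m + triangle (s (m + 1)), m + 1 := 0)"
    using Suc(2) by (cases "s (m + 1)") (auto simp: fun_eq_iff)
  ultimately show ?case using Suc(2) by (metis big.WhileT nat.distinct(1))
qed

lemma big_mkpair:
  assumes "s m = 0" "s (m + 3) = 0"
  shows "big \<phi>s (mkpair m) (s, w) (s(m := pc (s (m + 1)) (s (m + 2)), m + 1 := 0, m + 2 := 0), w)"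
  unfolding mkpair_def
  by (rule big_cong, rule big.Seq, rule big_copy, simp, rule assms, rule big.Seq, rule big_move, simp,
      rule big_triangle) (use assms in \<open>auto simp: prod_encode_def fun_eq_iff add_ac\<close>)

text \<open>A calling convention: argument and result share register \<open>m\<close>, the registers
  above it are scratch and are 0 before and after the call, and those below are preserved. Register
  2 has to be empty because it is the oracle tape.\<close>

definition realizes :: "nat \<Rightarrow> com \<Rightarrow> ((nat \<Rightarrow> rat) \<Rightarrow> nat \<Rightarrow> nat) \<Rightarrow> bool" where
  "realizes m c F \<longleftrightarrow> (\<exists>n. regs_below n c) \<and> (\<forall>\<phi>s s w. \<phi>s \<noteq> [] \<longrightarrow> s 2 = 0 \<longrightarrow> (\<forall>j>m. s j = 0) \<longrightarrow>
     big \<phi>s c (s, w) (s(m := F (\<phi>s ! 0) (s m)), w))"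

lemma realizesD:
  "realizes m c F \<Longrightarrow> \<phi>s \<noteq> [] \<Longrightarrow> s 2 = 0 \<Longrightarrow> \<forall>j>m. s j = 0 \<Longrightarrow>
     big \<phi>s c (s, w) (s(m := F (\<phi>s ! 0) (s m)), w)"
  by (simp add: realizes_def)

lemma regs_below_Seq: "\<exists>n. regs_below n c \<Longrightarrow> \<exists>n. regs_below n d \<Longrightarrow> \<exists>n. regs_below n (c ;;; d)"
  by (metis max.cobounded1 max.cobounded2 regs_below.simps(5) regs_below_mono)

lemma regs_below_While: "\<exists>n. regs_below n c \<Longrightarrow> r \<noteq> 1 \<Longrightarrow> \<exists>n. regs_below n (While r c)"
  by (metis lessI max.cobounded1 max.cobounded2 less_le_trans regs_below.simps(6) regs_below_mono)

lemma regs_below_atomic: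
  "r \<noteq> 1 \<Longrightarrow> \<exists>n. regs_below n (Inc r)"
  "r \<noteq> 1 \<Longrightarrow> \<exists>n. regs_below n (Dec r)"
  "\<exists>n. regs_below n (Emit a)"
  "i \<noteq> 1 \<Longrightarrow> j \<noteq> 1 \<Longrightarrow> k \<noteq> 1 \<Longrightarrow> \<exists>n. regs_below n (Ask i j k)"
  by (auto intro: exI[of _ "Suc r"] exI[of _ "Suc (i + j + k)"])

lemma regs_below_Cond:
  assumes "\<exists>n. regs_below n c" "\<exists>n. regs_below n d" "r \<noteq> 1"
  shows "\<exists>n. regs_below n (Cond r c d)"
proof -
  obtain n n' where "regs_below n c" "regs_below n' d" using assms by auto
  then have "regs_below (max (Suc r) (max n n')) (Cond r c d)"
    using assms(3) by (auto intro: regs_below_mono)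
  then show ?thesis ..
qed

lemmas regs_below_intros =
  regs_below_Seq regs_below_While regs_below_atomic regs_below_Cond

lemma regs_below_macros:
  "a \<noteq> 1 \<Longrightarrow> b \<noteq> 1 \<Longrightarrow> \<exists>n. regs_below n (move a b)"
  "a \<noteq> 1 \<Longrightarrow> b \<noteq> 1 \<Longrightarrow> t \<noteq> 1 \<Longrightarrow> \<exists>n. regs_below n (copy a b t)"
  "a \<noteq> 1 \<Longrightarrow> \<exists>n. regs_below n (clear a)"
  "3 \<le> m \<Longrightarrow> \<exists>n. regs_below n (unpair m)"
  "3 \<le> m \<Longrightarrow> \<exists>n. regs_below n (mkpair m)"
  unfolding move_def copy_def clear_def unpair_def mkpair_def
  by (intro regs_below_intros; simp)+

lemma realizesI:
  assumes "\<exists>n. regs_below n c"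
    and "\<And>\<phi>s s w. \<phi>s \<noteq> [] \<Longrightarrow> s 2 = 0 \<Longrightarrow> \<forall>j>m. s j = 0 \<Longrightarrow>
      \<exists>s'. big \<phi>s c (s, w) (s', w) \<and> (\<forall>j. s' j = (if j = m then F (\<phi>s ! 0) (s m) else s j))"
  shows "realizes m c F"
  unfolding realizes_def
proof (intro conjI allI impI assms(1))
  fix \<phi>s :: "(nat \<Rightarrow> rat) list" and s :: "nat \<Rightarrow> nat" and w :: "nat list"
    assume "\<phi>s \<noteq> []" "s 2 = (0::nat)" "\<forall>j>m. s j = 0"
  from assms(2)[OF this, of w] obtain s' where
    s': "big \<phi>s c (s, w) (s', w)" "\<forall>j. s' j = (if j = m then F (\<phi>s ! 0) (s m) else s j)" by blast
  then have "s' = s(m := F (\<phi>s ! 0) (s m))" by auto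
  with s' show "big \<phi>s c (s, w) (s(m := F (\<phi>s ! 0) (s m)), w)" by simp
qed

lemma big_iterate:
  assumes c: "realizes (m + 2) c F" and m: "3 \<le> m" and \<phi>s: "\<phi>s \<noteq> []"
  shows "s 2 = 0 \<Longrightarrow> \<forall>j>m + 2. s j = 0 \<Longrightarrow> big \<phi>s (While (m + 1) (Dec (m + 1) ;;; c)) (s, w)
    (s(m + 1 := 0, m + 2 := (F (\<phi>s ! 0) ^^ s (m + 1)) (s (m + 2))), w)"
proof (induction "s (m + 1)" arbitrary: s)
  case 0
  then show ?case by (intro big_WhileF) (auto simp: fun_eq_iff)
next
  case (Suc n)
  let ?s = "s(m + 1 := s (m + 1) - 1, m + 2 := F (\<phi>s ! 0) (s (m + 2)))"
  have "big \<phi>s (Dec (m + 1) ;;; c) (s, w) (?s, w)"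
    by (rule big_cong, rule big.Seq, rule big.Dec, rule realizesD[OF c \<phi>s])
      (use Suc m in auto)
  moreover have "big \<phi>s (While (m + 1) (Dec (m + 1) ;;; c)) (?s, w)
      (?s(m + 1 := 0, m + 2 := (F (\<phi>s ! 0) ^^ ?s (m + 1)) (?s (m + 2))), w)"
    by (rule Suc.hyps(1)) (use Suc m in auto)
  moreover have "?s(m + 1 := 0, m + 2 := (F (\<phi>s ! 0) ^^ ?s (m + 1)) (?s (m + 2))) =
      s(m + 1 := 0, m + 2 := (F (\<phi>s ! 0) ^^ s (m + 1)) (s (m + 2)))"
    using Suc(2) by (cases "s (m + 1)") (auto simp: fun_eq_iff funpow_swap1)
  ultimately show ?case using Suc(2) by (metis big.WhileT nat.distinct(1))
qed

text \<open>Registers 0, 1 and 2 are reserved for input, output and queries, hence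
  \<open>3 <= m\<close>. Subprograms are taken at a larger \<open>m\<close> where intermediate
  results have to survive below their scratch space.\<close>

lemma prec_realizes: "prec F \<Longrightarrow> 3 \<le> m \<Longrightarrow> \<exists>c. realizes m c F"
proof (induction arbitrary: m rule: prec.induct)
  case zero
  have "realizes m (clear m) (\<lambda>\<phi> x. 0)"
    by (rule realizesI, rule regs_below_macros) (use zero in \<open>auto intro!: exI big_clear\<close>)
  then show ?case ..
next
  case suc
  have "realizes m (Inc m) (\<lambda>\<phi> x. Suc x)"
    by (rule realizesI, rule regs_below_atomic) (use suc in \<open>auto intro!: exI big.Inc\<close>)
  then show ?case ..
next
  case fst
  have "realizes m (unpair m ;;; move (m + 1) m ;;; clear (m + 2)) (\<lambda>\<phi> x. p1 x)"
  proof (rule realizesI)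
    fix \<phi>s :: "(nat \<Rightarrow> rat) list" and s :: "nat \<Rightarrow> nat" and w :: "nat list"
    assume *: "\<phi>s \<noteq> []" "s 2 = 0" "\<forall>j>m. s j = (0::nat)"
    show "\<exists>s'. big \<phi>s (unpair m ;;; move (m + 1) m ;;; clear (m + 2)) (s, w) (s', w) \<and>
       (\<forall>j. s' j = (if j = m then p1 (s m) else s j))"
      by (rule exI, rule conjI, rule big.Seq, rule big_unpair_0, use * in simp, use * in simp,
        rule big.Seq, rule big_move, simp, rule big_clear) (use * in auto)
  qed (intro regs_below_intros regs_below_macros; use fst in \<open>simp add: realizes_def\<close>)
  then show ?case ..
next
  case snd
  have "realizes m (unpair m ;;; move (m + 2) m ;;; clear (m + 1)) (\<lambda>\<phi> x. p2 x)"
  proof (rule realizesI)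
    fix \<phi>s :: "(nat \<Rightarrow> rat) list" and s :: "nat \<Rightarrow> nat" and w :: "nat list"
    assume *: "\<phi>s \<noteq> []" "s 2 = 0" "\<forall>j>m. s j = (0::nat)"
    show "\<exists>s'. big \<phi>s (unpair m ;;; move (m + 2) m ;;; clear (m + 1)) (s, w) (s', w) \<and>
       (\<forall>j. s' j = (if j = m then p2 (s m) else s j))"
      by (rule exI, rule conjI, rule big.Seq, rule big_unpair_0, use * in simp, use * in simp,
        rule big.Seq, rule big_move, simp, rule big_clear) (use * in auto)
  qed (intro regs_below_intros regs_below_macros; use snd in \<open>simp add: realizes_def\<close>)
  then show ?case ..
next
  case query
  \<comment> \<open>The sign goes to \<open>m + 1\<close>, numerator and denominator go to
    \<open>m + 3\<close> and \<open>m + 4\<close>, which is where the two calls of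
    \<open>mkpair\<close> look for their arguments.\<close>
  let ?c = "move m 2 ;;; Ask (m + 1) (m + 3) (m + 4) ;;; mkpair (m + 2) ;;; mkpair m"
  have "realizes m ?c (\<lambda>\<phi> x. rat_code (\<phi> x))"
  proof (rule realizesI)
    fix \<phi>s :: "(nat \<Rightarrow> rat) list" and s :: "nat \<Rightarrow> nat" and w :: "nat list"
    assume *: "\<phi>s \<noteq> []" "s 2 = 0" "\<forall>j>m. s j = (0::nat)"
    obtain a b where q: "quotient_of ((\<phi>s ! 0) (s m)) = (a, b)" by fastforce
    show "\<exists>s'. big \<phi>s ?c (s, w) (s', w) \<and>
       (\<forall>j. s' j = (if j = m then rat_code ((\<phi>s ! 0) (s m)) else s j))"
      by (rule exI, rule conjI, rule big.Seq, rule big_move, use query in simp,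
        rule big.Seq, rule big.Ask, use * in simp, use * query q in simp, use query in simp,
        rule big.Seq, rule big_mkpair, use * query in simp, use * query in simp,
        rule big_mkpair)
       (use * query q in \<open>auto simp: rat_code_def eval_nat_numeral\<close>)
  qed (intro regs_below_intros regs_below_macros; use query in \<open>simp add: realizes_def\<close>)
  then show ?case ..
next
  case (pair F G)
  obtain c where c: "realizes (m + 1) c F" using pair by fastforce
  obtain d where d: "realizes (m + 2) d G" using pair by fastforce
  let ?c = "copy m (m + 1) (m + 2) ;;; c ;;; copy m (m + 2) (m + 3) ;;; d ;;; clear m ;;; mkpair m"
  have "realizes m ?c (\<lambda>\<phi> x. pc (F \<phi> x) (G \<phi> x))"
  proof (rule realizesI)
    fix \<phi>s :: "(nat \<Rightarrow> rat) list" and s :: "nat \<Rightarrow> nat" and w :: "nat list"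
    assume *: "\<phi>s \<noteq> []" "s 2 = 0" "\<forall>j>m. s j = (0::nat)"
    show "\<exists>s'. big \<phi>s ?c (s, w) (s', w) \<and>
       (\<forall>j. s' j = (if j = m then pc (F (\<phi>s ! 0) (s m)) (G (\<phi>s ! 0) (s m)) else s j))"
      by (rule exI, rule conjI, rule big.Seq, rule big_copy, simp, use * in simp,
        rule big.Seq, rule realizesD[OF c], rule *, use * pair(5) in simp, use * in simp,
        rule big.Seq, rule big_copy, simp, use * in simp,
        rule big.Seq, rule realizesD[OF d], rule *, use * pair(5) in simp, use * in simp,
        rule big.Seq, rule big_clear, rule big_mkpair) (use * in auto)
  qed (intro regs_below_intros regs_below_macros; use pair c d in \<open>simp add: realizes_def\<close>)
  then show ?case ..
next
  case (comp F G)
  obtain c where c: "realizes m c F" using comp by fastforce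
  obtain d where d: "realizes m d G" using comp by fastforce
  have "realizes m (d ;;; c) (\<lambda>\<phi> x. F \<phi> (G \<phi> x))"
  proof (rule realizesI)
    fix \<phi>s :: "(nat \<Rightarrow> rat) list" and s :: "nat \<Rightarrow> nat" and w :: "nat list"
    assume *: "\<phi>s \<noteq> []" "s 2 = 0" "\<forall>j>m. s j = (0::nat)"
    show "\<exists>s'. big \<phi>s (d ;;; c) (s, w) (s', w) \<and>
       (\<forall>j. s' j = (if j = m then F (\<phi>s ! 0) (G (\<phi>s ! 0) (s m)) else s j))"
      by (rule exI, rule conjI,
        rule big.Seq, rule realizesD[OF d], rule *, use * in simp, use * in simp,
        rule realizesD[OF c], rule *) (use * comp in auto)
  qed (intro regs_below_intros regs_below_macros; use c d in \<open>simp add: realizes_def\<close>)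
  then show ?case ..
next
  case (iter F)
  obtain c where c: "realizes (m + 2) c F" using iter by fastforce
  let ?c = "unpair m ;;; While (m + 1) (Dec (m + 1) ;;; c) ;;; move (m + 2) m"
  have "realizes m ?c (\<lambda>\<phi> x. (F \<phi> ^^ p1 x) (p2 x))"
  proof (rule realizesI)
    fix \<phi>s :: "(nat \<Rightarrow> rat) list" and s :: "nat \<Rightarrow> nat" and w :: "nat list"
    assume *: "\<phi>s \<noteq> []" "s 2 = 0" "\<forall>j>m. s j = (0::nat)"
    show "\<exists>s'. big \<phi>s ?c (s, w) (s', w) \<and>
       (\<forall>j. s' j = (if j = m then (F (\<phi>s ! 0) ^^ p1 (s m)) (p2 (s m)) else s j))"
      by (rule exI, rule conjI, rule big.Seq, rule big_unpair_0, use * in simp, use * in simp,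
        rule big.Seq, rule big_iterate[OF c iter(3)], rule *, use * iter in simp, use * in simp,
        rule big_move) (use * in auto)
  qed (intro regs_below_intros regs_below_macros; use iter c in \<open>simp add: realizes_def\<close>)
  then show ?case ..
qed

subsection \<open>Closure properties\<close>

lemma prec_cong: "prec F \<Longrightarrow> (\<And>\<phi> x. F \<phi> x = G \<phi> x) \<Longrightarrow> prec G"
proof -
  assume "prec F" "\<And>\<phi> x. F \<phi> x = G \<phi> x"
  then have "F = G" by auto
  with \<open>prec F\<close> show ?thesis by simp
qed

lemma prec_id: "prec (\<lambda>\<phi> x. x)"
  using prec.pair[OF prec.fst prec.snd] by simp

lemma prec_const: "prec (\<lambda>\<phi> x. n)"
  by (induction n) (auto intro: prec.zero prec.comp[OF prec.suc])

lemma prec_Suc: "prec F \<Longrightarrow> prec (\<lambda>\<phi> x. Suc (F \<phi> x))"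
  by (rule prec.comp[OF prec.suc])

lemma prec_fst: "prec F \<Longrightarrow> prec (\<lambda>\<phi> x. p1 (F \<phi> x))"
  by (rule prec.comp[OF prec.fst])

lemma prec_snd: "prec F \<Longrightarrow> prec (\<lambda>\<phi> x. p2 (F \<phi> x))"
  by (rule prec.comp[OF prec.snd])

lemma prec_query: "prec F \<Longrightarrow> prec (\<lambda>\<phi> x. rat_code (\<phi> (F \<phi> x)))"
  by (rule prec.comp[OF prec.query])

lemma prec_comp2:
  assumes "prec (\<lambda>\<phi> y. H \<phi> (p1 y) (p2 y))" "prec F" "prec G"
  shows "prec (\<lambda>\<phi> x. H \<phi> (F \<phi> x) (G \<phi> x))"
  using prec.comp[OF assms(1) prec.pair[OF assms(2,3)]] by simp

text \<open>The iterated value carries the argument and the counter along with the current result,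
  so that plain iteration imitates a recursion whose step depends on all three.\<close>

lemma prec_rec:
  assumes "prec N" "prec A" and H: "prec (\<lambda>\<phi> y. H \<phi> (p1 y) (p1 (p2 y)) (p2 (p2 y)))"
  shows "prec (\<lambda>\<phi> x. rec_nat (A \<phi> x) (\<lambda>i r. H \<phi> x i r) (N \<phi> x))"
proof -
  define S where "S = (\<lambda>\<phi> y. pc (p1 y) (pc (Suc (p1 (p2 y))) (H \<phi> (p1 y) (p1 (p2 y)) (p2 (p2 y)))))"
  have S: "prec S"
    unfolding S_def by (intro prec.pair prec_Suc prec_fst prec_snd prec_id H)
  have it: "(S \<phi> ^^ n) (pc x (pc 0 a)) = pc x (pc n (rec_nat a (\<lambda>i r. H \<phi> x i r) n))" for \<phi> n x a
    by (induction n) (auto simp: S_def)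
  have "prec (\<lambda>\<phi> x. pc (N \<phi> x) (pc x (pc 0 (A \<phi> x))))"
    by (intro prec.pair prec_id prec.zero assms)
  from prec_snd[OF prec_snd[OF prec.comp[OF prec.iter[OF S] this]]]
  show ?thesis by (simp add: it)
qed

lemma prec_funpow:
  assumes "prec N" "prec A" and F: "prec (\<lambda>\<phi> y. F \<phi> (p1 y) (p2 y))"
  shows "prec (\<lambda>\<phi> x. (F \<phi> x ^^ N \<phi> x) (A \<phi> x))"
proof -
  have "(f ^^ n) a = rec_nat a (\<lambda>i r. f r) n" for f :: "nat \<Rightarrow> nat" and n a
    by (induction n) auto
  moreover have "prec (\<lambda>\<phi> y. F \<phi> (p1 y) (p2 (p2 y)))"
    by (rule prec_comp2[OF F]) (intro prec_fst prec_snd prec_id)+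
  ultimately show ?thesis
    using prec_rec[OF assms(1,2), of "\<lambda>\<phi> x i r. F \<phi> x r"] by simp
qed

lemma prec_add: "prec F \<Longrightarrow> prec G \<Longrightarrow> prec (\<lambda>\<phi> x. F \<phi> x + G \<phi> x)"
proof -
  assume "prec F" "prec G"
  moreover have "a + b = (Suc ^^ a) b" for a b by simp
  ultimately show ?thesis
    using prec_funpow[of F G "\<lambda>\<phi> x. Suc"] by (simp add: prec_Suc prec_snd prec_id)
qed

lemma prec_diff: "prec F \<Longrightarrow> prec G \<Longrightarrow> prec (\<lambda>\<phi> x. F \<phi> x - G \<phi> x)"
proof -
  assume *: "prec F" "prec G"
  have pred: "prec (\<lambda>\<phi> x. x - 1)"
  proof -
    have "x - 1 = rec_nat 0 (\<lambda>i r. i) x" for x :: nat by (cases x) auto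
    then show ?thesis
      using prec_rec[OF prec_id prec.zero, of "\<lambda>\<phi> x i r. i"] by (simp add: prec_fst prec_snd prec_id)
  qed
  have "a - b = ((\<lambda>x. x - 1) ^^ b) a" for a b :: nat by (induction b) auto
  then show ?thesis
    by (intro prec_cong[OF prec_funpow[where F = "\<lambda>\<phi> x r. r - 1",
        OF *(2,1) prec.comp[OF pred prec.snd]]]) (rule sym)
qed

lemma prec_mult: "prec F \<Longrightarrow> prec G \<Longrightarrow> prec (\<lambda>\<phi> x. F \<phi> x * G \<phi> x)"
proof -
  assume *: "prec F" "prec G"
  have "prec (\<lambda>\<phi> y. G \<phi> (p1 y) + p2 y)"
    by (intro prec_add prec.comp[OF *(2)] prec_fst prec_snd prec_id)
  moreover have "a * b = ((\<lambda>x. b + x) ^^ a) 0" for a b :: nat by (induction a) auto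
  ultimately show ?thesis
    using prec_funpow[OF *(1) prec.zero, of "\<lambda>\<phi> x r. G \<phi> x + r"] by simp
qed

lemma prec_power: "prec F \<Longrightarrow> prec G \<Longrightarrow> prec (\<lambda>\<phi> x. F \<phi> x ^ G \<phi> x)"
proof -
  assume *: "prec F" "prec G"
  have "prec (\<lambda>\<phi> y. F \<phi> (p1 y) * p2 y)"
    by (intro prec_mult prec.comp[OF *(1)] prec_fst prec_snd prec_id)
  moreover have "a ^ b = ((\<lambda>x. a * x) ^^ b) 1" for a b :: nat by (induction b) auto
  ultimately show ?thesis
    using prec_funpow[OF *(2) prec_const[of 1], of "\<lambda>\<phi> x r. F \<phi> x * r"] by simp
qed

lemma prec_sum:
  assumes "prec N" "prec (\<lambda>\<phi> y. H \<phi> (p1 y) (p2 y))"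
  shows "prec (\<lambda>\<phi> x. \<Sum>i<N \<phi> x. H \<phi> x i)"
proof -
  have "(\<Sum>i<n. h i) = rec_nat 0 (\<lambda>i r. r + h i) n" for h :: "nat \<Rightarrow> nat" and n
    by (induction n) auto
  moreover have "prec (\<lambda>\<phi> y. p2 (p2 y) + H \<phi> (p1 y) (p1 (p2 y)))"
    by (intro prec_add prec_comp2[OF assms(2)] prec_fst prec_snd prec_id)
  ultimately show ?thesis
    using prec_rec[OF assms(1) prec.zero, of "\<lambda>\<phi> x i r. r + H \<phi> x i"] by simp
qed

lemma prec_not: "prec (\<lambda>\<phi> x. of_bool (P \<phi> x)) \<Longrightarrow> prec (\<lambda>\<phi> x. of_bool (\<not> P \<phi> x))"
  by (rule prec_cong[OF prec_diff[OF prec_const[of 1]]]) (auto simp: of_bool_not_iff)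

lemma prec_conj:
  "prec (\<lambda>\<phi> x. of_bool (P \<phi> x)) \<Longrightarrow> prec (\<lambda>\<phi> x. of_bool (Q \<phi> x)) \<Longrightarrow>
    prec (\<lambda>\<phi> x. of_bool (P \<phi> x \<and> Q \<phi> x))"
  using prec_mult[of "\<lambda>\<phi> x. of_bool (P \<phi> x)" "\<lambda>\<phi> x. of_bool (Q \<phi> x)"] by (simp add: of_bool_conj)

lemma prec_disj:
  "prec (\<lambda>\<phi> x. of_bool (P \<phi> x)) \<Longrightarrow> prec (\<lambda>\<phi> x. of_bool (Q \<phi> x)) \<Longrightarrow>
    prec (\<lambda>\<phi> x. of_bool (P \<phi> x \<or> Q \<phi> x))"
  using prec_not[OF prec_conj[OF prec_not prec_not, of P Q]] by simp

lemma prec_le: "prec F \<Longrightarrow> prec G \<Longrightarrow> prec (\<lambda>\<phi> x. of_bool (F \<phi> x \<le> G \<phi> x))"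
proof -
  assume *: "prec F" "prec G"
  have "of_bool (a \<le> b) = 1 - (a - b)" for a b :: nat by auto
  then show ?thesis using prec_diff[OF prec_const[of 1] prec_diff[OF *]] by simp
qed

lemma prec_less: "prec F \<Longrightarrow> prec G \<Longrightarrow> prec (\<lambda>\<phi> x. of_bool (F \<phi> x < G \<phi> x))"
  using prec_le[OF prec_Suc, of F G] by (simp add: Suc_le_eq)

lemma prec_eq: "prec F \<Longrightarrow> prec G \<Longrightarrow> prec (\<lambda>\<phi> x. of_bool (F \<phi> x = G \<phi> x))"
  using prec_conj[OF prec_le prec_le, of F G G F] by (simp add: eq_iff)

lemma prec_if:
  assumes "prec (\<lambda>\<phi> x. of_bool (P \<phi> x))" "prec F" "prec G"
  shows "prec (\<lambda>\<phi> x. if P \<phi> x then F \<phi> x else G \<phi> x)"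
proof -
  have "(if p then a else b) = of_bool p * a + of_bool (\<not> p) * b" for p and a b :: nat by auto
  then show ?thesis
    using prec_add[OF prec_mult[OF assms(1,2)] prec_mult[OF prec_not[OF assms(1)] assms(3)]] by simp
qed

lemma prec_ball:
  assumes "prec N" "prec (\<lambda>\<phi> y. of_bool (P \<phi> (p1 y) (p2 y)))"
  shows "prec (\<lambda>\<phi> x. of_bool (\<forall>i<N \<phi> x. P \<phi> x i))"
proof -
  have "(\<forall>i<n. q i) \<longleftrightarrow> (\<Sum>i<n. of_bool (\<not> q i)) = (0 :: nat)" for q and n :: nat
    by (auto simp: of_bool_eq_0_iff)
  then show ?thesis
    using prec_eq[OF prec_sum[OF assms(1) prec_not[OF assms(2)]] prec.zero] by simp
qed

lemma prec_div: 
  assumes "prec F" "prec G"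
  shows "prec (\<lambda>\<phi> x. F \<phi> x div G \<phi> x)"
proof -
  \<comment> \<open>The quotient counts the positive multiples of \<open>b\<close> up to
    \<open>a\<close>; the case \<open>b = 0\<close> is the default value of division.\<close>
  have eq: "a div b = (if b = 0 then 0 else (\<Sum>i<a. of_bool (Suc i * b \<le> a)))" for a b :: nat
  proof (cases "b = 0")
    case False
    then have "(\<Sum>i<a. of_bool (Suc i * b \<le> a)) = card {i. i < a \<and> Suc i * b \<le> a}"
      by (simp add: sum_of_bool_eq Int_def)
    also have "{i. i < a \<and> Suc i * b \<le> a} = {..<a div b}"
      proof -
      have "Suc i * b \<le> a \<longleftrightarrow> i < a div b" for i
        using False by (simp add: less_eq_div_iff_mult_less_eq flip: Suc_le_eq)
      moreover have "i < a" if "i < a div b" for i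
        using that div_le_dividend[of a b] by linarith
      ultimately show ?thesis by auto
    qed
    finally show ?thesis using False by simp
  qed simp
  have "prec (\<lambda>\<phi> x. if G \<phi> x = 0 then 0 else (\<Sum>i<F \<phi> x. of_bool (Suc i * G \<phi> x \<le> F \<phi> x)))"
    by (intro prec_if prec_eq prec_sum prec_le prec_mult prec_Suc prec_snd prec_fst prec_id prec.zero
        assms prec.comp[OF assms(1)] prec.comp[OF assms(2)])
  then show ?thesis by (simp flip: eq)
qed

lemma prec_even: "prec F \<Longrightarrow> prec (\<lambda>\<phi> x. of_bool (even (F \<phi> x)))"
proof -
  assume "prec F"
  moreover have "even a \<longleftrightarrow> 2 * (a div 2) = a" for a :: nat by presburger
  ultimately show ?thesis
    by (simp only:) (intro prec_eq prec_mult prec_div prec_const)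
qed

lemmas prec_intros =
  prec_if prec_even prec_div prec_ball prec_eq prec_less prec_le prec_disj prec_conj prec_not
  prec_sum prec_power prec_mult prec_diff prec_add prec.pair prec_snd prec_fst prec_Suc
  prec_query prec_const prec_id

subsection \<open>Machines computing rational vectors\<close>

definition emit_ones :: "nat \<Rightarrow> com" where
  "emit_ones r = While r (Dec r ;;; Emit 1)"

lemma big_emit_ones: "big \<phi>s (emit_ones r) (s, w) (s(r := 0), w @ replicate (s r) 1)"
  unfolding emit_ones_def
proof (induction "s r" arbitrary: s w)
  case 0
  then have "s(r := 0) = s" by auto
  with big.WhileF[of s r \<phi>s _ w] 0 show ?case by (metis append_Nil2 replicate_0)
next
  case (Suc n)
  let ?s = "s(r := s r - 1)"
  have "big \<phi>s (Dec r ;;; Emit 1) (s, w) (?s, w @ [1])"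
    by (rule big.Seq[OF big.Dec big.Emit])
  moreover have "big \<phi>s (While r (Dec r ;;; Emit 1)) (?s, w @ [1])
      (?s(r := 0), (w @ [1]) @ replicate (?s r) 1)"
    by (rule Suc.hyps(1)) (use Suc in auto)
  moreover have "?s(r := 0) = s(r := 0)" "(w @ [1]) @ replicate (?s r) 1 = w @ replicate (s r) 1"
    using Suc(2) by (auto simp flip: Suc(2))
  ultimately show ?case using Suc(2) by (metis big.WhileT nat.distinct(1))
qed

definition emit_zero :: com where
  "emit_zero = Emit 3 ;;; Emit 1 ;;; Emit 4"

lemma big_emit_zero: "big \<phi>s emit_zero (s, w) (s, w @ enc_rat 0 @ [4])"
  unfolding emit_zero_def
  by (rule big_cong, (rule big.intros)+) (simp add: enc_rat_def enc_nat_def)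

lemma outputs_zeros:
  "\<exists>M. wf_otm M \<and> (\<forall>\<phi>s k. outputs M \<phi>s k [0, 0, 0])"
proof (intro exI conjI allI)
  let ?c = "emit_zero ;;; emit_zero ;;; emit_zero"
  show "wf_otm (machine 3 ?c)" by (rule wf_machine) simp
  fix \<phi>s k
  show "outputs (machine 3 ?c) \<phi>s k [0, 0, 0]"
  proof (rule outputs_machine)
    let ?s = "(\<lambda>r. 0)(0 := k)"
    have "big \<phi>s ?c (?s, []) (?s, (([] @ enc_rat 0 @ [4]) @ enc_rat 0 @ [4]) @ enc_rat 0 @ [4])"
      by (rule big.Seq[OF big_emit_zero big.Seq[OF big_emit_zero big_emit_zero]])
    then show "big \<phi>s ?c (?s, []) (?s, enc_rats [0, 0, 0])"
      unfolding enc_rats_def by simp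
  qed (simp_all add: emit_zero_def)
qed

text \<open>The code of a rational is in lowest terms and the program performs no reduction, so
  \<open>F\<close> itself has to deliver the reduced numerator and denominator. This is why
  approximations will be odd numbers over powers of 2.\<close>

lemma outputs_prec:
  assumes F: "prec F"
  shows "\<exists>M. wf_otm M \<and> (\<forall>\<phi>s k r. \<phi>s \<noteq> [] \<longrightarrow>
    quotient_of r = (int (p1 (F (\<phi>s ! 0) k)), int (p2 (F (\<phi>s ! 0) k))) \<longrightarrow> outputs M \<phi>s k [r, 0, 0])"
proof -
  obtain c where c: "realizes 3 c F" using prec_realizes[OF F order_refl] by blast
  let ?c = "move 0 3 ;;; c ;;; unpair 3 ;;; emit_ones 4 ;;; Emit 3 ;;; emit_ones 5 ;;; Emit 4 ;;;
    emit_zero ;;; emit_zero"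
  have "\<exists>n. regs_below n ?c"
    unfolding emit_zero_def emit_ones_def
    by (intro regs_below_intros regs_below_macros; use c in \<open>simp add: realizes_def\<close>)
  then obtain n0 where n0: "regs_below n0 ?c" ..
  define n where "n = max n0 3"
  have n: "regs_below n ?c" "2 < n"
    unfolding n_def by (rule regs_below_mono[OF n0]) auto
  have "outputs (machine n ?c) \<phi>s k [r, 0, 0]"
    if "\<phi>s \<noteq> []" and q: "quotient_of r = (int (p1 (F (\<phi>s ! 0) k)), int (p2 (F (\<phi>s ! 0) k)))" for \<phi>s k r
    by (rule outputs_machine[OF _ n], rule big_cong, rule big.Seq, rule big_move, simp,
        rule big.Seq, rule realizesD[OF c that(1)], simp, simp,
        rule big.Seq, rule big_unpair_0, simp, simp,
        rule big.Seq, rule big_emit_ones, rule big.Seq, rule big.Emit, rule big.Seq, rule big_emit_ones,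
        rule big.Seq, rule big.Emit, rule big.Seq, rule big_emit_zero, rule big_emit_zero)
      (simp add: enc_rats_def quotient_of_enc[OF q])
  then show ?thesis using wf_machine[OF n(2)] by blast
qed

section \<open>Simulation of oracle Turing machines\<close>

text \<open>
  A memory is the code of an association list, with later entries shadowed by earlier ones and with
  default value 0. The head position of tape \<open>r\<close> is stored under the key \<open>(0, r)\<close>, the content of
  its cell \<open>z\<close> under \<open>(Suc r, z)\<close>.
\<close>

definition hdc :: "nat \<Rightarrow> nat" where "hdc l = p1 (l - 1)"
definition tlc :: "nat \<Rightarrow> nat" where "tlc l = p2 (l - 1)"

definition skip :: "nat \<Rightarrow> nat \<Rightarrow> nat" where
  "skip k l = (if l = 0 \<or> p1 (hdc l) = k then l else tlc l)"

text \<open>The code of a list bounds its length, so \<open>m\<close> rounds of \<open>skip\<close>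
  reach the first entry with key \<open>k\<close> or the end of the list. At the end
  \<open>hdc\<close> is 0, which yields the default value.\<close>

definition look :: "nat \<Rightarrow> nat \<Rightarrow> nat" where
  "look m k = p2 (hdc ((skip k ^^ m) m))"

definition put :: "nat \<Rightarrow> nat \<Rightarrow> nat \<Rightarrow> nat" where
  "put m k v = Suc (pc (pc k v) m)"

definition lnth :: "nat \<Rightarrow> nat \<Rightarrow> nat" where
  "lnth l i = hdc ((tlc ^^ i) l)"

lemma prod_decode_0 [simp]: "prod_decode 0 = (0, 0)"
  by (simp add: prod_decode_def prod_decode_aux.simps)

lemma hdc_simps [simp]: "hdc (Suc (pc x l)) = x" "hdc 0 = 0" "tlc (Suc (pc x l)) = l" "tlc 0 = 0"
  by (simp_all add: hdc_def tlc_def)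

lemma skip_iterate:
  "length xs \<le> n \<Longrightarrow> (skip k ^^ n) (list_encode xs) = list_encode (dropWhile (\<lambda>x. p1 x \<noteq> k) xs)"
proof (induction xs arbitrary: n)
  case Nil
  show ?case by (induction n) (auto simp: skip_def)
next
  case (Cons x xs)
  then obtain n' where n: "n = Suc n'" by (cases n) auto
  show ?case
  proof (cases "p1 x = k")
    case True
    have "(skip k ^^ n) (list_encode (x # xs)) = list_encode (x # xs)" for n
      by (induction n) (use True in \<open>auto simp: skip_def\<close>)
    then show ?thesis using True by simp
  next
    case False
    have "skip k (list_encode (x # xs)) = list_encode xs"
      using False by (simp add: skip_def)
    then have "(skip k ^^ n) (list_encode (x # xs)) = (skip k ^^ n') (list_encode xs)"
      by (simp add: n funpow_Suc_right del: funpow.simps list_encode.simps)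
    then show ?thesis using False Cons n by simp
  qed
qed

lemma length_le_list_encode: "length xs \<le> list_encode xs"
  by (induction xs) (auto intro: order_trans[OF _ le_prod_encode_2])

lemma look_list_encode:
  "look (list_encode xs) k = p2 (hdc (list_encode (dropWhile (\<lambda>x. p1 x \<noteq> k) xs)))"
  unfolding look_def by (subst skip_iterate[OF length_le_list_encode]) simp

lemma look_0 [simp]: "look 0 k = 0"
  using look_list_encode[of "[]" k] by simp

lemma look_put [simp]: "look (put m k v) k' = (if k' = k then v else look m k')"
  using look_list_encode[of "pc k v # list_decode m" k'] look_list_encode[of "list_decode m" k']
  by (auto simp: put_def)

text \<open>Each key in a list is less than the code of the list. Questions about nonblank cells
  thereby become bounded, hence primitive recursive.\<close>

lemma look_bound: "look m k \<noteq> 0 \<Longrightarrow> k < m"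
proof -
  have "look (list_encode xs) k \<noteq> 0 \<Longrightarrow> k < list_encode xs" for xs
  proof (induction xs)
    case (Cons x xs)
    have eq: "list_encode (x # xs) = put (list_encode xs) (p1 x) (p2 x)" by (simp add: put_def)
    show ?case
    proof (cases "k = p1 x")
      case True
      then have "k \<le> x" using le_prod_encode_1[of k "p2 x"] by simp
      then show ?thesis using le_prod_encode_1[of x "list_encode xs"] by (simp add: le_less_trans)
    next
      case False
      then have "k < list_encode xs" using Cons unfolding eq by simp
      then show ?thesis using le_prod_encode_2[of "list_encode xs" x] by simp
    qed
  qed simp
  from this[of "list_decode m"] show "look m k \<noteq> 0 \<Longrightarrow> k < m" by simp
qed

lemma lnth_list_encode: "i < length xs \<Longrightarrow> lnth (list_encode xs) i = xs ! i"
proof (induction xs arbitrary: i)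
  case (Cons x xs)
  then show ?case
    by (cases i) (auto simp: lnth_def funpow_swap1 simp del: funpow.simps(2) simp add: funpow_Suc_right)
qed simp

lemma prec_hdc: "prec F \<Longrightarrow> prec (\<lambda>\<phi> x. hdc (F \<phi> x))"
  unfolding hdc_def by (intro prec_intros)

lemma prec_tlc: "prec F \<Longrightarrow> prec (\<lambda>\<phi> x. tlc (F \<phi> x))"
  unfolding tlc_def by (intro prec_intros)

lemma prec_look:
  assumes "prec M" "prec K" shows "prec (\<lambda>\<phi> x. look (M \<phi> x) (K \<phi> x))"
proof -
  have "prec (\<lambda>\<phi> x. look (p1 x) (p2 x))"
    unfolding look_def skip_def by (intro prec_intros prec_funpow prec_hdc prec_tlc)
  from prec_comp2[where H = "\<lambda>\<phi>. look", OF this assms] show ?thesis .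
qed

lemma prec_put:
  "prec M \<Longrightarrow> prec K \<Longrightarrow> prec V \<Longrightarrow> prec (\<lambda>\<phi> x. put (M \<phi> x) (K \<phi> x) (V \<phi> x))"
  unfolding put_def by (intro prec_intros)

lemma prec_lnth:
  assumes "prec L" "prec I" shows "prec (\<lambda>\<phi> x. lnth (L \<phi> x) (I \<phi> x))"
proof -
  have "prec (\<lambda>\<phi> x. lnth (p1 x) (p2 x))"
    unfolding lnth_def by (intro prec_intros prec_funpow prec_hdc prec_tlc)
  from prec_comp2[where H = "\<lambda>\<phi>. lnth", OF this assms] show ?thesis .
qed

subsection \<open>Tapes in memory\<close>

definition hpos :: "nat \<Rightarrow> nat \<Rightarrow> nat" where "hpos m r = look m (pc 0 r)"
definition cell :: "nat \<Rightarrow> nat \<Rightarrow> nat \<Rightarrow> nat" where "cell m r z = look m (pc (Suc r) z)"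

definition stored :: "tape list \<Rightarrow> nat \<Rightarrow> bool" where
  "stored ts m \<longleftrightarrow> (\<forall>r<length ts. int_encode (snd (ts ! r)) = hpos m r \<and>
     (\<forall>z. fst (ts ! r) z = cell m r (int_encode z)))"

definition reads :: "nat \<Rightarrow> nat \<Rightarrow> nat" where
  "reads n m = rec_nat 0 (\<lambda>i acc. Suc (pc (cell m (n - Suc i) (hpos m (n - Suc i))) acc)) n"

text \<open>Moves by one cell on codes of integers: \<open>int_encode\<close> sends
  \<open>i >= 0\<close> to \<open>2 * i\<close> and -1, -2, ... to 1, 3, ..., so the irregular
  passages are those between the codes 0 and 1.\<close>

definition shift :: "nat \<Rightarrow> nat \<Rightarrow> nat" where
  "shift d z = (if d = 0 then (if even z then (if z = 0 then 1 else z - 2) else z + 2)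
     else if d = 1 then (if even z then z + 2 else if z = 1 then 0 else z - 2) else z)"

fun move_code :: "move \<Rightarrow> nat" where
  "move_code MoveL = 0" | "move_code MoveR = 1" | "move_code Stay = 2"

definition acts :: "nat \<Rightarrow> nat \<Rightarrow> nat \<Rightarrow> nat" where
  "acts n ws m = rec_nat m (\<lambda>r m'. put (put m' (pc (Suc r) (hpos m r)) (p1 (lnth ws r)))
     (pc 0 r) (shift (p2 (lnth ws r)) (hpos m r))) n"

definition qlen :: "nat \<Rightarrow> nat" where
  "qlen m = (\<Sum>z<m. of_bool (cell m 2 z \<noteq> 0))"

text \<open>The only candidate for the length of a tally word is the number \<open>qlen m\<close> of
  nonblank cells, and by \<open>look_bound\<close> the cells with codes from \<open>m\<close> on are
  blank, so a bounded test is enough.\<close>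

definition valid_query :: "nat \<Rightarrow> bool" where
  "valid_query m \<longleftrightarrow> (\<forall>z<m. cell m 2 z = of_bool (even z \<and> z div 2 < qlen m))"

text \<open>The content of the cell with code \<open>z\<close> of \<open>word_tape (enc_rat (of_nat v))\<close>.\<close>

definition answer_cell :: "nat \<Rightarrow> nat \<Rightarrow> nat" where
  "answer_cell v z = (if even z then (if z div 2 = v then 3 else of_bool (z div 2 \<le> Suc v)) else 0)"

text \<open>The rewritten range covers the old nonblank cells, whose codes are below
  \<open>m\<close>, and the new word, whose last symbol is in cell \<open>v + 1\<close> with code
  \<open>2 * v + 2\<close>.\<close>

definition answer :: "nat \<Rightarrow> nat \<Rightarrow> nat" where
  "answer v m = put (rec_nat m (\<lambda>z m'. put m' (pc 3 z) (answer_cell v z)) (m + 2 * v + 5)) (pc 0 2) 0"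

lemma int_encode_simps:
  "int_encode (int n) = 2 * n" "i < 0 \<Longrightarrow> odd (int_encode i)" "0 \<le> i \<Longrightarrow> int_encode i = 2 * nat i"
  by (auto simp: int_encode_def sum_encode_def)

lemma shift_int_encode:
  "shift (move_code d) (int_encode i) =
     int_encode (case d of MoveL \<Rightarrow> i - 1 | MoveR \<Rightarrow> i + 1 | Stay \<Rightarrow> i)"
  by (cases d) (auto simp: shift_def int_encode_def sum_encode_def nat_add_distrib nat_diff_distrib)

lemma reads_stored:
  assumes "stored ts m"
  shows "reads (length ts) m = list_encode (map read_tape ts)"
proof -
  let ?h = "\<lambda>i acc. Suc (pc (cell m (length ts - Suc i) (hpos m (length ts - Suc i))) acc)"
  have "k \<le> length ts \<Longrightarrow> rec_nat 0 ?h k = list_encode (map read_tape (drop (length ts - k) ts))" for k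
  proof (induction k)
    case (Suc k)
    let ?r = "length ts - Suc k"
    have r: "?r < length ts" and r': "length ts - k = Suc ?r" using Suc.prems by auto
    have "read_tape (ts ! ?r) = cell m ?r (hpos m ?r)"
      using assms r unfolding stored_def by (cases "ts ! ?r") auto
    moreover have "drop ?r ts = ts ! ?r # drop (length ts - k) ts"
      unfolding r' by (rule Cons_nth_drop_Suc[OF r, symmetric])
    ultimately show ?case using Suc by simp
  qed simp
  from this[OF order_refl] show ?thesis by (simp add: reads_def)
qed

lemma look_acts:
  "look (acts n ws m) (pc 0 r) =
     (if r < n then shift (p2 (lnth ws r)) (hpos m r) else hpos m r)"
  "look (acts n ws m) (pc (Suc r) z) =
     (if r < n \<and> z = hpos m r then p1 (lnth ws r) else cell m r z)"
  by (induction n) (auto simp: acts_def hpos_def cell_def)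

lemma acts_stored:
  assumes "stored ts m" "length ws = length ts"
  shows "stored (map2 act_tape ws ts)
    (acts (length ts) (list_encode (map (\<lambda>(a, d). pc a (move_code d)) ws)) m)"
  unfolding stored_def
proof (intro allI impI)
  fix r assume "r < length (map2 act_tape ws ts)"
  then have r: "r < length ts" "r < length ws" using assms(2) by auto
  obtain t h where t: "ts ! r = (t, h)" by fastforce
  obtain a d where a: "ws ! r = (a, d)" by fastforce
  have st: "int_encode h = hpos m r" "\<And>z. t z = cell m r (int_encode z)"
    using assms(1) r t unfolding stored_def by auto
  have w: "lnth (list_encode (map (\<lambda>(a, d). pc a (move_code d)) ws)) r = pc a (move_code d)"
    using r a by (simp add: lnth_list_encode)
  show "int_encode (snd (map2 act_tape ws ts ! r)) =
      hpos (acts (length ts) (list_encode (map (\<lambda>(a, d). pc a (move_code d)) ws)) m) r \<and>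
    (\<forall>z. fst (map2 act_tape ws ts ! r) z =
      cell (acts (length ts) (list_encode (map (\<lambda>(a, d). pc a (move_code d)) ws)) m) r (int_encode z))"
    using r t a st by (simp add: hpos_def[of "acts _ _ _"] cell_def[of "acts _ _ _"] look_acts w
      flip: shift_int_encode st(1)) (auto simp: int_encode_eq)
qed

lemma cell_bound: "cell m r z \<noteq> 0 \<Longrightarrow> z < m"
  unfolding cell_def using look_bound le_prod_encode_2 le_less_trans by blast

lemma word_tape_enc_nat:
  "fst (word_tape (enc_nat k)) z = of_bool (even (int_encode z) \<and> int_encode z div 2 < k)"
  by (cases "0 \<le> z") (auto simp: word_tape_def enc_nat_def int_encode_simps)

lemma qlen_eq:
  assumes "\<And>z. cell m 2 z = of_bool (even z \<and> z div 2 < k)"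
  shows "qlen m = k"
proof -
  have "i < k \<Longrightarrow> 2 * i < m" for i
    using cell_bound[of m 2 "2 * i"] assms by simp
  then have "{z. z < m \<and> cell m 2 z \<noteq> 0} = (\<lambda>i. 2 * i) ` {..<k}"
    unfolding assms by (auto elim!: evenE)
  moreover have "qlen m = card {z. z < m \<and> cell m 2 z \<noteq> 0}"
    by (simp add: qlen_def sum_of_bool_eq Int_def)
  ultimately show ?thesis by (simp add: card_image inj_on_def)
qed

lemma valid_query_iff:
  assumes "stored ts m" "2 < length ts"
  shows "valid_query m \<longleftrightarrow> (\<exists>k. fst (ts ! 2) = fst (word_tape (enc_nat k)))"
proof -
  have c: "fst (ts ! 2) z = cell m 2 (int_encode z)" for z
    using assms unfolding stored_def by simp
  have "fst (ts ! 2) = fst (word_tape (enc_nat k)) \<longleftrightarrow>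
      (\<forall>z. cell m 2 z = of_bool (even z \<and> z div 2 < k))" for k
    unfolding fun_eq_iff c word_tape_enc_nat by (metis int_decode_inverse)
  then have "(\<exists>k. fst (ts ! 2) = fst (word_tape (enc_nat k))) \<longleftrightarrow>
      (\<exists>k. \<forall>z. cell m 2 z = of_bool (even z \<and> z div 2 < k))" by blast
  also have "\<dots> \<longleftrightarrow> (\<forall>z. cell m 2 z = of_bool (even z \<and> z div 2 < qlen m))"
    using qlen_eq by metis
  also have "\<dots> \<longleftrightarrow> valid_query m"
  proof
    assume v: "valid_query m"
    show "\<forall>z. cell m 2 z = of_bool (even z \<and> z div 2 < qlen m)"
    proof
      fix z
      \<comment> \<open>A valid word occupies even codes below \<open>m\<close>, of which there are
        at most \<open>(m + 1) div 2\<close>. So the tally word of length \<open>qlen m\<close> ends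
        before \<open>m\<close>, and the equation extends to all \<open>z\<close>.\<close>
      have "qlen m \<le> card {z. z < m \<and> even z}"
        unfolding qlen_def using v unfolding valid_query_def
        by (simp add: sum_of_bool_eq Int_def) (intro card_mono; auto)
      moreover have "card {z. z < m \<and> even z} \<le> card {..<(m + 1) div 2}"
        by (rule card_inj_on_le[where f = "\<lambda>z. z div 2"])
          (auto simp: inj_on_def elim!: evenE)
      ultimately have q: "2 * qlen m \<le> m + 1" by simp
      show "cell m 2 z = of_bool (even z \<and> z div 2 < qlen m)"
      proof (cases "z < m")
        case True
        with v show ?thesis by (simp add: valid_query_def)
      next
        case False
        then have "cell m 2 z = 0" using cell_bound by blast
        moreover have "\<not> (even z \<and> z div 2 < qlen m)" using q False by (auto elim!: evenE)
        ultimately show ?thesis by simp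
      qed
    qed
  qed (simp add: valid_query_def)
  finally show ?thesis by simp
qed

lemma look_answer:
  "look (answer v m) (pc 0 r) = (if r = 2 then 0 else hpos m r)"
  "look (answer v m) (pc (Suc r) z) = (if r = 2 then answer_cell v z else cell m r z)"
proof -
  define f where "f n = rec_nat m (\<lambda>z m'. put m' (pc 3 z) (answer_cell v z)) n" for n
  have f: "look (f n) (pc 0 r) = hpos m r"
    "look (f n) (pc (Suc r) z) = (if r = 2 \<and> z < n then answer_cell v z else cell m r z)" for n
    by (induction n) (auto simp: f_def hpos_def cell_def)
  show "look (answer v m) (pc 0 r) = (if r = 2 then 0 else hpos m r)"
    by (simp add: answer_def f flip: f_def)
  have "cell m 2 z = 0" "answer_cell v z = 0" if "\<not> z < m + 2 * v + 5"
    using that cell_bound[of m 2 z] by (auto simp: answer_cell_def elim!: evenE)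
  then show "look (answer v m) (pc (Suc r) z) = (if r = 2 then answer_cell v z else cell m r z)"
    by (auto simp: answer_def f simp flip: f_def)
qed

lemma answer_stored:
  assumes "stored ts m"
  shows "stored (ts[2 := word_tape (enc_rat (of_nat v))]) (answer v m)"
proof -
  have "fst (word_tape (enc_rat (of_nat v))) z = answer_cell v (int_encode z)" for z
  proof -
    have "quotient_of (of_nat v) = (int v, 1)"
      using quotient_of_int[of "int v"] by (simp add: of_int_def)
    then have "enc_rat (of_nat v) = replicate v 1 @ [3, 1]"
      by (simp add: enc_rat_def enc_nat_def)
    then show ?thesis
      by (cases "0 \<le> z") (auto simp: word_tape_def answer_cell_def int_encode_simps nth_append nth_Cons')
  qed
  then show ?thesis
    using assms unfolding stored_def hpos_def[of "answer _ _"] cell_def[of "answer _ _"] look_answer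
    by (auto simp: nth_list_update word_tape_def int_encode_def sum_encode_def)
qed

lemma prec_comp3:
  assumes "prec (\<lambda>\<phi> y. H (p1 y) (p1 (p2 y)) (p2 (p2 y)))" "prec F" "prec G" "prec K"
  shows "prec (\<lambda>\<phi> x. H (F \<phi> x) (G \<phi> x) (K \<phi> x))"
  using prec.comp[OF assms(1) prec.pair[OF assms(2) prec.pair[OF assms(3,4)]]] by simp

lemma prec_cell:
  "prec M \<Longrightarrow> prec R \<Longrightarrow> prec Z \<Longrightarrow> prec (\<lambda>\<phi> x. cell (M \<phi> x) (R \<phi> x) (Z \<phi> x))"
  unfolding cell_def by (intro prec_intros prec_look)

lemma prec_hpos: "prec M \<Longrightarrow> prec R \<Longrightarrow> prec (\<lambda>\<phi> x. hpos (M \<phi> x) (R \<phi> x))"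
  unfolding hpos_def by (intro prec_intros prec_look)

lemma prec_reads:
  assumes "prec N" "prec M" shows "prec (\<lambda>\<phi> x. reads (N \<phi> x) (M \<phi> x))"
proof -
  have "prec (\<lambda>\<phi> y. reads (p1 y) (p2 y))"
    unfolding reads_def by (intro prec_rec prec_intros prec_cell prec_hpos)
  from prec_comp2[where H = "\<lambda>\<phi>. reads", OF this assms] show ?thesis .
qed

lemma prec_shift: "prec D \<Longrightarrow> prec Z \<Longrightarrow> prec (\<lambda>\<phi> x. shift (D \<phi> x) (Z \<phi> x))"
  unfolding shift_def by (intro prec_intros)

lemma prec_acts:
  assumes "prec N" "prec W" "prec M" shows "prec (\<lambda>\<phi> x. acts (N \<phi> x) (W \<phi> x) (M \<phi> x))"
proof -
  have "prec (\<lambda>\<phi> y. acts (p1 y) (p1 (p2 y)) (p2 (p2 y)))"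
    unfolding acts_def by (intro prec_rec prec_put prec_lnth prec_shift prec_intros prec_cell prec_hpos)
  from prec_comp3[where H = acts, OF this assms] show ?thesis .
qed

lemma prec_valid_query: "prec M \<Longrightarrow> prec (\<lambda>\<phi> x. of_bool (valid_query (M \<phi> x)))"
proof -
  assume M: "prec M"
  have "prec (\<lambda>\<phi> x. of_bool (valid_query x))"
    unfolding valid_query_def qlen_def by (intro prec_intros prec_cell)
  from prec.comp[OF this M] show ?thesis .
qed

lemma prec_answer:
  assumes "prec V" "prec M" shows "prec (\<lambda>\<phi> x. answer (V \<phi> x) (M \<phi> x))"
proof -
  have "prec (\<lambda>\<phi> y. answer (p1 y) (p2 y))"
    unfolding answer_def answer_cell_def by (intro prec_rec prec_put prec_intros)
  from prec_comp2[where H = "\<lambda>\<phi>. answer", OF this assms] show ?thesis .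
qed

subsection \<open>Universal simulation\<close>

text \<open>The successor keeps instructions apart from 0, which \<open>look\<close> returns for a
  missing table entry.\<close>

fun instr_code :: "instr \<Rightarrow> nat" where
  "instr_code (Act q ws) = Suc (pc 0 (pc q (list_encode (map (\<lambda>(a, d). pc a (move_code d)) ws))))"
| "instr_code (Query i q) = Suc (pc (Suc i) q)"

definition otm_code :: "otm \<Rightarrow> nat" where
  "otm_code M = pc (ntapes M)
     (list_encode (map (\<lambda>((q, as), ins). pc (pc q (list_encode as)) (instr_code ins)) (prog M)))"

text \<open>
  The machine with code \<open>e\<close> is run with oracles for the point with coordinates \<open>Suc (pc e 0), 0, 0\<close>.
  A configuration in state \<open>q\<close> is coded by \<open>pc (Suc q) m\<close> if its tapes are stored in \<open>m\<close>,
  and \<open>pc 0 m\<close> signals that the machine has halted. In \<open>accepts\<close>, the positions of the fraction bar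
  and of the terminator in the output are compared: \<open>9 * j < l\<close> holds if the output is smaller than
  \<open>1/16\<close> in absolute value, and fails if it exceeds \<open>1/8\<close>.
\<close>

definition fetch :: "nat \<Rightarrow> nat \<Rightarrow> nat" where
  "fetch e c = look (p2 e) (pc (p1 c - 1) (reads (p1 e) (p2 c)))"

definition sim :: "nat \<Rightarrow> nat \<Rightarrow> nat" where
  "sim e c =
    (if p1 c = 0 then c
     else if fetch e c = 0 then pc 0 (p2 c)
     else if p1 (fetch e c - 1) = 0
     then pc (Suc (p1 (p2 (fetch e c - 1)))) (acts (p1 e) (p2 (p2 (fetch e c - 1))) (p2 c))
     else if p1 (fetch e c - 1) \<le> 3 \<and> valid_query (p2 c)
     then pc (Suc (p2 (fetch e c - 1)))
       (answer (if p1 (fetch e c - 1) = 1 then Suc (pc e 0) else 0) (p2 c))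
     else pc 0 (p2 c))"

text \<open>The input 4 in unary: the cells of tape 0 have the keys \<open>pc 1 z\<close>, and the
  cells 0 to 3 have the codes 0, 2, 4, 6. Precision \<open>1 / 2 ^ 4\<close> is enough to tell the
  distance 0 from distances of at least 1/4.\<close>

definition init_mem :: nat where
  "init_mem = put (put (put (put 0 (pc 1 0) 1) (pc 1 2) 1) (pc 1 4) 1) (pc 1 6) 1"

definition run :: "nat \<Rightarrow> nat \<Rightarrow> nat" where
  "run e n = (sim e ^^ n) (pc 1 init_mem)"

definition accepts :: "nat \<Rightarrow> nat \<Rightarrow> bool" where
  "accepts e t \<longleftrightarrow> p1 (run e (p1 t)) = 0 \<and>
     cell (p2 (run e (p1 t))) 1 (2 * p1 (p2 t)) = 3 \<and>
     cell (p2 (run e (p1 t))) 1 (2 * p2 (p2 t)) = 4 \<and> 9 * p1 (p2 t) < p2 (p2 t)"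

lemma prec_fetch: "prec E \<Longrightarrow> prec C \<Longrightarrow> prec (\<lambda>\<phi> x. fetch (E \<phi> x) (C \<phi> x))"
  unfolding fetch_def by (intro prec_look prec_reads prec_intros)

lemma prec_accepts: "prec (\<lambda>\<phi> x. of_bool (accepts (p1 x) (p2 x)))"
proof -
  have sim: "prec (\<lambda>\<phi> x. sim (p1 x) (p2 x))"
    unfolding sim_def
    by (intro prec_fetch prec_acts prec_answer prec_valid_query prec_intros)
  have "prec (\<lambda>\<phi> x. run (p1 x) (p2 x))"
    unfolding run_def
    by (intro prec_funpow prec_comp2[where H = "\<lambda>\<phi>. sim", OF sim] prec_intros)
  note run = prec_comp2[where H = "\<lambda>\<phi>. run", OF this]
  show ?thesis
    unfolding accepts_def by (intro run prec_intros prec_cell)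
qed

text \<open>A coded program is itself a memory: as in \<open>map_of\<close>, the first entry for a
  key wins.\<close>

lemma fetch_program:
  "look (list_encode (map (\<lambda>((q, as), ins). pc (pc q (list_encode as)) (instr_code ins)) xs))
     (pc q (list_encode as)) = (case map_of xs (q, as) of None \<Rightarrow> 0 | Some ins \<Rightarrow> instr_code ins)"
proof (induction xs)
  case (Cons x xs)
  obtain q' as' ins where x: "x = ((q', as'), ins)" by (metis surj_pair)
  have "list_encode (map (\<lambda>((q, as), ins). pc (pc q (list_encode as)) (instr_code ins)) (x # xs)) =
      put (list_encode (map (\<lambda>((q, as), ins). pc (pc q (list_encode as)) (instr_code ins)) xs))
        (pc q' (list_encode as')) (instr_code ins)"
    by (simp add: x put_def)
  then show ?case using Cons by (auto simp: x list_encode_eq)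
qed simp

lemma fetch_stored:
  assumes "stored ts m" "length ts = ntapes M"
  shows "fetch (otm_code M) (pc (Suc q) m) =
    (case map_of (prog M) (q, map read_tape ts) of None \<Rightarrow> 0 | Some ins \<Rightarrow> instr_code ins)"
  using reads_stored[OF assms(1)] assms(2) by (simp add: fetch_def otm_code_def fetch_program)

definition point_oracles :: "nat \<Rightarrow> (nat \<Rightarrow> rat) list" where
  "point_oracles v = [\<lambda>k. of_nat v, \<lambda>k. 0, \<lambda>k. 0]"

lemma wf_otmD:
  assumes "wf_otm M"
  shows "3 \<le> ntapes M" "map_of (prog M) (q, as) = Some (Act q' ws) \<Longrightarrow> length ws = ntapes M"
proof -
  show "3 \<le> ntapes M" using assms by (simp add: wf_otm_def)
  assume "map_of (prog M) (q, as) = Some (Act q' ws)"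
  then have "((q, as), Act q' ws) \<in> set (prog M)" by (rule map_of_SomeD)
  then show "length ws = ntapes M" using assms unfolding wf_otm_def by fastforce
qed

text \<open>The three oracles are constant, so an answer depends on which oracle is asked but not on
  the precision asked for; of the query tape, only well-formedness has to be checked.\<close>

lemma sim_step:
  assumes M: "wf_otm M" and st: "stored ts m" "length ts = ntapes M"
    and step: "step M (point_oracles (Suc (pc (otm_code M) 0))) (q, ts) (q', ts')"
  shows "\<exists>m'. sim (otm_code M) (pc (Suc q) m) = pc (Suc q') m' \<and> stored ts' m' \<and> length ts' = ntapes M"
  using step
proof cases
  case (act ws)
  have ws: "length ws = length ts" using wf_otmD(2)[OF M act(2)] st by simp
  have f: "fetch (otm_code M) (pc (Suc q) m) = instr_code (Act q' ws)"
    using fetch_stored[OF st] act by simp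
  have "sim (otm_code M) (pc (Suc q) m) = pc (Suc q')
      (acts (length ts) (list_encode (map (\<lambda>(a, d). pc a (move_code d)) ws)) m)"
    unfolding sim_def f using st(2) by (simp add: otm_code_def)
  then show ?thesis using acts_stored[OF st(1) ws] act(1) ws st(2) by auto
next
  case (query i k)
  have l: "2 < length ts" using wf_otmD(1)[OF M] st by simp
  have i: "i < 3" using query by (simp add: point_oracles_def)
  have f: "fetch (otm_code M) (pc (Suc q) m) = instr_code (Query i q')"
    using fetch_stored[OF st] query by simp
  have v: "valid_query m" using valid_query_iff[OF st(1) l] query by blast
  have "sim (otm_code M) (pc (Suc q) m) = pc (Suc q')
      (answer (if i = 0 then Suc (pc (otm_code M) 0) else 0) m)"
    unfolding sim_def f using i v by simp
  moreover have "(point_oracles (Suc (pc (otm_code M) 0)) ! i) k =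
      of_nat (if i = 0 then Suc (pc (otm_code M) 0) else 0)"
    using i by (auto simp: point_oracles_def less_Suc_eq numeral_3_eq_3)
  ultimately show ?thesis using answer_stored[OF st(1)] query(1) st(2) by auto
qed

lemma sim_halt:
  assumes M: "wf_otm M" and st: "stored ts m" "length ts = ntapes M"
    and halt: "\<nexists>c. step M (point_oracles v) (q, ts) c"
  shows "sim (otm_code M) (pc (Suc q) m) = pc 0 m"
proof (cases "map_of (prog M) (q, map read_tape ts)")
  case None
  then show ?thesis using fetch_stored[OF st, of q] by (simp add: sim_def)
next
  case (Some ins)
  show ?thesis
  proof (cases ins)
    case (Act q' ws)
    then show ?thesis using step.act Some halt by blast
  next
    case (Query i q')
    have l: "2 < length ts" using wf_otmD(1)[OF M] st by simp
    have f: "fetch (otm_code M) (pc (Suc q) m) = instr_code (Query i q')"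
      using fetch_stored[OF st] Some Query by simp
    have "\<not> (i < length (point_oracles v) \<and> (\<exists>k. fst (ts ! 2) = fst (word_tape (enc_nat k))))"
      using halt Some step.query unfolding Query by blast
    then have "\<not> (Suc i \<le> 3 \<and> valid_query m)"
      using valid_query_iff[OF st(1) l] by (auto simp: point_oracles_def)
    then show ?thesis unfolding sim_def f by auto
  qed
qed

lemma stored_init:
  assumes "wf_otm M"
  shows "stored (snd (init_config M 4)) init_mem"
proof -
  have "cell init_mem r z = (if r = 0 then of_bool (even z \<and> z div 2 < 4) else 0)" for r z
    by (auto simp: init_mem_def cell_def elim!: evenE)
  moreover have "hpos init_mem r = 0" for r
    by (auto simp: init_mem_def hpos_def)
  moreover have "int_encode 0 = 0" by (simp add: int_encode_def sum_encode_def)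
  moreover have "snd (word_tape w) = 0" "fst (word_tape []) z = 0" for w z
    by (simp_all add: word_tape_def)
  ultimately show ?thesis
    by (auto simp: stored_def init_config_def word_tape_enc_nat nth_Cons')
qed

lemma run_steps:
  assumes M: "wf_otm M"
    and "(step M (point_oracles (Suc (pc (otm_code M) 0))))\<^sup>*\<^sup>* (init_config M 4) c"
  shows "\<exists>n m. run (otm_code M) n = pc (Suc (fst c)) m \<and> stored (snd c) m \<and> length (snd c) = ntapes M"
  using assms(2)
proof (induction rule: rtranclp_induct)
  case base
  have "run (otm_code M) 0 = pc (Suc (fst (init_config M 4))) init_mem"
    by (simp add: run_def init_config_def)
  moreover have "length (snd (init_config M 4)) = ntapes M"
    using wf_otmD(1)[OF M] by (simp add: init_config_def)
  ultimately show ?case using stored_init[OF M] by blast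
next
  case (step c c')
  then obtain n m where n: "run (otm_code M) n = pc (Suc (fst c)) m" "stored (snd c) m"
    "length (snd c) = ntapes M" by blast
  obtain m' where "sim (otm_code M) (pc (Suc (fst c)) m) = pc (Suc (fst c')) m'" "stored (snd c') m'"
    "length (snd c') = ntapes M"
    using sim_step[OF M n(2,3), of "fst c" "fst c'" "snd c'"] step(2) by auto
  moreover from this have "run (otm_code M) (Suc n) = pc (Suc (fst c')) m'"
    using n(1) by (simp add: run_def)
  ultimately show ?case by blast
qed

text \<open>The run halts because there is an output, and \<open>run\<close> is constant from then
  on. A witness \<open>t\<close> therefore amounts to two positions on the final output
  tape.\<close>

lemma accepts_iff:
  assumes M: "wf_otm M" and out: "outputs M (point_oracles (Suc (pc (otm_code M) 0))) 4 rs"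
  shows "(\<exists>t. accepts (otm_code M) t) \<longleftrightarrow>
    (\<exists>j l. fst (word_tape (enc_rats rs)) (int j) = 3 \<and> fst (word_tape (enc_rats rs)) (int l) = 4 \<and> 9 * j < l)"
proof -
  let ?e = "otm_code M"
  obtain q ts where c: "(step M (point_oracles (Suc (pc ?e 0))))\<^sup>*\<^sup>* (init_config M 4) (q, ts)"
    "\<nexists>c. step M (point_oracles (Suc (pc ?e 0))) (q, ts) c"
    "fst (ts ! 1) = fst (word_tape (enc_rats rs))"
    using out unfolding outputs_def by blast
  obtain n m where n: "run ?e n = pc (Suc q) m" "stored ts m" "length ts = ntapes M"
    using run_steps[OF M c(1)] by auto
  have h: "run ?e (Suc n) = pc 0 m"
    using n(1) sim_halt[OF M n(2,3) c(2)] by (simp add: run_def)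
  have stable: "run ?e (i + k) = run ?e i" if "p1 (run ?e i) = 0" for i k
    using that by (induction k) (auto simp: run_def sim_def)
  have halted: "run ?e i = pc 0 m" if i: "p1 (run ?e i) = 0" for i
  proof (cases "i \<le> n")
    case True
    then have "p1 (pc (Suc q) m) = 0" using stable[OF i, of "n - i"] i unfolding n(1)[symmetric] by simp
    then show ?thesis by simp
  next
    case False
    then show ?thesis using stable[of "Suc n" "i - Suc n"] h by simp
  qed
  have cell: "cell m 1 (2 * j) = fst (word_tape (enc_rats rs)) (int j)" for j
  proof -
    have "1 < length ts" using n(3) wf_otmD(1)[OF M] by simp
    then have "fst (ts ! 1) (int j) = cell m 1 (int_encode (int j))"
      using n(2) unfolding stored_def by blast
    then show ?thesis using c(3) by (simp add: int_encode_simps(1))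
  qed
  show ?thesis
  proof
    assume "\<exists>t. accepts ?e t"
    then obtain t where t: "accepts ?e t" ..
    then have "run ?e (p1 t) = pc 0 m" using halted by (simp add: accepts_def)
    with t show "\<exists>j l. fst (word_tape (enc_rats rs)) (int j) = 3 \<and>
        fst (word_tape (enc_rats rs)) (int l) = 4 \<and> 9 * j < l"
      unfolding accepts_def by (auto simp: cell simp del: One_nat_def)
  next
    assume "\<exists>j l. fst (word_tape (enc_rats rs)) (int j) = 3 \<and>
        fst (word_tape (enc_rats rs)) (int l) = 4 \<and> 9 * j < l"
    then obtain j l where jl: "fst (word_tape (enc_rats rs)) (int j) = 3"
      "fst (word_tape (enc_rats rs)) (int l) = 4" "9 * j < l" by blast
    have "accepts ?e (pc (Suc n) (pc j l))"
      unfolding accepts_def using jl by (simp add: h cell del: One_nat_def)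
    then show "\<exists>t. accepts ?e t" ..
  qed
qed

section \<open>Reading the size of a rational off its code\<close>

lemma accepts_small_output:
  assumes M: "wf_otm M" and out: "outputs M (point_oracles (Suc (pc (otm_code M) 0))) 4 [r]"
    and r: "\<bar>r\<bar> < 1 / 16"
  shows "\<exists>t. accepts (otm_code M) t"
proof -
  obtain a b where q: "quotient_of r = (a, b)" by fastforce
  have b: "b > 0" using quotient_of_denom_pos[OF q] .
  have "\<bar>of_int a\<bar> / of_int b < (1 / 16 :: rat)"
    using r b unfolding quotient_of_div[OF q] by (simp add: abs_divide)
  then have "of_int (16 * \<bar>a\<bar>) < (of_int b :: rat)" using b by (simp add: field_simps)
  then have ab: "16 * \<bar>a\<bar> < b" unfolding of_int_less_iff .
  define s :: "nat list" where "s = (if a < 0 then [2] else [])"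
  define n where "n = nat \<bar>a\<bar>"
  define d where "d = nat b"
  have w: "enc_rats [r] = s @ replicate n 1 @ [3] @ replicate d 1 @ [4]"
    using quotient_of_enc[OF q] by (simp add: enc_rats_def s_def n_def d_def)
  have "fst (word_tape (enc_rats [r])) (int (length s + n)) = 3"
    "fst (word_tape (enc_rats [r])) (int (length s + n + 1 + d)) = 4"
    unfolding w by (auto simp: word_tape_def nth_append)
  \<comment> \<open>Equivalently \<open>8 * (length s + n) < 1 + d\<close>. A minus sign forces
    \<open>1 <= n\<close>, hence \<open>8 * (length s + n) <= 16 * n < d\<close>: the gap between
    1/16 and 1/8 absorbs the sign.\<close>
  moreover have "9 * (length s + n) < length s + n + 1 + d"
    using ab by (auto simp: s_def n_def d_def)
  ultimately show ?thesis unfolding accepts_iff[OF M out] by blast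
qed

lemma accepts_large_output:
  assumes M: "wf_otm M" and out: "outputs M (point_oracles (Suc (pc (otm_code M) 0))) 4 [r]"
    and "accepts (otm_code M) t"
  shows "r \<le> 1 / 8"
proof (rule ccontr)
  assume r: "\<not> r \<le> 1 / 8"
  obtain a b where q: "quotient_of r = (a, b)" by fastforce
  have b: "b > 0" using quotient_of_denom_pos[OF q] .
  have "of_int b < (of_int (8 * a) :: rat)"
    using r b unfolding quotient_of_div[OF q] by (simp add: field_simps)
  then have ab: "b < 8 * a" unfolding of_int_less_iff .
  define n where "n = nat a"
  define d where "d = nat b"
  have w: "enc_rats [r] = replicate n 1 @ [3] @ replicate d 1 @ [4]"
    using quotient_of_enc[OF q] ab b by (simp add: enc_rats_def n_def d_def)
  obtain j l where jl: "fst (word_tape (enc_rats [r])) (int j) = 3"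
    "fst (word_tape (enc_rats [r])) (int l) = 4" "9 * j < l"
    using assms(3) accepts_iff[OF M out] by blast
  have "j = n" using jl(1) unfolding w by (auto simp: word_tape_def nth_append nth_Cons' split: if_splits)
  moreover have "l = n + 1 + d" using jl(2) unfolding w by (auto simp: word_tape_def nth_append nth_Cons' split: if_splits)
  ultimately show False using jl(3) ab b by (auto simp: n_def d_def)
qed

text \<open>The number 0 describes an empty program, whose simulation halts at once with a blank
  output tape. This supplies a point outside the basin.\<close>

lemma not_accepts_0: "\<not> accepts 0 t"
proof -
  have "run 0 (Suc n) = pc 0 init_mem" for n
  proof (induction n)
    case 0
    have "fetch 0 (pc 1 init_mem) = 0" by (simp add: fetch_def)
    then show ?case by (simp add: run_def sim_def)
  next
    case (Suc n)
    then show ?case unfolding run_def by (simp add: sim_def)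
  qed
  moreover have "p1 (run 0 0) = 1" by (simp add: run_def)
  moreover have "cell init_mem 1 z = 0" for z by (simp add: init_mem_def cell_def)
  ultimately show ?thesis unfolding accepts_def by (cases "p1 t") auto
qed

section \<open>Interpolation by rational functions\<close>

text \<open>Polymorphic, for use over the reals in the dynamics and over the complex numbers for
  analyticity.\<close>

definition denom :: "nat \<Rightarrow> nat \<Rightarrow> 'a::real_normed_field \<Rightarrow> 'a" where
  "denom q n x = x ^ 2 + (2 * (x - of_nat (Suc q))) ^ (2 * n)"

definition bump :: "nat \<Rightarrow> nat \<Rightarrow> 'a::real_normed_field \<Rightarrow> 'a" where
  "bump q n x = x ^ 2 / denom q n x"

lemma Suc_le_power2: "Suc n \<le> 2 ^ n"
  by (induction n) auto

lemma abs_two_mult: "\<bar>2 * a\<bar> = 2 * \<bar>a :: real\<bar>"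
  by (simp add: abs_mult)

text \<open>For \<open>v = 2 * norm (x - (q + 1))\<close> one has
  \<open>norm x <= (q + 2) * v\<close> and \<open>2 <= v ^ 2\<close>, so for large \<open>n\<close>
  the power \<open>v ^ (2 * n)\<close> is at least \<open>2 * norm x ^ 2\<close> and dominates the
  denominator, in the complex plane as well. The second bound keeps a factor
  \<open>norm x ^ 2\<close> for use near 0, the third is uniform in \<open>x\<close>.\<close>

lemma far_bounds:
  fixes x :: "'a::real_normed_field"
  assumes n: "2 * q + 4 \<le> n" and x: "3 / 4 \<le> norm (x - of_nat (Suc q))"
  shows "2 ^ n / 2 \<le> norm (denom q n x)" "norm (bump q n x) \<le> 2 * norm x ^ 2 / 2 ^ n"
    "norm (bump q n x) \<le> 2 ^ (2 * q + 4) / 2 ^ n"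
proof -
  define v where "v = 2 * norm (x - of_nat (Suc q))"
  have v: "3 / 2 \<le> v" using x by (simp add: v_def)
  obtain k where k: "n = Suc k" using n by (cases n) auto
  have "norm x \<le> v / 2 + real (Suc q)"
    using norm_triangle_ineq[of "x - of_nat (Suc q)" "of_nat (Suc q)"] unfolding v_def norm_of_nat by simp
  also have "\<dots> \<le> v + real (Suc q) * v"
  proof -
    have "c * 1 \<le> c * v" if "0 \<le> c" for c by (intro mult_left_mono) (use v that in auto)
    then have "v / 2 + c \<le> v + c * v" if "0 \<le> c" for c using that v by fastforce
    then show ?thesis by simp
  qed
  finally have nx: "norm x \<le> real (q + 2) * v" by (simp add: algebra_simps)
  have "2 \<le> v ^ 2" using power_mono[of "3/2" v 2] v by (simp add: power2_eq_square)
  then have v2: "2 ^ j \<le> v ^ (2 * j)" for j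
    using power_mono[of 2 "v ^ 2" j] by (simp add: power_mult)
  have "norm x ^ 2 \<le> (real (q + 2)) ^ 2 * v ^ 2"
    using power_mono[OF nx, of 2] by (simp add: power_mult_distrib)
  moreover have q4: "(real (q + 2)) ^ 2 \<le> 2 ^ (2 * q + 2)"
    using power_mono[of "real (q + 2)" "2 ^ (q + 1)" 2] Suc_le_power2[of "q + 1"]
    by (simp add: power_mult mult.commute[of 2] flip: of_nat_le_iff[where 'a = real] power_mult)
  ultimately have x2: "norm x ^ 2 \<le> 2 ^ (2 * q + 2) * v ^ 2"
    by (meson mult_right_mono order_trans zero_le_power2)
  have "2 * 2 ^ (2 * q + 2) \<le> (2 ^ k :: real)"
    using n power_increasing[of "2 * q + 3" k "2 :: real"] by (simp add: k power_add)
  also have "\<dots> \<le> v ^ (2 * k)" by (rule v2)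
  finally have "2 * 2 ^ (2 * q + 2) * v ^ 2 \<le> v ^ (2 * k) * v ^ 2"
    by (rule mult_right_mono) simp
  with x2 have "2 * norm x ^ 2 \<le> v ^ (2 * n)" by (simp add: k power_add[symmetric])
  moreover have "norm (denom q n x) \<ge> v ^ (2 * n) - norm x ^ 2"
  proof -
    have "norm (2 * (x - of_nat (Suc q))) = v" by (simp only: norm_mult norm_numeral v_def)
    then show ?thesis
      using norm_diff_ineq[of "(2 * (x - of_nat (Suc q))) ^ (2 * n)" "x ^ 2"]
      unfolding denom_def by (simp only: norm_power add.commute)
  qed
  ultimately have d: "v ^ (2 * n) / 2 \<le> norm (denom q n x)" by simp
  then show d1: "2 ^ n / 2 \<le> norm (denom q n x)" using v2[of n] by simp
  have vpos: "0 < v ^ (2 * n)" using v by simp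
  have "norm (bump q n x) = norm x ^ 2 / norm (denom q n x)"
    by (simp add: bump_def norm_divide norm_power)
  also have "\<dots> \<le> norm x ^ 2 / (v ^ (2 * n) / 2)"
    using d vpos by (intro divide_left_mono mult_pos_pos) auto
  finally have b: "norm (bump q n x) \<le> 2 * norm x ^ 2 / v ^ (2 * n)"
    by (simp add: mult.commute)
  also have "\<dots> \<le> 2 * norm x ^ 2 / 2 ^ n"
    using v2[of n] vpos by (intro divide_left_mono mult_pos_pos) auto
  finally show "norm (bump q n x) \<le> 2 * norm x ^ 2 / 2 ^ n" .
  have "2 * norm x ^ 2 / v ^ (2 * n) \<le> 2 * (2 ^ (2 * q + 2) * v ^ 2) / v ^ (2 * n)"
    using x2 vpos by (intro divide_right_mono) (auto simp: ac_simps)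
  also have "\<dots> = 2 ^ (2 * q + 3) / v ^ (2 * k)"
    using v by (simp add: k power_add field_simps power2_eq_square)
  also have "\<dots> \<le> 2 ^ (2 * q + 3) / 2 ^ k"
    using v2[of k] v by (intro divide_left_mono mult_pos_pos) auto
  also have "\<dots> = 2 ^ (2 * q + 4) / 2 ^ n" by (simp add: k power_add)
  finally show "norm (bump q n x) \<le> 2 ^ (2 * q + 4) / 2 ^ n" using b by linarith
qed

lemma near_bound:
  fixes x :: real
  assumes "\<bar>x - real (Suc q)\<bar> \<le> 1 / 4"
  shows "\<bar>1 - bump q n x\<bar> \<le> 2 / 2 ^ n"
proof -
  define s where "s = (2 * (x - real (Suc q))) ^ (2 * n)"
  have s0: "0 \<le> s" by (simp add: s_def power_mult)
  have "\<bar>2 * (x - real (Suc q))\<bar> \<le> 1 / 2"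
    unfolding abs_two_mult using mult_left_mono[OF assms, of 2] by simp
  then have "(2 * (x - real (Suc q))) ^ 2 \<le> (1 / 2) ^ 2"
    by (metis abs_ge_zero power2_abs power_mono)
  then have "((2 * (x - real (Suc q))) ^ 2) ^ n \<le> (1 / 2) ^ n"
    by (intro power_mono) (auto simp: power2_eq_square)
  then have s1: "s \<le> 1 / 2 ^ n" by (simp add: s_def power_mult power_one_over)
  have "3 / 4 \<le> x" if "\<bar>x - c\<bar> \<le> 1 / 4" "1 \<le> c" for c using that by linarith
  from this[OF assms] have "3 / 4 \<le> x" by simp
  then have x2: "1 / 2 \<le> x ^ 2" using power_mono[of "3/4" x 2] by (simp add: power2_eq_square)
  have "1 - bump q n x = s / (x ^ 2 + s)"
    using x2 s0 unfolding bump_def denom_def s_def[symmetric] of_nat_id by (simp add: field_simps)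
  also have "\<dots> \<le> s / (1 / 2)" using x2 s0 by (intro divide_left_mono) auto
  also have "\<dots> \<le> 2 / 2 ^ n" using s1 by simp
  moreover have "0 \<le> s / (x ^ 2 + s)" using s0 by simp
  ultimately show ?thesis using \<open>1 - bump q n x = s / (x ^ 2 + s)\<close> by simp
qed

text \<open>Both terms are nonnegative, and they are not small together: if
  \<open>abs x < 1/2\<close>, then \<open>x\<close> is at distance at least 1/2 from
  \<open>q + 1\<close>, and the second term is at least 1.\<close>

lemma denom_real: "1 / 4 \<le> denom q n (x :: real)"
proof (cases "1 / 2 \<le> \<bar>x\<bar>")
  case True
  then have "1 / 4 \<le> x ^ 2" using power_mono[of "1/2" "\<bar>x\<bar>" 2] by (simp add: power2_eq_square)
  moreover have "0 \<le> (2 * (x - real (Suc q))) ^ (2 * n)" by (simp add: power_mult)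
  ultimately show ?thesis unfolding denom_def by linarith
next
  case False
  moreover have "1 \<le> real (Suc q)" by simp
  ultimately have "1 / 2 \<le> \<bar>x - real (Suc q)\<bar>" by linarith
  then have "1 \<le> \<bar>2 * (x - real (Suc q))\<bar>"
    unfolding abs_two_mult using mult_left_mono[of "1 / 2" "\<bar>x - real (Suc q)\<bar>" 2] by simp
  then have "1 \<le> \<bar>2 * (x - real (Suc q))\<bar> ^ (2 * n)" by (rule one_le_power)
  then have "1 \<le> (2 * (x - real (Suc q))) ^ (2 * n)" by (simp add: power_even_abs)
  then show ?thesis unfolding denom_def using zero_le_power2[of x] by linarith
qed

lemma power_lipschitz:
  fixes a b :: real
  assumes "\<bar>a\<bar> \<le> T" "\<bar>b\<bar> \<le> T"
  shows "\<bar>a ^ n - b ^ n\<bar> \<le> real n * T ^ (n - 1) * \<bar>a - b\<bar>"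
proof (induction n)
  case (Suc n)
  have T: "0 \<le> T" using assms by linarith
  have "a ^ Suc n - b ^ Suc n = a * (a ^ n - b ^ n) + (a - b) * b ^ n" by (simp add: algebra_simps)
  then have "\<bar>a ^ Suc n - b ^ Suc n\<bar> \<le> \<bar>a\<bar> * \<bar>a ^ n - b ^ n\<bar> + \<bar>a - b\<bar> * \<bar>b\<bar> ^ n"
    by (metis abs_mult abs_triangle_ineq power_abs)
  also have "\<dots> \<le> T * (real n * T ^ (n - 1) * \<bar>a - b\<bar>) + \<bar>a - b\<bar> * T ^ n"
    using Suc assms T by (intro add_mono mult_mono power_mono) auto
  also have "\<dots> = real (Suc n) * T ^ (Suc n - 1) * \<bar>a - b\<bar>"
    by (cases n) (auto simp: algebra_simps)
  finally show ?case .
qed simp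

text \<open>Over a common denominator \<open>x ^ 2 * y ^ 2\<close> cancels, and the product of the
  denominators is at least 1/16. The constant is explicit because the precision of the oracle query
  is computed from it.\<close>

lemma bump_lipschitz:
  fixes x y :: real
  assumes xy: "\<bar>x\<bar> \<le> Y" "\<bar>y\<bar> \<le> Y" and T: "T = 2 * (Y + real (Suc q))"
  shows "\<bar>bump q n x - bump q n y\<bar> \<le> 16 * (4 * real n + 2) * T ^ (2 * n + 2) * \<bar>x - y\<bar>"
proof -
  define s where "s = 2 * (x - real (Suc q))"
  define t where "t = 2 * (y - real (Suc q))"
  have Y: "0 \<le> Y" and T1: "1 \<le> T" and YT: "Y \<le> T" using xy T by auto
  have st: "\<bar>s\<bar> \<le> T" "\<bar>t\<bar> \<le> T" using xy by (auto simp: s_def t_def T)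
  have "\<bar>s - t\<bar> = 2 * \<bar>x - y\<bar>"
    unfolding s_def t_def by (simp only: abs_mult flip: right_diff_distrib) simp
  then have 1: "\<bar>s ^ (2 * n) - t ^ (2 * n)\<bar> \<le> 4 * real n * T ^ (2 * n - 1) * \<bar>x - y\<bar>"
    using power_lipschitz[OF st, of "2 * n"] by simp
  have 2: "\<bar>x ^ 2 - y ^ 2\<bar> \<le> 2 * T * \<bar>x - y\<bar>"
    using power_lipschitz[of x T y 2] xy YT by simp
  have x2: "x ^ 2 \<le> T ^ 2" using xy YT power_mono[of "\<bar>x\<bar>" T 2] by simp
  have s2: "\<bar>s ^ (2 * n)\<bar> \<le> T ^ (2 * n)" using st by (simp add: power_abs power_mono)
  have "\<bar>x ^ 2 * t ^ (2 * n) - y ^ 2 * s ^ (2 * n)\<bar> =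
      \<bar>x ^ 2 * (t ^ (2 * n) - s ^ (2 * n)) + s ^ (2 * n) * (x ^ 2 - y ^ 2)\<bar>"
    by (simp add: algebra_simps)
  also have "\<dots> \<le> x ^ 2 * \<bar>t ^ (2 * n) - s ^ (2 * n)\<bar> + \<bar>s ^ (2 * n)\<bar> * \<bar>x ^ 2 - y ^ 2\<bar>"
    by (metis abs_mult abs_triangle_ineq abs_power2)
  also have "\<dots> \<le> T ^ 2 * (4 * real n * T ^ (2 * n - 1) * \<bar>x - y\<bar>) + T ^ (2 * n) * (2 * T * \<bar>x - y\<bar>)"
    using 1 2 x2 s2 T1 by (intro add_mono mult_mono) (auto simp: abs_minus_commute)
  also have "\<dots> = (4 * real n * T ^ (2 + (2 * n - 1)) + 2 * T ^ (2 * n + 1)) * \<bar>x - y\<bar>"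
    by (simp add: algebra_simps power_add power2_eq_square)
  also have "\<dots> \<le> (4 * real n * T ^ (2 * n + 2) + 2 * T ^ (2 * n + 2)) * \<bar>x - y\<bar>"
  proof -
    have "T ^ (2 + (2 * n - 1)) \<le> T ^ (2 * n + 2)" "T ^ (2 * n + 1) \<le> T ^ (2 * n + 2)"
      by (rule power_increasing; use T1 in simp)+
    then show ?thesis by (intro mult_right_mono add_mono mult_left_mono) auto
  qed
  also have "\<dots> = (4 * real n + 2) * T ^ (2 * n + 2) * \<bar>x - y\<bar>" by (simp add: algebra_simps)
  finally have num: "\<bar>x ^ 2 * t ^ (2 * n) - y ^ 2 * s ^ (2 * n)\<bar> \<le> (4 * real n + 2) * T ^ (2 * n + 2) * \<bar>x - y\<bar>" .
  have d: "1 / 4 \<le> denom q n x" "1 / 4 \<le> denom q n y" by (rule denom_real)+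
  then have d0: "denom q n x \<noteq> 0" "denom q n y \<noteq> 0" by linarith+
  have "1 / 4 * (1 / 4) \<le> denom q n x * denom q n y" using d by (intro mult_mono) auto
  then have d16: "1 / 16 \<le> denom q n x * denom q n y" by simp
  have "bump q n x - bump q n y = (x ^ 2 * denom q n y - y ^ 2 * denom q n x) / (denom q n x * denom q n y)"
    using d0 by (simp add: bump_def diff_frac_eq mult.commute)
  also have "x ^ 2 * denom q n y - y ^ 2 * denom q n x = x ^ 2 * t ^ (2 * n) - y ^ 2 * s ^ (2 * n)"
    by (simp add: denom_def s_def t_def algebra_simps)
  finally have "\<bar>bump q n x - bump q n y\<bar> =
      \<bar>x ^ 2 * t ^ (2 * n) - y ^ 2 * s ^ (2 * n)\<bar> / (denom q n x * denom q n y)"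
    using d16 by (simp add: abs_divide)
  also have "\<dots> \<le> \<bar>x ^ 2 * t ^ (2 * n) - y ^ 2 * s ^ (2 * n)\<bar> / (1 / 16)"
    using d16 by (intro divide_left_mono) auto
  also have "\<dots> \<le> 16 * ((4 * real n + 2) * T ^ (2 * n + 2) * \<bar>x - y\<bar>)"
    using mult_left_mono[OF num, of 16] by (simp add: mult.commute)
  finally show ?thesis by (simp only: mult.assoc)
qed

text \<open>The exponents grow fast enough to make the summands away from \<open>Suc q\<close> decay geometrically.\<close>

definition expo :: "(nat \<Rightarrow> nat) \<Rightarrow> nat \<Rightarrow> nat" where
  "expo V q = V q + 3 * q + 20"

section \<open>The interpolating series and its values near integers\<close>

definition summand :: "(nat \<Rightarrow> nat) \<Rightarrow> nat \<Rightarrow> 'a::real_normed_field \<Rightarrow> 'a" where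
  "summand V q x = of_nat (V q) * bump q (expo V q) x"

definition interp :: "(nat \<Rightarrow> nat) \<Rightarrow> real \<Rightarrow> real" where
  "interp V x = (\<Sum>q. summand V q x)"

lemma of_nat_le_power2: "real n \<le> 2 ^ n"
  using less_exp[of n] by (metis less_imp_le of_nat_le_iff of_nat_numeral of_nat_power)

lemma summand_far:
  fixes x :: "'a::real_normed_field"
  assumes "3 / 4 \<le> norm (x - of_nat (Suc q))"
  shows "norm (summand V q x) \<le> (1 / 2) ^ (q + 16)"
    "norm (summand V q x) \<le> (1 / 2) ^ (q + 16) * norm x ^ 2"
proof -
  have n: "2 * q + 4 \<le> expo V q" by (simp add: expo_def)
  have "norm (summand V q x) = real (V q) * norm (bump q (expo V q) x)"
    by (simp add: summand_def norm_mult)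
  also have "\<dots> \<le> 2 ^ V q * (2 ^ (2 * q + 4) / 2 ^ expo V q)"
    by (intro mult_mono far_bounds(3)[OF n assms] of_nat_le_power2) auto
  \<comment> \<open>Of the exponent \<open>V q + 3 * q + 20\<close>, the part \<open>V q\<close>
    pays for the factor \<open>V q\<close> and \<open>2 * q + 4\<close> for the far bound;
    \<open>q + 16\<close> is left.\<close>
  also have "\<dots> = (1 / 2) ^ (q + 16)"
    by (simp add: expo_def power_add field_simps power_mult power3_eq_cube power2_eq_square power_mult_distrib)
  finally show "norm (summand V q x) \<le> (1 / 2) ^ (q + 16)" .
  have "norm (summand V q x) = real (V q) * norm (bump q (expo V q) x)"
    by (simp add: summand_def norm_mult)
  also have "\<dots> \<le> 2 ^ V q * (2 * norm x ^ 2 / 2 ^ expo V q)"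
    by (intro mult_mono far_bounds(2)[OF n assms] of_nat_le_power2) auto
  also have "\<dots> = (1 / 2) ^ (3 * q + 19) * norm x ^ 2"
    by (simp add: expo_def power_add field_simps)
  also have "\<dots> \<le> (1 / 2) ^ (q + 16) * norm x ^ 2"
    by (intro mult_right_mono power_decreasing) auto
  finally show "norm (summand V q x) \<le> (1 / 2) ^ (q + 16) * norm x ^ 2" .
qed

lemma summand_near:
  fixes x :: real
  assumes "\<bar>x - real (Suc q)\<bar> \<le> 1 / 4"
  shows "\<bar>summand V q x - real (V q)\<bar> \<le> 1 / 16"
proof -
  have "\<bar>summand V q x - real (V q)\<bar> = real (V q) * \<bar>1 - bump q (expo V q) x\<bar>"
  proof -
    have "summand V q x - real (V q) = - (real (V q) * (1 - bump q (expo V q) x))"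
      by (simp add: summand_def algebra_simps)
    then show ?thesis by (simp only: abs_minus_cancel abs_mult abs_of_nat)
  qed
  also have "\<dots> \<le> 2 ^ V q * (2 / 2 ^ expo V q)"
    by (intro mult_mono near_bound[OF assms] of_nat_le_power2) auto
  also have "\<dots> = (1 / 2) ^ (3 * q + 19)"
    by (simp add: expo_def power_add field_simps)
  also have "\<dots> \<le> (1 / 2) ^ 4" by (intro power_decreasing) auto
  finally show ?thesis by (simp add: power4_eq_xxxx)
qed

lemma far_real: "\<lbrakk>\<bar>x - real p\<bar> \<le> 1 / 4; p \<noteq> Suc q\<rbrakk> \<Longrightarrow> 3 / 4 \<le> norm (x - of_nat (Suc q))"
proof -
  assume *: "\<bar>x - real p\<bar> \<le> 1 / 4" "p \<noteq> Suc q"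
  then have "1 \<le> \<bar>real p - real (Suc q)\<bar>" by linarith
  then have "3 / 4 \<le> \<bar>x - real (Suc q)\<bar>" using *(1) by linarith
  then show ?thesis by simp
qed

lemma geo_sums: "(\<lambda>i. (1 / 2 :: real) ^ (i + k)) sums (2 * (1 / 2) ^ k)"
  using sums_mult2[OF geometric_sums[of "1 / 2 :: real"], of "(1 / 2) ^ k"] by (simp add: power_add)

lemma summable_summand: "summable (\<lambda>q. summand V q (x :: real))"
proof (rule summable_comparison_test')
  show "summable (\<lambda>q. (1 / 2 :: real) ^ (q + 16))" using geo_sums sums_summable by blast
  fix q assume "nat \<lceil>\<bar>x\<bar>\<rceil> \<le> q"
  then have "\<bar>x\<bar> \<le> real q" by linarith
  then show "norm (summand V q x) \<le> (1 / 2) ^ (q + 16)"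
    by (intro summand_far) (simp add: abs_if split: if_splits)
qed

lemma interp_tail:
  assumes "\<And>q. Q \<le> q \<Longrightarrow> \<bar>summand V q x\<bar> \<le> (1 / 2) ^ (q + 16) * c"
  shows "\<bar>interp V x - (\<Sum>q<Q. summand V q x)\<bar> \<le> (1 / 2) ^ (Q + 15) * c"
proof -
  have "interp V x - (\<Sum>q<Q. summand V q x) = (\<Sum>q. summand V (q + Q) x)"
    unfolding interp_def using suminf_split_initial_segment[OF summable_summand, of V x Q] by simp
  also have "\<bar>\<dots>\<bar> \<le> (\<Sum>q. (1 / 2) ^ (q + (Q + 16)) * c)"
  proof -
    have "(\<lambda>q. (1 / 2 :: real) ^ (q + (Q + 16)) * c) sums (2 * (1 / 2) ^ (Q + 16) * c)"
      by (intro sums_mult2 geo_sums)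
    then have s: "summable (\<lambda>q. (1 / 2 :: real) ^ (q + (Q + 16)) * c)" by (rule sums_summable)
    have "norm (\<Sum>q. summand V (q + Q) x) \<le> (\<Sum>q. (1 / 2) ^ (q + (Q + 16)) * c)"
      by (rule norm_suminf_le[OF _ s]) (use assms[of "n + Q" for n] in \<open>simp add: add.assoc\<close>)
    then show ?thesis by simp
  qed
  also have "\<dots> = 2 * (1 / 2) ^ (Q + 16) * c"
    by (rule sums_unique[symmetric]) (intro sums_mult2 geo_sums)
  also have "2 * (1 / 2) ^ (Q + 16) = (1 / 2 :: real) ^ (Q + 15)"
    by (simp add: power_add power_one_over)
  finally show ?thesis .
qed

lemma interp_near:
  assumes x: "\<bar>x - real (Suc q)\<bar> \<le> 1 / 4"
  shows "\<bar>interp V x - real (V q)\<bar> \<le> 1 / 8"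
proof -
  \<comment> \<open>Changing one value to 0 removes exactly the \<open>q\<close>-th summand, so the
    tail estimate with \<open>Q = 0\<close> bounds all the others at once.\<close>
  let ?W = "V(q := 0)"
  have W: "summand ?W i x = (if i = q then 0 else summand V i x)" for i
    by (simp add: summand_def expo_def)
  have "\<bar>summand ?W i x\<bar> \<le> (1 / 2) ^ (i + 16) * 1" for i
    unfolding W using summand_far(1)[OF far_real[OF x, of i]] by auto
  then have 1: "\<bar>interp ?W x\<bar> \<le> (1 / 2) ^ 15"
    using interp_tail[of 0 ?W x 1] by simp
  have "(\<lambda>i. summand V i x - summand ?W i x) sums (interp V x - interp ?W x)"
    unfolding interp_def by (intro sums_diff summable_sums summable_summand)
  moreover have "(\<lambda>i. summand V i x - summand ?W i x) = (\<lambda>i. if i = q then summand V i x else 0)"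
    unfolding W by auto
  ultimately have "(\<lambda>i. if i = q then summand V i x else 0) sums (interp V x - interp ?W x)" by simp
  then have "interp V x - interp ?W x = summand V q x"
    using sums_single[of q "\<lambda>i. summand V i x"] sums_unique2 by blast
  then have "interp V x - real (V q) = interp ?W x + (summand V q x - real (V q))" by simp
  also have "\<bar>\<dots>\<bar> \<le> (1 / 2) ^ 15 + 1 / 16"
    using 1 summand_near[OF x, of V] by linarith
  also have "\<dots> \<le> 1 / 8" by (simp add: power_one_over)
  finally show ?thesis .
qed

text \<open>All positive integers are at distance at least 3/4 from \<open>x\<close>, so every
  summand is far and carries a factor \<open>x ^ 2\<close>.\<close>

lemma interp_origin:
  assumes "\<bar>x\<bar> \<le> 1 / 4"
  shows "\<bar>interp V x\<bar> \<le> x ^ 2"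
proof -
  have "\<bar>summand V i x\<bar> \<le> (1 / 2) ^ (i + 16) * x ^ 2" for i
    using summand_far(2)[OF far_real[of x 0 i], of V] assms by simp
  then have "\<bar>interp V x\<bar> \<le> (1 / 2) ^ 15 * x ^ 2"
    using interp_tail[of 0 V x "x ^ 2"] by simp
  also have "\<dots> \<le> 1 * x ^ 2" by (intro mult_right_mono) (auto simp: power_one_over)
  finally show ?thesis by simp
qed

section \<open>Dynamics of the interpolating map\<close>

lemma iterate_origin:
  assumes x: "\<bar>x\<bar> \<le> 1 / 4"
  shows "\<bar>(interp V ^^ k) x\<bar> \<le> (1 / 4) ^ Suc k"
proof (induction k)
  case (Suc k)
  let ?y = "(interp V ^^ k) x"
  have "(1 / 4 :: real) ^ Suc k \<le> (1 / 4) ^ 1" by (intro power_decreasing) auto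
  then have y: "\<bar>?y\<bar> \<le> 1 / 4" using Suc by simp
  have "\<bar>interp V ?y\<bar> \<le> \<bar>?y\<bar> * \<bar>?y\<bar>"
    using interp_origin[OF y, of V] by (simp add: power2_eq_square)
  also have "\<dots> \<le> 1 / 4 * (1 / 4) ^ Suc k"
    using y Suc by (intro mult_mono) auto
  finally show ?case by simp
qed (use x in simp)

lemma tendsto_origin: "\<bar>x\<bar> \<le> 1 / 4 \<Longrightarrow> (\<lambda>k. (interp V ^^ k) x) \<longlonglongrightarrow> 0"
proof (rule Lim_null_comparison)
  assume "\<bar>x\<bar> \<le> 1 / 4"
  then show "\<forall>\<^sub>F k in sequentially. norm ((interp V ^^ k) x) \<le> (1 / 4) ^ Suc k"
    using iterate_origin by (intro always_eventually) auto
  show "(\<lambda>k. (1 / 4 :: real) ^ Suc k) \<longlonglongrightarrow> 0"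
    by (rule LIMSEQ_Suc[OF LIMSEQ_power_zero]) simp
qed

text \<open>The orbit of \<open>Suc (prod_encode (e, 0))\<close> searches for a \<open>t\<close> with \<open>R e t\<close>.\<close>

definition search :: "(nat \<Rightarrow> nat \<Rightarrow> bool) \<Rightarrow> nat \<Rightarrow> nat" where
  "search R q = (case prod_decode q of (e, t) \<Rightarrow> if R e t then 0 else Suc (prod_encode (e, Suc t)))"

lemma search_pair: "search R (prod_encode (e, t)) = (if R e t then 0 else Suc (prod_encode (e, Suc t)))"
  by (simp add: search_def)

text \<open>The ball of radius 1/4 around one integer goes into the ball of radius 1/8 around the
  next, so errors do not accumulate.\<close>

lemma search_orbit:
  assumes x: "\<bar>x - real (Suc (prod_encode (e, 0)))\<bar> \<le> 1 / 4" and R: "\<And>t. t < k \<Longrightarrow> \<not> R e t"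
  shows "\<bar>(interp (search R) ^^ k) x - real (Suc (prod_encode (e, k)))\<bar> \<le> 1 / 4"
  using R
proof (induction k)
  case (Suc k)
  then have "\<bar>(interp (search R) ^^ k) x - real (Suc (prod_encode (e, k)))\<bar> \<le> 1 / 4" by simp
  from interp_near[OF this, of "search R"] Suc.prems[of k] show ?case
    by (simp add: search_pair del: of_nat_Suc)
qed (use x in simp)

lemma search_success:
  assumes x: "\<bar>x - real (Suc (prod_encode (e, 0)))\<bar> \<le> 1 / 4" and R: "R e t"
  shows "(\<lambda>k. (interp (search R) ^^ k) x) \<longlonglongrightarrow> 0"
proof -
  \<comment> \<open>The orbit leaves the search at the first witness, which need not be
    \<open>t\<close>.\<close>
  define k where "k = (LEAST t. R e t)"
  have k: "R e k" "\<And>t. t < k \<Longrightarrow> \<not> R e t"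
    unfolding k_def using R by (auto intro: LeastI dest: not_less_Least)
  let ?y = "(interp (search R) ^^ Suc k) x"
  have "\<bar>?y - real (search R (prod_encode (e, k)))\<bar> \<le> 1 / 8"
    using interp_near[OF search_orbit[where R = R and k = k, OF x k(2)]] by simp
  then have "\<bar>?y\<bar> \<le> 1 / 4" using k(1) by (simp add: search_pair)
  then have "(\<lambda>i. (interp (search R) ^^ i) ?y) \<longlonglongrightarrow> 0" by (rule tendsto_origin)
  moreover have "(interp (search R) ^^ i) ?y = (interp (search R) ^^ (i + Suc k)) x" for i
    by (simp only: funpow_add o_apply)
  ultimately show ?thesis
    using LIMSEQ_offset[of "\<lambda>i. (interp (search R) ^^ i) x" "Suc k" 0] by simp
qed

lemma search_failure:
  assumes R: "\<And>t. \<not> R e t"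
  shows "\<not> (\<lambda>k. (interp (search R) ^^ k) (real (Suc (prod_encode (e, 0))))) \<longlonglongrightarrow> 0"
proof
  let ?x = "real (Suc (prod_encode (e, 0)))"
  assume "(\<lambda>k. (interp (search R) ^^ k) ?x) \<longlonglongrightarrow> 0"
  then obtain K where "\<bar>(interp (search R) ^^ K) ?x\<bar> < 1 / 2"
    using LIMSEQ_D[of _ 0 "1 / 2"] by fastforce
  moreover have "\<bar>(interp (search R) ^^ K) ?x - real (Suc (prod_encode (e, K)))\<bar> \<le> 1 / 4"
    by (rule search_orbit) (use R in auto)
  moreover have "1 \<le> real (Suc (prod_encode (e, K)))" by simp
  ultimately show False by linarith
qed

subsection \<open>Analyticity\<close>

lemma denom_of_real: "denom q n (of_real x :: complex) = of_real (denom q n x)"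
  by (simp add: denom_def)

lemma summand_of_real: "summand V q (of_real x :: complex) = of_real (summand V q x)"
  by (simp add: summand_def bump_def denom_of_real)

text \<open>On the unit ball around \<open>x0\<close> all but the first \<open>Q\<close> summands
  are far and dominated by a geometric series. The remaining finitely many have no poles on the real
  line, so a smaller ball avoids their poles.\<close>

lemma interp_holomorphic_extension:
  obtains r G where "0 < r" "G holomorphic_on ball (of_real x0) r"
    "\<And>u. \<bar>u - x0\<bar> < r \<Longrightarrow> G (of_real u) = of_real (interp V u)"
proof -
  let ?z0 = "of_real x0 :: complex"
  define Q where "Q = nat \<lceil>\<bar>x0\<bar>\<rceil> + 1"
  define S where "S = ball ?z0 1 \<inter> (\<Inter>q\<in>{..<Q}. {z. denom q (expo V q) z \<noteq> 0})"
  have "continuous_on UNIV (\<lambda>z. denom q n z :: complex)" for q n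
    unfolding denom_def by (intro continuous_intros)
  then have "open {z :: complex. denom q n z \<noteq> 0}" for q n
    by (intro open_Collect_neq continuous_on_const)
  then have S: "open S" unfolding S_def by (intro open_Int open_ball open_INT) auto
  have "?z0 \<in> S"
  proof -
    have "denom q n ?z0 \<noteq> 0" for q n
      using denom_real[of q n x0] unfolding denom_of_real of_real_eq_0_iff by linarith
    then show ?thesis by (simp add: S_def)
  qed
  then obtain r where r: "0 < r" "ball ?z0 r \<subseteq> S" using S open_contains_ball by blast
  have far: "3 / 4 \<le> norm (z - of_nat (Suc q))" if "z \<in> S" "Q \<le> q" for z q
  proof -
    have "real q \<ge> \<bar>x0\<bar> + 1" using that(2) unfolding Q_def by linarith
    moreover have "norm (z - ?z0) < 1" using that(1) by (simp add: S_def dist_norm norm_minus_commute)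
    moreover have "norm (of_nat (Suc q) :: complex) \<le> norm (z - of_nat (Suc q)) + norm z"
      using norm_triangle_ineq[of "of_nat (Suc q) - z" z]
      unfolding norm_minus_commute[of "of_nat (Suc q)" z] diff_add_cancel .
    moreover have "norm z \<le> norm (z - ?z0) + \<bar>x0\<bar>"
      using norm_triangle_ineq[of "z - ?z0" ?z0] by simp
    ultimately show ?thesis unfolding norm_of_nat by linarith
  qed
  have nz: "denom q (expo V q) z \<noteq> 0" if "z \<in> S" for z q
  proof (cases "q < Q")
    case False
    then have "2 ^ expo V q / 2 \<le> norm (denom q (expo V q) z)"
      using far[OF that] by (intro far_bounds) (auto simp: expo_def)
    then show ?thesis by (metis divide_pos_pos leD norm_zero zero_less_numeral zero_less_power)
  qed (use that in \<open>auto simp: S_def\<close>)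
  have d: "(summand V q has_field_derivative deriv (summand V q) z) (at z)" if "z \<in> S" for q z
  proof -
    have "(\<lambda>z. summand V q z :: complex) holomorphic_on S"
      using nz unfolding summand_def bump_def denom_def
      by (intro holomorphic_intros) auto
    then show ?thesis using S that by (simp add: holomorphic_derivI)
  qed
  have m: "\<forall>\<^sub>F q in sequentially. \<forall>z\<in>S. norm (summand V q z) \<le> (1 / 2) ^ (q + 16)"
    using eventually_ge_at_top[of Q] by eventually_elim (auto intro: summand_far far)
  have s: "summable (\<lambda>q. (1 / 2 :: real) ^ (q + 16))" using geo_sums sums_summable by blast
  obtain G G' where G: "\<forall>z\<in>S. ((\<lambda>q. summand V q z) sums G z) \<and>
      ((\<lambda>q. deriv (summand V q) z) sums G' z) \<and> (G has_field_derivative G' z) (at z)"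
    using series_and_derivative_comparison[OF S s d m] by blast
  have "G (of_real u) = of_real (interp V u)" if "\<bar>u - x0\<bar> < r" for u
  proof -
    have "dist ?z0 (of_real u) = \<bar>u - x0\<bar>"
      by (simp add: dist_norm norm_minus_commute flip: of_real_diff)
    then have "of_real u \<in> S" using that r(2) by auto
    then have "(\<lambda>q. summand V q (of_real u :: complex)) sums G (of_real u)" using G by blast
    moreover have "(\<lambda>q. summand V q (of_real u :: complex)) sums of_real (interp V u)"
      unfolding summand_of_real interp_def by (intro sums_of_real summable_sums summable_summand)
    ultimately show ?thesis by (rule sums_unique2)
  qed
  moreover have "G holomorphic_on ball ?z0 r"
    using G r(2) by (auto simp: holomorphic_on_open)
  ultimately show ?thesis by (intro that[OF r(1)])
qed

lemma interp_power_series: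
  obtains r a where "0 < r"
    "\<And>u. \<bar>u - x0\<bar> < r \<Longrightarrow> ((\<lambda>n. a n * (u - x0) ^ n) has_sum interp V u) UNIV"
proof -
  obtain r G where r: "0 < r" and G: "G holomorphic_on ball (of_real x0) r"
    and ext: "\<And>u. \<bar>u - x0\<bar> < r \<Longrightarrow> G (of_real u) = of_real (interp V u)"
    using interp_holomorphic_extension[of x0 V] by metis
  define b where "b n = (deriv ^^ n) G (of_real x0) / fact n" for n
  have sums: "(\<lambda>n. b n * (of_real (u - x0)) ^ n) sums of_real (interp V u)" if "\<bar>u - x0\<bar> < r" for u
  proof -
    have "of_real u \<in> ball (of_real x0 :: complex) r"
      using that by (simp add: dist_norm norm_minus_commute flip: of_real_diff)
    from holomorphic_power_series[OF G this] show ?thesis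
      using ext[OF that] by (simp add: b_def)
  qed
  have "((\<lambda>n. Re (b n) * (u - x0) ^ n) has_sum interp V u) UNIV" if u: "\<bar>u - x0\<bar> < r" for u
  proof -
    \<comment> \<open>\<open>has_sum\<close> asks for unconditional convergence, which follows from
      convergence at a point \<open>v\<close> farther from the centre.\<close>
    define v where "v = x0 + (\<bar>u - x0\<bar> + r) / 2"
    have v: "\<bar>v - x0\<bar> < r" "\<bar>u - x0\<bar> < \<bar>v - x0\<bar>" using u r by (auto simp: v_def)
    have "summable (\<lambda>n. norm (b n * of_real (u - x0) ^ n))"
      by (rule powser_insidea[OF sums_summable[OF sums[OF v(1)]]])
        (use v(2) in \<open>simp flip: of_real_diff\<close>)
    from norm_summable_imp_has_sum[OF this sums[OF u]]
    have "((\<lambda>n. Re (b n * of_real (u - x0) ^ n)) has_sum Re (of_real (interp V u))) UNIV"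
      by (rule has_sum_Re)
    moreover have "Re (b n * of_real (u - x0) ^ n) = Re (b n) * (u - x0) ^ n" for n
      by (simp flip: of_real_power of_real_diff)
    ultimately show ?thesis by simp
  qed
  then show ?thesis by (rule that[OF r])
qed

section \<open>Maps that depend on one coordinate and take values on its axis\<close>

definition along :: "'n::finite \<Rightarrow> (real \<Rightarrow> real) \<Rightarrow> real ^ 'n \<Rightarrow> real ^ 'n" where
  "along j g x = axis j (g (x $ j))"

lemma along_nth: "along j g x $ i = (if i = j then g (x $ j) else 0)"
  by (simp add: along_def axis_def)

lemma norm_axis: "norm (axis j c :: real ^ 'n) = \<bar>c\<bar>"
  by (simp add: norm_eq_sqrt_inner inner_axis_axis)

lemma bounded_linear_axis: "bounded_linear (\<lambda>c. axis j c :: real ^ 'n)"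
proof -
  have "(\<lambda>c. axis j c :: real ^ 'n) = (\<lambda>c. c *\<^sub>R axis j 1)"
    by (auto simp: axis_def vec_eq_iff)
  then show ?thesis by (rule ssubst) (rule bounded_linear_scaleR_left)
qed

lemma real_analytic_along: "real_analytic (along (j :: 'n::finite) (interp V))"
  unfolding real_analytic_def
proof
  fix x :: "real ^ 'n"
  obtain r a where r: "0 < r" and
    a: "\<And>u. \<bar>u - x $ j\<bar> < r \<Longrightarrow> ((\<lambda>n. a n * (u - x $ j) ^ n) has_sum interp V u) UNIV"
    using interp_power_series[of "x $ j" V] by metis
  \<comment> \<open>The multi-indices with \<open>n\<close> at \<open>j\<close> and 0 elsewhere; all
    others get the coefficient 0.\<close>
  define h where "h n = (\<lambda>i. if i = j then n else (0::nat))" for n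
  define c :: "('n \<Rightarrow> nat) \<Rightarrow> real ^ 'n"
    where "c \<alpha> = (if \<alpha> \<in> range h then axis j (a (\<alpha> j)) else 0)" for \<alpha>
  have "((\<lambda>\<alpha>. (\<Prod>i\<in>UNIV. (y $ i - x $ i) ^ \<alpha> i) *\<^sub>R c \<alpha>) has_sum along j (interp V) y) UNIV"
    if y: "y \<in> ball x r" for y
  proof -
    have "\<bar>y $ j - x $ j\<bar> < r"
      using y component_le_norm_cart[of "y - x" j] by (simp add: dist_norm norm_minus_commute)
    from has_sum_bounded_linear[OF bounded_linear_axis a[OF this]]
    have 1: "((\<lambda>n. axis j (a n * (y $ j - x $ j) ^ n)) has_sum along j (interp V) y) UNIV"
      unfolding along_def by blast
    have "inj h" by (rule injI) (metis h_def)
    have "(\<Prod>i\<in>UNIV. (y $ i - x $ i) ^ h n i) = (y $ j - x $ j) ^ n" for n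
    proof -
      have "(\<Prod>i\<in>UNIV. (y $ i - x $ i) ^ h n i) = (\<Prod>i\<in>UNIV. if i = j then (y $ i - x $ i) ^ n else 1)"
        by (intro prod.cong) (auto simp: h_def)
      then show ?thesis by simp
    qed
    then have "(\<Prod>i\<in>UNIV. (y $ i - x $ i) ^ h n i) *\<^sub>R c (h n) = axis j (a n * (y $ j - x $ j) ^ n)" for n
      by (simp add: c_def h_def vec_eq_iff axis_def mult.commute)
    then have "((\<lambda>\<alpha>. (\<Prod>i\<in>UNIV. (y $ i - x $ i) ^ \<alpha> i) *\<^sub>R c \<alpha>) has_sum along j (interp V) y) (range h)"
      using 1 unfolding has_sum_reindex[OF \<open>inj h\<close>] by (simp add: o_def)
    then show ?thesis
      by (rule has_sum_cong_neutral[THEN iffD1, rotated -1]) (auto simp: c_def)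
  qed
  with r show "real_analytic_at (along j (interp V)) x"
    unfolding real_analytic_at_def by blast
qed

lemma funpow_along: "(along j g ^^ Suc k) x = axis j ((g ^^ Suc k) (x $ j))"
  by (induction k) (auto simp: along_def)

lemma tendsto_axis_iff:
  "(\<lambda>k. axis j (h k)) \<longlonglongrightarrow> (0 :: real ^ 'n) \<longleftrightarrow> h \<longlonglongrightarrow> (0 :: real)"
proof -
  have "(\<lambda>k. axis j (h k)) \<longlonglongrightarrow> (0 :: real ^ 'n) \<longleftrightarrow> (\<lambda>k. norm (axis j (h k) :: real ^ 'n)) \<longlonglongrightarrow> 0"
    by (rule tendsto_norm_zero_iff[symmetric])
  also have "\<dots> \<longleftrightarrow> h \<longlonglongrightarrow> 0"
    unfolding norm_axis by (rule tendsto_rabs_zero_iff)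
  finally show ?thesis .
qed

lemma basin_along: "basin (along (j :: 'n::finite) g) 0 = {x. (\<lambda>k. (g ^^ k) (x $ j)) \<longlonglongrightarrow> 0}"
proof -
  have "(\<lambda>k. (along j g ^^ k) x) \<longlonglongrightarrow> 0 \<longleftrightarrow> (\<lambda>k. (g ^^ k) (x $ j)) \<longlonglongrightarrow> 0" for x
  proof -
    have "(\<lambda>k. (along j g ^^ k) x) \<longlonglongrightarrow> 0 \<longleftrightarrow> (\<lambda>k. axis j ((g ^^ Suc k) (x $ j))) \<longlonglongrightarrow> (0 :: real ^ 'n)"
      by (subst filterlim_sequentially_Suc[symmetric]) (simp only: funpow_along)
    also have "\<dots> \<longleftrightarrow> (\<lambda>k. (g ^^ Suc k) (x $ j)) \<longlonglongrightarrow> 0"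
      by (rule tendsto_axis_iff)
    also have "\<dots> \<longleftrightarrow> (\<lambda>k. (g ^^ k) (x $ j)) \<longlonglongrightarrow> 0" by (rule filterlim_sequentially_Suc)
    finally show ?thesis .
  qed
  then show ?thesis by (simp add: basin_def)
qed

lemma hyperbolic_sink_along: "hyperbolic_sink (along (j :: 'n::finite) (interp V)) 0"
proof -
  let ?f = "along j (interp V)"
  have g0: "interp V 0 = 0" using interp_origin[of 0 V] by simp
  have f0: "?f 0 = 0" by (simp add: vec_eq_iff along_nth g0)
  have coord: "\<bar>x $ j\<bar> \<le> norm x" for x :: "real ^ 'n" by (rule component_le_norm_cart)
  have "ball 0 (1 / 4) \<subseteq> basin ?f 0"
  proof
    fix x :: "real ^ 'n" assume "x \<in> ball 0 (1 / 4)"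
    then have "\<bar>x $ j\<bar> \<le> 1 / 4" using coord[of x] by simp
    then show "x \<in> basin ?f 0" unfolding basin_along by (simp add: tendsto_origin)
  qed
  with f0 have "sink ?f 0" unfolding sink_def by (intro conjI exI[of _ "ball 0 (1 / 4)"]) auto
  have "(?f has_derivative (\<lambda>h. 0)) (at 0)"
    unfolding has_derivative_at
  proof (intro conjI)
    show "(\<lambda>y. norm (?f (0 + y) - ?f 0 - 0) / norm y) \<midarrow>0\<rightarrow> 0"
    proof (rule Lim_null_comparison)
      have "norm (norm (?f (0 + y) - ?f 0 - 0) / norm y) \<le> norm y" if "dist y 0 < 1 / 4" for y
      proof -
        have "norm (?f y) = \<bar>interp V (y $ j)\<bar>" by (simp add: along_def norm_axis)
        also have "\<dots> \<le> (y $ j) ^ 2"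
          using that coord[of y] by (intro interp_origin) simp
        also have "\<dots> \<le> norm y ^ 2" using power_mono[OF coord[of y], of 2] by simp
        finally have "norm (?f y) \<le> norm y * norm y" by (simp add: power2_eq_square)
        then show ?thesis by (simp add: f0 divide_le_eq)
      qed
      then show "\<forall>\<^sub>F y in at 0. norm (norm (?f (0 + y) - ?f 0 - 0) / norm y) \<le> norm y"
        unfolding eventually_at by (intro exI[of _ "1 / 4"]) auto
      show "(\<lambda>y :: real ^ 'n. norm y) \<midarrow>0\<rightarrow> 0" by (rule tendsto_norm_zero) simp
    qed
  qed simp
  then have diff: "?f differentiable (at 0)" and "frechet_derivative ?f (at 0) = (\<lambda>h. 0)"
    by (rule differentiableI, rule frechet_derivative_at[symmetric])
  then have jac: "jacobian ?f (at 0) = 0"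
    by (simp add: jacobian_def matrix_def vec_eq_iff)
  have "cmod \<mu> < 1" if ev: "complex_eigenvalue (jacobian ?f (at 0)) \<mu>" for \<mu>
  proof -
    obtain v where v: "v \<noteq> 0" "map_matrix of_real (0 :: real ^ 'n ^ 'n) *v v = \<mu> *s v"
      using ev unfolding complex_eigenvalue_def jac by blast
    have "map_matrix of_real (0 :: real ^ 'n ^ 'n) = (0 :: complex ^ 'n ^ 'n)"
      by (simp add: map_matrix_def vec_eq_iff)
    then have "\<mu> *s v = 0" using v(2) by simp
    with v(1) show ?thesis by (simp add: vector_mul_eq_0)
  qed
  with \<open>sink ?f 0\<close> diff show ?thesis unfolding hyperbolic_sink_def by auto
qed

lemma sorted_list_3: "sorted_list_of_set (UNIV :: 3 set) = [0, 1, 2]"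
proof -
  have "(UNIV :: 3 set) = set [0, 1, 2]"
  proof (intro set_eqI)
    fix x :: 3
    \<comment> \<open>Numerals of type \<open>3\<close> are residues, so the value 3 in
      \<open>exhaust_3\<close> is the least element 0.\<close>
    have "(3 :: 3) = 0" by simp
    then show "x \<in> UNIV \<longleftrightarrow> x \<in> set [0, 1, 2]" using exhaust_3[of x] by auto
  qed
  moreover have "sorted [0, 1, 2 :: 3]" "distinct [0, 1, 2 :: 3]"
    by (simp_all add: less_eq_bit1_def bit1.Rep_0 bit1.Rep_1 bit1.Rep_numeral)
  ultimately show ?thesis using sorted_list_of_set.idem_if_sorted_distinct by metis
qed

lemma tuple_3: "tuple g = [g 0, g 1, g (2 :: 3)]"
  by (simp add: tuple_def sorted_list_3)

lemma tuple_1: "tuple g = [g (1 :: 1)]"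
  by (simp add: tuple_def UNIV_1)

subsection \<open>Rational approximation\<close>

lemma real_div_error:
  assumes "0 < d" shows "\<bar>real (m div d) - real m / real d\<bar> \<le> 1"
proof -
  have "real m = real (m div d) * real d + real (m mod d)"
    by (metis div_mult_mod_eq of_nat_add of_nat_mult)
  moreover have "real (m mod d) \<le> real d" using assms by (simp add: less_imp_le)
  ultimately show ?thesis using assms by (simp add: field_simps)
qed

text \<open>Multiplying numerator and denominator of the bump by \<open>b ^ (2 * n)\<close> makes
  them natural numbers; even powers remove the signs of \<open>y\<close> and of
  \<open>y - (q + 1)\<close>.\<close>

lemma bump_fraction:
  fixes a b w n :: nat
  assumes b: "0 < b" and n: "0 < n" and y: "\<bar>y\<bar> = real a / real b"
    and w: "real w = \<bar>y - real (Suc q)\<bar> * real b"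
  defines "A \<equiv> a ^ 2 * b ^ (2 * n - 2)" and "C \<equiv> (2 * w) ^ (2 * n)"
  shows "0 < A + C" "bump q n y = real A / real (A + C)"
proof -
  have "y ^ 2 = (real a / real b) ^ 2" using y by (metis power2_abs)
  then have A: "real A = y ^ 2 * real b ^ (2 * n)"
    using b n by (cases n) (simp_all add: A_def power_divide power2_eq_square)
  have "real C = (2 * \<bar>y - real (Suc q)\<bar> * real b) ^ (2 * n)"
    unfolding C_def of_nat_power of_nat_mult w by (simp only: mult.assoc of_nat_numeral)
  also have "\<dots> = (2 * (y - real (Suc q))) ^ (2 * n) * real b ^ (2 * n)"
    unfolding power_mult_distrib power_mult power2_abs by simp
  finally have "real (A + C) = denom q n y * real b ^ (2 * n)"
    using A unfolding denom_def of_nat_add by (simp add: algebra_simps)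
  note AC = this
  have d: "0 < denom q n y" using denom_real[of q n y] by linarith
  have bn: "0 < real b ^ (2 * n)" using b by simp
  have "0 < real (A + C)" unfolding AC using d bn by (rule mult_pos_pos)
  then show "0 < A + C" unfolding of_nat_0_less_iff .
  show "bump q n y = real A / real (A + C)"
    unfolding AC unfolding A bump_def using bn by simp
qed

definition lip :: "(nat \<Rightarrow> nat) \<Rightarrow> nat \<Rightarrow> nat \<Rightarrow> nat" where
  "lip V X q = V q * (16 * (4 * expo V q + 2) * (2 * (X + 1 + Suc q)) ^ (2 * expo V q + 2))"

lemma summand_lipschitz:
  fixes x y :: real
  assumes "\<bar>x\<bar> \<le> real X + 1" "\<bar>y\<bar> \<le> real X + 1"
  shows "\<bar>summand V q x - summand V q y\<bar> \<le> real (lip V X q) * \<bar>x - y\<bar>"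
proof -
  have "\<bar>summand V q x - summand V q y\<bar> = real (V q) * \<bar>bump q (expo V q) x - bump q (expo V q) y\<bar>"
    unfolding summand_def right_diff_distrib[symmetric] abs_mult by simp
  also have "\<dots> \<le> real (V q) * (16 * (4 * real (expo V q) + 2) *
      (2 * (real X + 1 + real (Suc q))) ^ (2 * expo V q + 2) * \<bar>x - y\<bar>)"
    by (intro mult_left_mono bump_lipschitz[OF assms refl]) simp
  also have "\<dots> = real (lip V X q) * \<bar>x - y\<bar>"
    by (simp only: lip_def of_nat_mult of_nat_add of_nat_power of_nat_numeral of_nat_1 mult.assoc)
  finally show ?thesis .
qed

text \<open>Four errors of at most \<open>1 / 2 ^ (k + 3)\<close> each: truncation after
  \<open>Q\<close> summands, passage from \<open>x\<close> to the oracle value \<open>y\<close>,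
  rounding of the summands, and the \<open>+ 1\<close> that makes the numerator odd. The bounds
  \<open>B <= 2 ^ B\<close> and \<open>Q <= 2 ^ Q\<close> avoid logarithms in the choice of the
  precisions.\<close>

lemma interp_approx:
  fixes x y :: real
  assumes x: "\<bar>x\<bar> \<le> real X" and Q: "Q = X + k + 5" and P: "P = k + 3 + Q"
    and B: "B = (\<Sum>q<Q. lip V X q)" and y: "\<bar>x - y\<bar> \<le> 1 / 2 ^ (k + 3 + B)"
    and s: "\<And>q. \<bar>real (s q) - 2 ^ P * summand V q y\<bar> \<le> 1"
  shows "\<bar>interp V x - real (2 * (\<Sum>q<Q. s q) + 1) / 2 ^ (P + 1)\<bar> < 1 / 2 ^ k"
proof -
  define e :: real where "e = 1 / 2 ^ (k + 3)"
  have e: "0 < e" by (simp add: e_def)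
  have "1 / 2 ^ (k + 3 + B) \<le> (1 :: real)" by simp
  then have y1: "\<bar>y\<bar> \<le> real X + 1" "\<bar>x\<bar> \<le> real X + 1" using x y by linarith+
  have 1: "\<bar>interp V x - (\<Sum>q<Q. summand V q x)\<bar> \<le> e"
  proof -
    have "\<bar>summand V q x\<bar> \<le> (1 / 2) ^ (q + 16) * 1" if "Q \<le> q" for q
    proof -
      have "real X + 1 \<le> real (Suc q)" using that Q by simp
      then have "3 / 4 \<le> norm (x - of_nat (Suc q))" using x unfolding real_norm_def by linarith
      then show ?thesis using summand_far(1)[of x q V] by simp
    qed
    from interp_tail[OF this] have "\<bar>interp V x - (\<Sum>q<Q. summand V q x)\<bar> \<le> (1 / 2) ^ (Q + 15)"
      by simp
    also have "\<dots> \<le> (1 / 2) ^ (k + 3)" using Q by (intro power_decreasing) auto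
    finally show ?thesis by (simp add: e_def power_one_over)
  qed
  have 2: "\<bar>(\<Sum>q<Q. summand V q x) - (\<Sum>q<Q. summand V q y)\<bar> \<le> e"
  proof -
    have "\<bar>(\<Sum>q<Q. summand V q x) - (\<Sum>q<Q. summand V q y)\<bar> \<le> (\<Sum>q<Q. real (lip V X q) * \<bar>x - y\<bar>)"
      unfolding sum_subtractf[symmetric] by (intro sum_abs[THEN order_trans] sum_mono summand_lipschitz y1)
    also have "\<dots> = real B * \<bar>x - y\<bar>" by (simp add: B sum_distrib_right)
    also have "\<dots> \<le> 2 ^ B * (1 / 2 ^ (k + 3 + B))"
      by (intro mult_mono of_nat_le_power2 y) auto
    also have "\<dots> = e" by (simp add: e_def power_add)
    finally show ?thesis .
  qed
  have 3: "\<bar>(\<Sum>q<Q. summand V q y) - real (\<Sum>q<Q. s q) / 2 ^ P\<bar> \<le> e"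
  proof -
    have "\<bar>summand V q y - real (s q) / 2 ^ P\<bar> \<le> 1 / 2 ^ P" for q
    proof -
      have "summand V q y - real (s q) / 2 ^ P = - (real (s q) - 2 ^ P * summand V q y) / 2 ^ P"
        by (simp add: field_simps)
      then show ?thesis using s[of q] by (simp add: divide_right_mono)
    qed
    then have "\<bar>\<Sum>q<Q. summand V q y - real (s q) / 2 ^ P\<bar> \<le> (\<Sum>q<Q. 1 / 2 ^ P)"
      by (intro sum_abs[THEN order_trans] sum_mono)
    moreover have "(\<Sum>q<Q. summand V q y) - real (\<Sum>q<Q. s q) / 2 ^ P =
        (\<Sum>q<Q. summand V q y - real (s q) / 2 ^ P)"
      by (simp add: sum_subtractf sum_divide_distrib)
    ultimately have "\<bar>(\<Sum>q<Q. summand V q y) - real (\<Sum>q<Q. s q) / 2 ^ P\<bar> \<le> real Q * (1 / 2 ^ P)"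
      by simp
    also have "\<dots> \<le> 2 ^ Q * (1 / 2 ^ P)" by (intro mult_right_mono of_nat_le_power2) simp
    also have "\<dots> = e" by (simp add: e_def P power_add)
    finally show ?thesis .
  qed
  have 4: "real (2 * (\<Sum>q<Q. s q) + 1) / 2 ^ (P + 1) = real (\<Sum>q<Q. s q) / 2 ^ P + 1 / 2 ^ (P + 1)"
    by (simp add: field_simps)
  have "1 / 2 ^ (P + 1) = (1 / 2 :: real) ^ (P + 1)" by (simp add: power_one_over)
  also have "\<dots> \<le> (1 / 2) ^ (k + 3)" by (intro power_decreasing) (auto simp: P)
  also have "\<dots> = e" by (simp add: e_def power_one_over)
  finally have 5: "1 / 2 ^ (P + 1) \<le> e" .
  have 6: "0 \<le> 1 / (2 :: real) ^ (P + 1)" by simp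
  have "8 * e = 1 / 2 ^ k" by (simp add: e_def power_add)
  then show ?thesis unfolding 4 using 1 2 3 5 6 e by linarith
qed

subsection \<open>Computability of the interpolation\<close>

text \<open>
  For a rational number \<open>y\<close> with code \<open>c\<close>, \<open>gap c q\<close> is the numerator of the distance of \<open>y\<close> to
  \<open>Suc q\<close>; the two truncated differences cover both signs.
\<close>

definition gap :: "nat \<Rightarrow> nat \<Rightarrow> nat" where
  "gap c q = (let a = p1 (p2 c); b = Suc q * p2 (p2 c) in
     if p1 c = 0 then (a - b) + (b - a) else a + b)"

definition digit :: "(nat \<Rightarrow> nat) \<Rightarrow> nat \<Rightarrow> nat \<Rightarrow> nat \<Rightarrow> nat" where
  "digit V P c q = (let A = p1 (p2 c) ^ 2 * p2 (p2 c) ^ (2 * expo V q - 2) in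
     (2 ^ P * V q * A) div (A + (2 * gap c q) ^ (2 * expo V q)))"

text \<open>Denominators are at least 1, so the numerator bounds the absolute value of the oracle's
  first rational; the successor pays for its error of at most 1.\<close>

definition size_bound :: "(nat \<Rightarrow> rat) \<Rightarrow> nat" where
  "size_bound \<phi> = Suc (p1 (p2 (rat_code (\<phi> 0))))"

definition cutoff :: "(nat \<Rightarrow> rat) \<Rightarrow> nat \<Rightarrow> nat" where
  "cutoff \<phi> k = size_bound \<phi> + k + 5"

definition precision :: "(nat \<Rightarrow> nat) \<Rightarrow> (nat \<Rightarrow> rat) \<Rightarrow> nat \<Rightarrow> nat" where
  "precision V \<phi> k = k + 3 + (\<Sum>q<cutoff \<phi> k. lip V (size_bound \<phi>) q)"

definition approx_num :: "(nat \<Rightarrow> nat) \<Rightarrow> (nat \<Rightarrow> rat) \<Rightarrow> nat \<Rightarrow> nat" where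
  "approx_num V \<phi> k =
     (\<Sum>q<cutoff \<phi> k. digit V (k + 3 + cutoff \<phi> k) (rat_code (\<phi> (precision V \<phi> k))) q)"

lemma prec_approx:
  assumes V: "prec (\<lambda>\<phi>. V)"
  shows "prec (\<lambda>\<phi> k. pc (2 * approx_num V \<phi> k + 1) (2 ^ (k + 3 + cutoff \<phi> k + 1)))"
proof -
  note V' = prec.comp[OF V]
  have cutoff: "prec F \<Longrightarrow> prec (\<lambda>\<phi> x. cutoff \<phi> (F \<phi> x))" for F
    unfolding cutoff_def size_bound_def by (intro prec_intros)
  have expo: "prec F \<Longrightarrow> prec (\<lambda>\<phi> x. expo V (F \<phi> x))" for F
    unfolding expo_def by (intro V' prec_intros)
  have lip: "prec F \<Longrightarrow> prec (\<lambda>\<phi> x. lip V (size_bound \<phi>) (F \<phi> x))" for F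
    unfolding lip_def size_bound_def by (intro V' expo prec_intros)
  have precision: "prec F \<Longrightarrow> prec (\<lambda>\<phi> x. precision V \<phi> (F \<phi> x))" for F
    unfolding precision_def by (intro prec_intros cutoff lip)
  have digit: "prec P \<Longrightarrow> prec C \<Longrightarrow> prec Q \<Longrightarrow> prec (\<lambda>\<phi> x. digit V (P \<phi> x) (C \<phi> x) (Q \<phi> x))" for P C Q
    unfolding digit_def gap_def Let_def by (intro prec_intros V' expo)
  show ?thesis
    unfolding approx_num_def by (intro prec_intros cutoff digit precision)
qed

lemma rat_codeE:
  obtains a b where "quotient_of r = (a, b)" "0 < b"
    "rat_code r = pc (if a < 0 then 1 else 0) (pc (nat \<bar>a\<bar>) (nat b))"
    "real_of_rat r = real_of_int a / real_of_int b"
proof -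
  obtain a b where q: "quotient_of r = (a, b)" by fastforce
  have "real_of_rat r = real_of_int a / real_of_int b"
    unfolding quotient_of_div[OF q] by (simp add: of_rat_divide)
  then show ?thesis
    using that[OF q quotient_of_denom_pos[OF q]] q by (simp add: rat_code_def)
qed

lemma digit_error:
  "\<bar>real (digit V P (rat_code r) q) - 2 ^ P * summand V q (real_of_rat r)\<bar> \<le> 1"
proof -
  obtain a b where ab: "quotient_of r = (a, b)" "0 < b"
    "rat_code r = pc (if a < 0 then 1 else 0) (pc (nat \<bar>a\<bar>) (nat b))"
    "real_of_rat r = real_of_int a / real_of_int b"
    using rat_codeE .
  let ?y = "real_of_rat r" and ?w = "gap (rat_code r) q" and ?n = "expo V q"
  define A where "A = nat \<bar>a\<bar> ^ 2 * nat b ^ (2 * ?n - 2)"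
  define C where "C = (2 * ?w) ^ (2 * ?n)"
  have y: "\<bar>?y\<bar> = real (nat \<bar>a\<bar>) / real (nat b)" using ab by (simp add: abs_divide)
  have "int ?w = \<bar>a - int (Suc q) * b\<bar>"
  proof -
    define m where "m = Suc q * nat b"
    have "gap (rat_code r) q = (if a < 0 then nat \<bar>a\<bar> + m else (nat \<bar>a\<bar> - m) + (m - nat \<bar>a\<bar>))"
      by (simp add: gap_def ab(3) m_def Let_def)
    then have "int ?w = \<bar>a - int m\<bar>" by (cases "a < 0") auto
    also have "int m = int (Suc q) * b" using ab(2) by (simp add: m_def algebra_simps)
    finally show ?thesis .
  qed
  then have "real ?w = \<bar>real_of_int a - real (Suc q) * real_of_int b\<bar>"
    by (metis of_int_abs of_int_diff of_int_mult of_int_of_nat_eq)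
  also have "\<dots> = \<bar>(?y - real (Suc q)) * real_of_int b\<bar>"
    using ab by (simp add: field_simps)
  finally have w: "real ?w = \<bar>?y - real (Suc q)\<bar> * real (nat b)"
    using ab(2) by (simp add: abs_mult)
  have "0 < A + C" "bump q ?n ?y = real A / real (A + C)"
    unfolding A_def C_def by (rule bump_fraction[OF _ _ y w]; use ab(2) in \<open>simp add: expo_def\<close>)+
  moreover have "digit V P (rat_code r) q = (2 ^ P * V q * A) div (A + C)"
    by (simp add: digit_def ab(3) A_def C_def Let_def)
  ultimately show ?thesis
    using real_div_error[of "A + C" "2 ^ P * V q * A"] by (simp add: summand_def mult.assoc)
qed

lemma computable_along_interp:
  assumes V: "prec (\<lambda>\<phi>. V)"
  shows "computable_fun (along (0 :: 3) (interp V))"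
proof -
  define F where "F \<phi> k = pc (2 * approx_num V \<phi> k + 1) (2 ^ (k + 3 + cutoff \<phi> k + 1))" for \<phi> k
  have "prec F" using prec_approx[OF V] unfolding F_def .
  from outputs_prec[OF this] obtain M where M: "wf_otm M"
    "\<And>\<phi>s k r. \<phi>s \<noteq> [] \<Longrightarrow> quotient_of r = (int (p1 (F (\<phi>s ! 0) k)), int (p2 (F (\<phi>s ! 0) k))) \<Longrightarrow>
      outputs M \<phi>s k [r, 0, 0]" by blast
  have "\<exists>r. outputs M (tuple \<phi>) k (tuple r) \<and>
      (\<forall>j. \<bar>along 0 (interp V) x $ j - real_of_rat (r j)\<bar> < 1 / 2 ^ k)"
    if \<phi>: "is_oracle_vec \<phi> x" for x :: "real ^ 3" and \<phi> k
  proof -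
    let ?\<phi> = "\<phi> 0"
    let ?S = "approx_num V ?\<phi> k" and ?P = "k + 3 + cutoff ?\<phi> k"
    let ?r = "Fract (int (2 * ?S + 1)) (int (2 ^ (?P + 1)))"
    have orc: "\<bar>x $ 0 - of_rat (?\<phi> i)\<bar> \<le> 1 / 2 ^ i" for i
      using \<phi> by (simp add: is_oracle_vec_def is_oracle_def)
    \<comment> \<open>An odd number over a power of 2 is in lowest terms, so the emitted numerator
      and denominator are those of \<open>quotient_of\<close>.\<close>
    have "coprime (int (2 * ?S + 1)) (int (2 ^ (?P + 1)))"
      by (simp only: coprime_int_iff) simp
    then have q: "quotient_of ?r = (int (2 * ?S + 1), int (2 ^ (?P + 1)))"
      by (simp add: quotient_of_Fract normalize_def)
    have "outputs M (tuple \<phi>) k [?r, 0, 0]"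
      by (rule M(2)) (simp add: tuple_3, simp only: tuple_3 nth_Cons_0 F_def prod_encode_inverse fst_conv snd_conv q)
    moreover have "tuple (\<lambda>j :: 3. if j = 0 then ?r else 0) = [?r, 0, 0]"
      by (simp only: tuple_3) simp
    ultimately have out: "outputs M (tuple \<phi>) k (tuple (\<lambda>j :: 3. if j = 0 then ?r else 0))"
      by (simp only:)
    have X: "\<bar>x $ 0\<bar> \<le> real (size_bound ?\<phi>)"
    proof -
      obtain a b where ab: "0 < b" "rat_code (?\<phi> 0) = pc (if a < 0 then 1 else 0) (pc (nat \<bar>a\<bar>) (nat b))"
        "real_of_rat (?\<phi> 0) = real_of_int a / real_of_int b"
        using rat_codeE .
      have "\<bar>real_of_rat (?\<phi> 0)\<bar> = real_of_int \<bar>a\<bar> / real_of_int b"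
        using ab by (simp add: abs_divide)
      also have "\<dots> \<le> real_of_int \<bar>a\<bar> / 1"
        using ab(1) by (intro divide_left_mono) auto
      finally have "\<bar>real_of_rat (?\<phi> 0)\<bar> \<le> real_of_int \<bar>a\<bar>" by simp
      moreover have "real (size_bound ?\<phi>) = real_of_int \<bar>a\<bar> + 1"
        by (simp add: size_bound_def ab(2))
      moreover have "\<bar>x $ 0 - real_of_rat (?\<phi> 0)\<bar> \<le> 1" using orc[of 0] by simp
      ultimately show ?thesis by linarith
    qed
    have "\<bar>interp V (x $ 0) - real (2 * ?S + 1) / 2 ^ (?P + 1)\<bar> < 1 / 2 ^ k"
      unfolding approx_num_def
      by (rule interp_approx[OF X cutoff_def refl refl orc[of "precision V ?\<phi> k", unfolded precision_def]])
        (use digit_error in \<open>simp add: precision_def\<close>)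
    moreover have "real_of_rat ?r = real (2 * ?S + 1) / 2 ^ (?P + 1)"
    proof -
      have "real_of_rat (Fract (int m) (int (2 ^ n))) = real m / 2 ^ n" for m n
        by (simp add: of_rat_rat)
      then show ?thesis .
    qed
    ultimately have "\<forall>j. \<bar>along 0 (interp V) x $ j - real_of_rat (if j = 0 then ?r else 0)\<bar> < 1 / 2 ^ k"
      by (simp add: along_nth)
    with out show ?thesis by blast
  qed
  then show ?thesis unfolding computable_fun_def using M(1) by blast
qed

section \<open>The basin of attraction\<close>

lemma prec_search: "prec (\<lambda>\<phi>. search accepts)"
proof -
  have "prec (\<lambda>\<phi> q. if accepts (p1 q) (p2 q) then 0 else Suc (pc (p1 q) (Suc (p2 q))))"
    by (intro prec_if prec_accepts prec_intros)
  from prec_cong[OF this, of "\<lambda>\<phi>. search accepts"] show ?thesis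
    by (simp add: search_def case_prod_beta)
qed

text \<open>The machine is refuted by its own answer: if the output is accepted as small, the orbit
  ends in the sink and the distance is large; otherwise the point is outside the basin and the
  distance is 0.\<close>

lemma basin_not_computable:
  "\<not> computable_open_set (basin (along (0 :: 3) (interp (search accepts))) 0)"
proof
  let ?g = "interp (search accepts)"
  let ?U = "basin (along (0 :: 3) ?g) 0"
  assume "computable_open_set ?U"
  then obtain M where M: "wf_otm M"
    "\<And>x \<phi> k. is_oracle_vec \<phi> x \<Longrightarrow> \<exists>r. outputs M (tuple \<phi>) k (tuple r) \<and>
      (\<forall>j. \<bar>(vec (infdist x (- ?U)) :: real ^ 1) $ j - of_rat (r j)\<bar> < 1 / 2 ^ k)"
    unfolding computable_open_set_def computable_fun_def by blast
  define e where "e = otm_code M"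
  define v where "v = Suc (pc e 0)"
  define x :: "real ^ 3" where "x = axis 0 (real v)"
  define \<phi> :: "3 \<Rightarrow> nat \<Rightarrow> rat" where "\<phi> i = (\<lambda>k. if i = 0 then of_nat v else 0)" for i
  have "is_oracle_vec \<phi> x"
    by (simp add: is_oracle_vec_def is_oracle_def \<phi>_def x_def axis_def)
  from M(2)[OF this, of 4] obtain r where r: "outputs M (tuple \<phi>) 4 (tuple r)"
    "\<forall>j. \<bar>(vec (infdist x (- ?U)) :: real ^ 1) $ j - of_rat (r j)\<bar> < 1 / 2 ^ 4" by blast
  from r(2) have "\<bar>infdist x (- ?U) - of_rat (r 1)\<bar> < 1 / 2 ^ 4" by simp
  moreover note r(1)
  moreover have "tuple \<phi> = point_oracles v"
    by (simp add: tuple_3 \<phi>_def point_oracles_def)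
  ultimately have out: "outputs M (point_oracles (Suc (pc (otm_code M) 0))) 4 [r 1]"
    and r: "\<bar>infdist x (- ?U) - of_rat (r 1)\<bar> < 1 / 16"
    by (simp_all add: tuple_1 v_def e_def)
  show False
  proof (cases "\<exists>t. accepts e t")
    case True
    then obtain t where t: "accepts e t" ..
    have ball: "y \<in> ?U" if "dist x y < 1 / 4" for y
    proof -
      have "\<bar>y $ 0 - x $ 0\<bar> < 1 / 4"
        using that component_le_norm_cart[of "y - x" 0] by (simp add: dist_norm norm_minus_commute)
      then have "\<bar>y $ 0 - real (Suc (pc e 0))\<bar> \<le> 1 / 4"
        by (simp add: x_def v_def axis_def)
      from search_success[OF this, of accepts, OF t] show ?thesis by (simp add: basin_along)
    qed
    \<comment> \<open>The value of \<open>infdist\<close> for the empty set is 0 by convention,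
      which would spoil the lower bound; the point belonging to the code 0 keeps the complement
      nonempty.\<close>
    have "axis 0 (real (Suc (pc 0 0))) \<in> - ?U"
      using search_failure[of accepts 0] not_accepts_0 by (simp add: basin_along axis_def)
    then have ne: "- ?U \<noteq> {}" by blast
    have "1 / 4 \<le> infdist x (- ?U)"
      unfolding infdist_notempty[OF ne]
      by (rule cINF_greatest[OF ne]) (use ball not_less in blast)
    \<comment> \<open>The distance is at least 1/4 and the output is off by less than 1/16, so it
      exceeds 3/16.\<close>
    then have "1 / 8 < real_of_rat (r 1)" using r by linarith
    moreover have "real_of_rat (r 1) \<le> real_of_rat (1 / 8)"
      unfolding of_rat_less_eq using accepts_large_output[OF M(1) out] t by (simp add: e_def)
    ultimately show False by (simp add: of_rat_divide)
  next
    case False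
    then have "x \<in> - ?U"
      using search_failure[of accepts e] by (simp add: basin_along x_def v_def axis_def)
    then have "\<bar>real_of_rat (r 1)\<bar> < 1 / 16" using r by simp
    then have "real_of_rat \<bar>r 1\<bar> < real_of_rat (1 / 16)" by (simp add: of_rat_divide)
    then have "\<bar>r 1\<bar> < 1 / 16" unfolding of_rat_less .
    from accepts_small_output[OF M(1) out this] False show False by (simp add: e_def)
  qed
qed

theorem theorem3p1:
  shows "\<exists>f :: real ^ 3 \<Rightarrow> real ^ 3.
    real_analytic f \<and> computable_fun f \<and>
    (\<exists>s. computable_point s \<and> hyperbolic_sink f s \<and> \<not> computable_open_set (basin f s))"
proof (intro exI conjI)
  obtain M where "wf_otm M" "\<And>\<phi>s k. outputs M \<phi>s k [0, 0, 0]" using outputs_zeros by blast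
  then show "computable_point (0 :: real ^ 3)"
    unfolding computable_point_def
    by (intro exI[of _ M] exI[of _ "\<lambda>i k. 0"])
      (simp add: tuple_3 is_oracle_vec_def is_oracle_def)
qed (rule real_analytic_along computable_along_interp[OF prec_search] hyperbolic_sink_along
  basin_not_computable)+

end
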